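(* Consider the well-posed port-Hamiltonian system with constant uniform wave speed $$\frac{\partial}{\partial t}z(\zeta,t)=-\lambda_0\frac{\partial}{\partial\zeta}z(\zeta,t),\quad z(\zeta,0)=z_0(\zeta),\quad \begin{bmatrix}0\\ u(t)\end{bmatrix}=-\lambda_0Kz(0,t)-\lambda_0Lz(1,t),\quad y(t)=-\lambda_0K_yz(0,t)-\lambda_0L_yz(1,t),$$ for $\zeta\in(0,1)$, $t\ge0$, as described in the context. Then the zero dynamics of this system is well-posed, and the dynamics restricted to the largest output nulling subspace $V^*$ is a port-Hamiltonian system without inputs.
   Context: Here $\lambda_0>0$ is a constant, $K=\begin{bmatrix}K_0\\ K_u\end{bmatrix}$, $L=\begin{bmatrix}L_0\\ L_u\end{bmatrix}\in\mathbb{C}^{n\times n}$ with $K_0,L_0\in\mathbb{C}^{(n-p)\times n}$, $K_u,L_u\in\mathbb{C}^{p\times n}$, and $K_y,L_y\in\mathbb{C}^{m\times n}$; the input is $u(t)\in\mathbb{C}^p$ and the output is $y(t)\in\mathbb{C}^m$. The matrix $K$ is assumed invertible, which is equivalent to well-posedness of the system on $X=L^2(0,1;\mathbb{C}^n)$: for every $z_0\in X$ and $u\in L^2_{loc}(0,\infty;\mathbb{C}^p)$ the mild solution is well-defined in $X$ and the output is well-defined in $L^2_{loc}(0,\infty;\mathbb{C}^m)$. A mild solution is a $z\in C([0,\infty);X)$ such that, for all $t\ge0$, $Z(t)=\int_0^tz(\cdot,\tau)\,d\tau\in H^1(0,1;\mathbb{C}^n)$, $z(\cdot,t)-z_0=-\lambda_0\,\partial_\zeta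 Z(t)$, and the boundary condition holds with $z(\cdot,t),u(t)$ replaced by $Z(t),\int_0^tu$; the output equation is understood in the same integrated sense. The zero dynamics are the pairs $(z_0,u)\in X\times L^2_{loc}(0,\infty;\mathbb{C}^p)$ for which the mild solution satisfies $y=0$. The largest output nulling subspace $V^*$ is the set of $z_0\in X$ for which there exists $u\in L^2_{loc}(0,\infty;\mathbb{C}^p)$ such that the mild solution satisfies $y=0$. The zero dynamics are described by the partial differential equation and initial condition above together with $$0=\begin{bmatrix}K_0\\ K_y\end{bmatrix}z(0,t)+\begin{bmatrix}L_0\\ L_y\end{bmatrix}z(1,t),\qquad u(t)=-\lambda_0K_uz(0,t)-\lambda_0L_uz(1,t).$$ The zero dynamics are called well-posed if this system, with state space $V^*$, no input and output $u$, is well-posed. A port-Hamiltonian system without inputs (with wave speed $\lambda_0$) on a state space $L^2(0,1;W)$, with $W$ a finite-dimensional complex vector space, is a system $$\frac{\partial}{\partial t}z(\zeta,t)=-\lambda_0\frac{\partial}{\partial\zeta}z(\zeta,t),\qquad 0=-\lambda_0K_Wz(0,t)-\lambda_0L_Wz(1,t),$$ with linear maps $K_W,L_W$ from $W$ to a space of dimension $\dim W$; it is well-posed if and only if $K_W$ is invertible. The case $W=\{0\}$ is allowed.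
   Formalization: Well-posedness (uniqueness of z and u), and that every zero dynamics solution solves the system on V*, are proved exactly when z_0=0 has no output-nulling input but u=0; without this the claim fails, e.g. K_y=L_y=0, p≥1. Existence and V*=L^2(0,1;W) hold always. *)

theory Defs
  imports "HOL-Analysis.Analysis"
begin

section \<open>The real inner product space \<open>L\<^sup>2(0,1;E)\<close>\<close>

definition square_integrable_01 :: "(real \<Rightarrow> 'a::euclidean_space) \<Rightarrow> bool" where
  "square_integrable_01 f \<longleftrightarrow>
     set_borel_measurable lborel {0<..<1} f \<and>
     set_integrable lborel {0<..<1} (\<lambda>x. (norm (f x))\<^sup>2)"

definition L2_eq :: "(real \<Rightarrow> 'a::euclidean_space) \<Rightarrow> (real \<Rightarrow> 'a) \<Rightarrow> bool" where
  "L2_eq f g \<longleftrightarrow> square_integrable_01 f \<and> square_integrable_01 g \<and>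
     (AE x in lborel. x \<in> {0<..<1} \<longrightarrow> f x = g x)"

lemma square_integrable_01_zero: "square_integrable_01 (\<lambda>x. 0)"
  by (simp add: square_integrable_01_def set_borel_measurable_def set_integrable_def)

lemma square_integrable_01_scaleR:
  assumes "square_integrable_01 f" shows "square_integrable_01 (\<lambda>x. c *\<^sub>R f x)"
proof -
  have m: "(\<lambda>x. indicator {0<..<1::real} x *\<^sub>R f x) \<in> borel_measurable lborel"
    using assms unfolding square_integrable_01_def set_borel_measurable_def by blast
  have "(\<lambda>x. c *\<^sub>R (indicator {0<..<1} x *\<^sub>R f x)) \<in> borel_measurable lborel"
    by (rule borel_measurable_scaleR[OF borel_measurable_const m])
  moreover have "set_integrable lborel {0<..<1} (\<lambda>x. c\<^sup>2 * (norm (f x))\<^sup>2)"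
    using assms by (auto simp: square_integrable_01_def)
  ultimately show ?thesis
    by (simp add: square_integrable_01_def set_borel_measurable_def power_mult_distrib
        mult.commute[of c])
qed

lemma square_integrable_01_inner:
  assumes f: "square_integrable_01 f" and g: "square_integrable_01 g"
  shows "set_integrable lborel {0<..<1} (\<lambda>x. f x \<bullet> g x)"
proof -
  let ?I = "indicator {0<..<1} :: real \<Rightarrow> real"
  have mf: "(\<lambda>x. ?I x *\<^sub>R f x) \<in> borel_measurable lborel"
    and mg: "(\<lambda>x. ?I x *\<^sub>R g x) \<in> borel_measurable lborel"
    using f g by (auto simp: square_integrable_01_def set_borel_measurable_def)
  have eq: "(?I x *\<^sub>R f x) \<bullet> (?I x *\<^sub>R g x) = ?I x *\<^sub>R (f x \<bullet> g x)" for x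
    by (simp add: indicator_def)
  have "(\<lambda>x. (?I x *\<^sub>R f x) \<bullet> (?I x *\<^sub>R g x)) \<in> borel_measurable lborel"
    using mf mg by measurable
  then have m: "(\<lambda>x. ?I x *\<^sub>R (f x \<bullet> g x)) \<in> borel_measurable lborel"
    by (simp only: eq)
  have i: "integrable lborel (\<lambda>x. ?I x *\<^sub>R (norm (f x))\<^sup>2 + ?I x *\<^sub>R (norm (g x))\<^sup>2)"
    using f g by (auto simp: square_integrable_01_def set_integrable_def)
  have "\<bar>a \<bullet> b\<bar> \<le> (norm a)\<^sup>2 + (norm b)\<^sup>2" for a b :: 'a
  proof -
    have "\<bar>a \<bullet> b\<bar> \<le> norm a * norm b" by (rule Cauchy_Schwarz_ineq2)
    also have "\<dots> \<le> 2 * norm a * norm b" by simp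
    also have "\<dots> \<le> (norm a)\<^sup>2 + (norm b)\<^sup>2" by (rule sum_squares_bound)
    finally show ?thesis .
  qed
  then show ?thesis
    unfolding set_integrable_def
    by (intro Bochner_Integration.integrable_bound[OF i m]) (auto simp: indicator_def)
qed

lemma square_integrable_01_add:
  assumes f: "square_integrable_01 f" and g: "square_integrable_01 g"
  shows "square_integrable_01 (\<lambda>x. f x + g x)"
proof -
  have "(\<lambda>x. indicator {0<..<1::real} x *\<^sub>R f x + indicator {0<..<1} x *\<^sub>R g x)
          \<in> borel_measurable lborel"
    using f g unfolding square_integrable_01_def set_borel_measurable_def
    by (intro borel_measurable_add) simp_all
  moreover have "set_integrable lborel {0<..<1}
      (\<lambda>x. (norm (f x))\<^sup>2 + 2 * (f x \<bullet> g x) + (norm (g x))\<^sup>2)"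
    using f g square_integrable_01_inner[OF f g]
    by (intro set_integral_add) (auto simp: square_integrable_01_def)
  ultimately show ?thesis
    by (simp add: square_integrable_01_def set_borel_measurable_def scaleR_add_right
        power2_norm_eq_inner inner_add_left inner_add_right inner_commute algebra_simps)
qed

lemma L2_eq_part_equivp: "part_equivp (L2_eq :: (real \<Rightarrow> 'a::euclidean_space) \<Rightarrow> _)"
proof (rule part_equivpI)
  show "\<exists>x. L2_eq x (x :: real \<Rightarrow> 'a)"
    by (rule exI[of _ "\<lambda>x. 0"]) (simp add: L2_eq_def square_integrable_01_zero)
  show "symp (L2_eq :: (real \<Rightarrow> 'a) \<Rightarrow> _)"
    by (rule sympI) (auto simp: L2_eq_def elim: AE_mp)
  show "transp (L2_eq :: (real \<Rightarrow> 'a) \<Rightarrow> _)"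
  proof (rule transpI)
    fix f g h :: "real \<Rightarrow> 'a"
    assume a: "L2_eq f g" "L2_eq g h"
    have "AE x in lborel. x \<in> {0<..<1} \<longrightarrow> f x = g x"
      and "AE x in lborel. x \<in> {0<..<1} \<longrightarrow> g x = h x"
      using a by (auto simp: L2_eq_def)
    then have "AE x in lborel. x \<in> {0<..<1} \<longrightarrow> f x = h x" by eventually_elim auto
    with a show "L2_eq f h" by (simp add: L2_eq_def)
  qed
qed

quotient_type (overloaded) 'a L2 = "real \<Rightarrow> 'a::euclidean_space" / partial: L2_eq
  morphisms rep_L2 L2_class
  by (rule L2_eq_part_equivp)

instantiation L2 :: (euclidean_space) real_vector
begin

lift_definition zero_L2 :: "'a L2" is "\<lambda>x. 0"
  by (simp add: L2_eq_def square_integrable_01_zero)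

lift_definition plus_L2 :: "'a L2 \<Rightarrow> 'a L2 \<Rightarrow> 'a L2" is "\<lambda>f g x. f x + g x"
  unfolding L2_eq_def by (auto intro: square_integrable_01_add)

lift_definition scaleR_L2 :: "real \<Rightarrow> 'a L2 \<Rightarrow> 'a L2" is "\<lambda>c f x. c *\<^sub>R f x"
  unfolding L2_eq_def by (auto intro: square_integrable_01_scaleR)

definition uminus_L2 :: "'a L2 \<Rightarrow> 'a L2" where "uminus_L2 f = (-1) *\<^sub>R f"

definition minus_L2 :: "'a L2 \<Rightarrow> 'a L2 \<Rightarrow> 'a L2" where "minus_L2 f g = f + (- g)"

instance
proof
  fix a b c :: "'a L2" and r s :: real
  show "a + b + c = a + (b + c)"
    by transfer (auto simp: L2_eq_def add.assoc intro: square_integrable_01_add)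
  show "a + b = b + a"
    by transfer (auto simp: L2_eq_def add.commute intro: square_integrable_01_add)
  show "0 + a = a"
    by transfer (auto simp: L2_eq_def)
  show "- a + a = 0"
    unfolding uminus_L2_def
    by transfer (auto simp: L2_eq_def square_integrable_01_zero)
  show "a - b = a + - b" by (rule minus_L2_def)
  show "r *\<^sub>R (a + b) = r *\<^sub>R a + r *\<^sub>R b"
    by transfer (auto simp: L2_eq_def scaleR_add_right
        intro!: square_integrable_01_add square_integrable_01_scaleR)
  show "(r + s) *\<^sub>R a = r *\<^sub>R a + s *\<^sub>R a"
    by transfer (auto simp: L2_eq_def scaleR_add_left
        intro!: square_integrable_01_add square_integrable_01_scaleR)
  show "r *\<^sub>R s *\<^sub>R a = (r * s) *\<^sub>R a"
    by transfer (auto simp: L2_eq_def intro!: square_integrable_01_scaleR)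
  show "1 *\<^sub>R a = a"
    by transfer (auto simp: L2_eq_def)
qed

end

text \<open>For \<open>E = \<complex>\<^sup>n\<close> the real inner product below is the real part of the usual complex one;
  it induces the usual norm.\<close>

instantiation L2 :: (euclidean_space) real_inner
begin

lift_definition inner_L2 :: "'a L2 \<Rightarrow> 'a L2 \<Rightarrow> real" is
  "\<lambda>f g. LINT x:{0<..<1}|lborel. f x \<bullet> g x"
proof -
  fix f f' g g' :: "real \<Rightarrow> 'a"
  assume a: "L2_eq f f'" "L2_eq g g'"
  have "AE x in lborel. x \<in> {0<..<1} \<longrightarrow> f x = f' x"
    and "AE x in lborel. x \<in> {0<..<1} \<longrightarrow> g x = g' x"
    using a by (auto simp: L2_eq_def)
  then have ae: "AE x in lborel. indicator {0<..<1::real} x *\<^sub>R (f x \<bullet> g x)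
      = indicator {0<..<1} x *\<^sub>R (f' x \<bullet> g' x)"
    by eventually_elim (auto simp: indicator_def)
  have "set_integrable lborel {0<..<1} (\<lambda>x. f x \<bullet> g x)"
    and "set_integrable lborel {0<..<1} (\<lambda>x. f' x \<bullet> g' x)"
    using a by (auto simp: L2_eq_def intro: square_integrable_01_inner)
  with ae show "(LINT x:{0<..<1}|lborel. f x \<bullet> g x) = (LINT x:{0<..<1}|lborel. f' x \<bullet> g' x)"
    unfolding set_lebesgue_integral_def set_integrable_def
    by (intro integral_cong_AE) auto
qed

definition norm_L2 :: "'a L2 \<Rightarrow> real" where "norm_L2 f = sqrt (f \<bullet> f)"
definition sgn_L2 :: "'a L2 \<Rightarrow> 'a L2" where "sgn_L2 f = f /\<^sub>R norm f"
definition dist_L2 :: "'a L2 \<Rightarrow> 'a L2 \<Rightarrow> real" where "dist_L2 f g = norm (f - g)"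
definition uniformity_L2 :: "('a L2 \<times> 'a L2) filter" where
  "uniformity_L2 = (INF e\<in>{0<..}. principal {(x, y). dist x y < e})"
definition open_L2 :: "'a L2 set \<Rightarrow> bool" where
  "open_L2 S \<longleftrightarrow> (\<forall>x\<in>S. \<forall>\<^sub>F (x', y) in uniformity. x' = x \<longrightarrow> y \<in> S)"

instance
proof
  fix x y z :: "'a L2" and r :: real and S :: "'a L2 set"
  show "dist x y = norm (x - y)" by (rule dist_L2_def)
  show "sgn x = x /\<^sub>R norm x" by (rule sgn_L2_def)
  show "uniformity = (INF e\<in>{0<..}. principal {(x :: 'a L2, y). dist x y < e})"
    by (rule uniformity_L2_def)
  show "open S = (\<forall>x\<in>S. \<forall>\<^sub>F (x', y) in uniformity. x' = x \<longrightarrow> y \<in> S)"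
    by (rule open_L2_def)
  show "norm x = sqrt (x \<bullet> x)" by (rule norm_L2_def)
  show "x \<bullet> y = y \<bullet> x" by transfer (simp add: inner_commute)
  show "(x + y) \<bullet> z = x \<bullet> z + y \<bullet> z"
    by transfer (auto simp: L2_eq_def inner_add_left
        intro!: set_integral_add(2) square_integrable_01_inner)
  show "(r *\<^sub>R x) \<bullet> y = r * (x \<bullet> y)"
    by transfer simp
  show "0 \<le> x \<bullet> x"
    by transfer (auto simp: set_lebesgue_integral_def intro!: integral_nonneg_AE)
  show "(x \<bullet> x = 0) = (x = 0)"
  proof transfer
    fix f :: "real \<Rightarrow> 'a"
    assume "L2_eq f f"
    then have f: "square_integrable_01 f" by (simp add: L2_eq_def)
    have "(LINT x:{0<..<1}|lborel. f x \<bullet> f x) = 0 \<longleftrightarrow>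
        (AE x in lborel. indicator {0<..<1::real} x *\<^sub>R (f x \<bullet> f x) = 0)"
      using square_integrable_01_inner[OF f f]
      unfolding set_lebesgue_integral_def set_integrable_def
      by (intro integral_nonneg_eq_0_iff_AE) auto
    also have "\<dots> \<longleftrightarrow> (AE x in lborel. x \<in> {0<..<1} \<longrightarrow> f x = 0)"
      by (intro AE_cong) (auto simp: indicator_def)
    also have "\<dots> \<longleftrightarrow> L2_eq f (\<lambda>x. 0)"
      using f by (simp add: L2_eq_def square_integrable_01_zero)
    finally show "((LINT x:{0<..<1}|lborel. f x \<bullet> f x) = 0) = L2_eq f (\<lambda>x. 0)" .
  qed
qed

end

text \<open>\<open>L2_on W\<close> is \<open>L\<^sup>2(0,1;W)\<close>, for a subspace \<open>W\<close> of \<open>E\<close>.\<close>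

definition L2_on :: "'a::euclidean_space set \<Rightarrow> 'a L2 set" where
  "L2_on W = {L2_class f |f. square_integrable_01 f \<and> (AE x in lborel. x \<in> {0<..<1} \<longrightarrow> f x \<in> W)}"

text \<open>\<open>H1_rep Z F G\<close>: the class \<open>Z\<close> belongs to \<open>H\<^sup>1(0,1;E)\<close>, its derivative is \<open>G\<close>, and \<open>F\<close> is
  (on \<open>[0,1]\<close>) its absolutely continuous representative, so that \<open>F 0\<close> and \<open>F 1\<close> are the boundary
  values of \<open>Z\<close>.\<close>

definition H1_rep :: "'a::euclidean_space L2 \<Rightarrow> (real \<Rightarrow> 'a) \<Rightarrow> 'a L2 \<Rightarrow> bool" where
  "H1_rep Z F G \<longleftrightarrow> square_integrable_01 F \<and> Z = L2_class F \<and>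
     (\<exists>g. square_integrable_01 g \<and> G = L2_class g \<and>
       (\<forall>x\<in>{0..1}. F x = F 0 + (LINT s:{0<..<x}|lborel. g s)))"

text \<open>\<open>L\<^sup>2\<^sub>l\<^sub>o\<^sub>c(0,\<infinity>;E)\<close> means, as usual for inputs and outputs, square integrable on \<open>(0,T)\<close> for every
  \<open>T\<close>. Its elements are represented by functions; equality is almost everywhere on \<open>(0,\<infinity>)\<close>.\<close>

definition L2_loc :: "(real \<Rightarrow> 'a::euclidean_space) \<Rightarrow> bool" where
  "L2_loc u \<longleftrightarrow> set_borel_measurable lborel {0<..} u \<and>
     (\<forall>T>0. set_integrable lborel {0<..<T} (\<lambda>t. (norm (u t))\<^sup>2))"

section \<open>Port-Hamiltonian systems with uniform wave speed\<close>

text \<open>Integrated form of \<open>\<partial>z/\<partial>t = - \<lambda>\<^sub>0 \<partial>z/\<partial>\<zeta>\<close>, \<open>z(\<cdot>,0) = z\<^sub>0\<close>, boundary conditions not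
  included. \<open>F t\<close> is the absolutely continuous representative of \<open>Z(t) = \<integral>\<^sub>0\<^sup>t z(\<cdot>,\<tau>) d\<tau>\<close>; the latter
  is an integral in \<open>L\<^sup>2(0,1;E)\<close> of a continuous function.\<close>

definition transport_solution ::
    "real \<Rightarrow> 'a::euclidean_space L2 \<Rightarrow> (real \<Rightarrow> 'a L2) \<Rightarrow> (real \<Rightarrow> real \<Rightarrow> 'a) \<Rightarrow> bool" where
  "transport_solution lam z0 z F \<longleftrightarrow> continuous_on {0..} z \<and>
     (\<forall>t\<ge>0. \<exists>Z G. (z has_integral Z) {0..t} \<and> H1_rep Z (F t) G \<and> z t - z0 = - lam *\<^sub>R G)"

text \<open>The row blocks \<open>K\<^sub>u, L\<^sub>u\<close> consist of the rows of \<open>K, L\<close> with index in \<open>U\<close>, the blocks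
  \<open>K\<^sub>0, L\<^sub>0\<close> of the remaining ones; thus \<open>p = card U\<close>, with \<open>0 \<le> p \<le> n\<close>. The input space \<open>\<complex>\<^sup>p\<close> is
  the set of vectors of \<open>\<complex>\<^sup>n\<close> supported on \<open>U\<close>, so that \<open>u t\<close> stands for the whole column
  \<open>[0; u(t)]\<close>.\<close>

definition input_signal :: "'n::finite set \<Rightarrow> (real \<Rightarrow> complex^'n) \<Rightarrow> bool" where
  "input_signal U u \<longleftrightarrow> L2_loc u \<and> (\<forall>t>0. \<forall>i. i \<notin> U \<longrightarrow> u t $ i = 0)"

definition mild_solution ::
    "real \<Rightarrow> complex^'n^'n \<Rightarrow> complex^'n^'n \<Rightarrow> complex^'n^'m \<Rightarrow> complex^'n^'m \<Rightarrow>
     (complex^'n) L2 \<Rightarrow> (real \<Rightarrow> complex^'n) \<Rightarrow> (real \<Rightarrow> (complex^'n) L2) \<Rightarrow> (real \<Rightarrow> complex^'m) \<Rightarrow> bool"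
  where
  "mild_solution lam K L Ky Ly z0 u z y \<longleftrightarrow> L2_loc y \<and>
     (\<exists>F. transport_solution lam z0 z F \<and>
       (\<forall>t\<ge>0. (LINT s:{0<..<t}|lborel. u s) = - lam *\<^sub>R (K *v F t 0) - lam *\<^sub>R (L *v F t 1)) \<and>
       (\<forall>t\<ge>0. (LINT s:{0<..<t}|lborel. y s) = - lam *\<^sub>R (Ky *v F t 0) - lam *\<^sub>R (Ly *v F t 1)))"

definition zero_dynamics ::
    "real \<Rightarrow> complex^'n^'n \<Rightarrow> complex^'n^'n \<Rightarrow> 'n set \<Rightarrow> complex^'n^'m \<Rightarrow> complex^'n^'m \<Rightarrow>
     ((complex^'n) L2 \<times> (real \<Rightarrow> complex^'n)) set" where
  "zero_dynamics lam K L U Ky Ly =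
     {(z0, u). input_signal U u \<and> (\<exists>z. mild_solution lam K L Ky Ly z0 u z (\<lambda>t. 0))}"

definition output_nulling_subspace ::
    "real \<Rightarrow> complex^'n^'n \<Rightarrow> complex^'n^'n \<Rightarrow> 'n set \<Rightarrow> complex^'n^'m \<Rightarrow> complex^'n^'m \<Rightarrow>
     (complex^'n) L2 set" where
  "output_nulling_subspace lam K L U Ky Ly = {z0. \<exists>u. (z0, u) \<in> zero_dynamics lam K L U Ky Ly}"

text \<open>The system describing the zero dynamics: state space \<open>V\<^sup>*\<close>, no input, output \<open>u\<close>.\<close>

definition zero_dynamics_solution ::
    "real \<Rightarrow> complex^'n^'n \<Rightarrow> complex^'n^'n \<Rightarrow> 'n set \<Rightarrow> complex^'n^'m \<Rightarrow> complex^'n^'m \<Rightarrow>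
     (complex^'n) L2 \<Rightarrow> (real \<Rightarrow> (complex^'n) L2) \<Rightarrow> (real \<Rightarrow> complex^'n) \<Rightarrow> bool" where
  "zero_dynamics_solution lam K L U Ky Ly z0 z u \<longleftrightarrow> input_signal U u \<and>
     (\<forall>t\<ge>0. z t \<in> output_nulling_subspace lam K L U Ky Ly) \<and>
     (\<exists>F. transport_solution lam z0 z F \<and>
       (\<forall>t\<ge>0. (\<forall>i. i \<notin> U \<longrightarrow> (K *v F t 0 + L *v F t 1) $ i = 0) \<and>
               Ky *v F t 0 + Ly *v F t 1 = 0 \<and>
               (\<forall>i\<in>U. (LINT s:{0<..<t}|lborel. u s) $ i
                        = (- lam *\<^sub>R (K *v F t 0) - lam *\<^sub>R (L *v F t 1)) $ i)))"

text \<open>Well-posedness: existence and uniqueness of state and output \<open>u\<close>. Existence is no restriction on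
  the data, but uniqueness is: for \<open>Ky = Ly = 0\<close> and \<open>U \<noteq> {}\<close> every input nulls the output, so that
  \<open>V\<^sup>*\<close> is the whole space and the input is not determined by \<open>z\<^sub>0\<close>. By linearity, uniqueness can
  hold only if \<open>z\<^sub>0 = 0\<close> admits no output nulling input but \<open>u = 0\<close>.\<close>

definition zero_dynamics_wellposed ::
    "real \<Rightarrow> complex^'n^'n \<Rightarrow> complex^'n^'n \<Rightarrow> 'n set \<Rightarrow> complex^'n^'m \<Rightarrow> complex^'n^'m \<Rightarrow> bool" where
  "zero_dynamics_wellposed lam K L U Ky Ly \<longleftrightarrow>
     (\<forall>z0\<in>output_nulling_subspace lam K L U Ky Ly.
        (\<exists>z u. zero_dynamics_solution lam K L U Ky Ly z0 z u) \<and>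
        (\<forall>z u z' u'. zero_dynamics_solution lam K L U Ky Ly z0 z u \<and>
                      zero_dynamics_solution lam K L U Ky Ly z0 z' u' \<longrightarrow>
           (\<forall>t\<ge>0. z t = z' t) \<and> (AE t in lborel. t > 0 \<longrightarrow> u t = u' t)))"

text \<open>A port-Hamiltonian system without inputs on \<open>L\<^sup>2(0,1;W)\<close>, with \<open>W\<close> a complex subspace of
  \<open>\<complex>\<^sup>n\<close>. The linear maps \<open>K\<^sub>W, L\<^sub>W : W \<rightarrow> Y\<close> are given by matrices, of which only the restriction to
  \<open>W\<close> matters.\<close>

definition port_hamiltonian_without_input ::
    "(complex^'n) set \<Rightarrow> (complex^'n) set \<Rightarrow> complex^'n^'n \<Rightarrow> complex^'n^'n \<Rightarrow> bool" where
  "port_hamiltonian_without_input W Y KW LW \<longleftrightarrow>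
     vec.subspace W \<and> vec.subspace Y \<and> vec.dim Y = vec.dim W \<and>
     (*v) KW ` W \<subseteq> Y \<and> (*v) LW ` W \<subseteq> Y"

definition phs_solution ::
    "real \<Rightarrow> (complex^'n) set \<Rightarrow> complex^'n^'n \<Rightarrow> complex^'n^'n \<Rightarrow>
     (complex^'n) L2 \<Rightarrow> (real \<Rightarrow> (complex^'n) L2) \<Rightarrow> bool" where
  "phs_solution lam W KW LW z0 z \<longleftrightarrow> (\<forall>t\<ge>0. z t \<in> L2_on W) \<and>
     (\<exists>F. transport_solution lam z0 z F \<and>
       (\<forall>t\<ge>0. - lam *\<^sub>R (KW *v F t 0) - lam *\<^sub>R (LW *v F t 1) = 0))"

definition phs_wellposed ::
    "real \<Rightarrow> (complex^'n) set \<Rightarrow> complex^'n^'n \<Rightarrow> complex^'n^'n \<Rightarrow> bool" where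
  "phs_wellposed lam W KW LW \<longleftrightarrow>
     (\<forall>z0\<in>L2_on W. (\<exists>z. phs_solution lam W KW LW z0 z) \<and>
        (\<forall>z z'. phs_solution lam W KW LW z0 z \<and> phs_solution lam W KW LW z0 z' \<longrightarrow>
           (\<forall>t\<ge>0. z t = z' t)))"

end

theory Submission
  imports Defs
begin

text \<open>
  Along a characteristic nothing changes, so every solution has the form
  \<open>z(\<zeta>,t) = f(\<lambda>\<^sub>0 t - \<zeta>)\<close> with one function \<open>f\<close> on \<open>(-1,\<infinity>)\<close>: on \<open>(-1,0)\<close> it is the reflected
  initial state, and \<open>f(\<lambda>\<^sub>0 t)\<close>, \<open>f(\<lambda>\<^sub>0 t - 1)\<close> are the two boundary values. The boundary condition
  with \<open>y = 0\<close> and with the input eliminated says precisely that \<open>(f(s - 1), f(s))\<close> lies in a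
  linear relation on \<open>\<complex>\<^sup>n\<close> (\<open>transition\<close>) for almost every \<open>s > 0\<close>. The zero dynamics
  therefore decouple into copies of one discrete-time system, one for each \<open>s \<in> (-1,0)\<close>, with
  trajectory \<open>f(s), f(s+1), f(s+2), \<dots>\<close>.

  Let \<open>W\<close> be the set of the points from which an infinite trajectory of this relation starts
  (\<open>viable\<close>). It is a complex subspace, and \<open>V\<^sup>* = L\<^sup>2(0,1;W)\<close>. For the inclusion from left to right,
  the trajectories through almost all \<open>s\<close> stay in the relation
  (\<open>mild_solution_output_nulling\<close>). Conversely every point of \<open>W\<close> has a
  successor in \<open>W\<close>, which can be chosen linearly (\<open>linear_feedback_exists\<close>), say \<open>x \<mapsto> P x\<close>; the
  delay equation \<open>f(s) = P f(s - 1)\<close> then gives a solution with values in \<open>W\<close>. So the restricted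
  system is \<open>z(0,t) = P z(1,t)\<close>, that is \<open>K\<^sub>W = 1\<close> and \<open>L\<^sub>W = -P\<close> on \<open>W\<close>. If \<open>z\<^sub>0 = 0\<close> admits only
  the input \<open>0\<close>, then \<open>0\<close> is the only successor of \<open>0\<close> in \<open>W\<close> (\<open>successor_of_zero\<close>), so the feedback
  is forced, and every solution of the zero dynamics solves this system.

  Two analytical facts carry the reduction. The functions \<open>f(\<lambda>\<^sub>0 t - \<zeta>)\<close> are solutions in the
  integrated sense for every locally square integrable \<open>f\<close> (\<open>transport_solution_wave\<close>); this needs
  the continuity of translation in \<open>L\<^sup>2\<close> and Fubini's theorem. And a solution with initial state \<open>0\<close>
  whose inflow is controlled by its outflow vanishes (\<open>transport_solution_unique_zero\<close>), by an
  energy estimate with the weight \<open>1 + c \<zeta>\<close>. Hence each solution is one of the explicit ones,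
  whose boundary traces are known pointwise almost everywhere.
\<close>

section \<open>Locally square integrable functions\<close>

definition locally_L2 :: "(real \<Rightarrow> 'a::euclidean_space) \<Rightarrow> bool" where
  "locally_L2 f \<longleftrightarrow> f \<in> borel_measurable borel \<and>
     (\<forall>a b. set_integrable lborel {a..b} (\<lambda>s. (norm (f s))\<^sup>2))"

lemma locally_L2_measurable: "locally_L2 f \<Longrightarrow> f \<in> borel_measurable borel"
  by (simp add: locally_L2_def)

lemma locally_L2_integrable_norm:
  assumes "locally_L2 f" "S \<in> sets borel" "S \<subseteq> {a..b}"
  shows "set_integrable lborel S (\<lambda>s. (norm (f s))\<^sup>2)"
  by (rule set_integrable_subset[of lborel "{a..b}"]) (use assms in \<open>auto simp: locally_L2_def\<close>)

lemma locally_L2_bound: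
  assumes "f \<in> borel_measurable borel" "locally_L2 g" "\<And>s. norm (f s) \<le> C * norm (g s)"
  shows "locally_L2 f"
  unfolding locally_L2_def
proof (intro conjI allI)
  fix a b :: real
  have sq: "(norm (f s))\<^sup>2 \<le> C\<^sup>2 * (norm (g s))\<^sup>2" for s
    using power_mono[OF assms(3)[of s], of 2] by (simp add: power_mult_distrib)
  have "set_integrable lborel {a..b} (\<lambda>s. C\<^sup>2 * (norm (g s))\<^sup>2)"
    using assms(2) by (auto simp: locally_L2_def)
  then show "set_integrable lborel {a..b} (\<lambda>s. (norm (f s))\<^sup>2)"
    by (rule set_integrable_bound) (use assms(1) sq in \<open>auto simp: set_borel_measurable_def\<close>)
qed (use assms in simp)

lemma locally_L2_add:
  assumes "locally_L2 f" "locally_L2 g" shows "locally_L2 (\<lambda>s. f s + g s)"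
  unfolding locally_L2_def
proof (intro conjI allI)
  fix a b :: real
  have [measurable]: "f \<in> borel_measurable borel" "g \<in> borel_measurable borel"
    using assms by (auto simp: locally_L2_def)
  show "(\<lambda>s. f s + g s) \<in> borel_measurable borel" by measurable
  have sq: "(norm (f s + g s))\<^sup>2 \<le> 2 * (norm (f s))\<^sup>2 + 2 * (norm (g s))\<^sup>2" for s
  proof -
    have "(norm (f s + g s))\<^sup>2 \<le> (norm (f s) + norm (g s))\<^sup>2"
      by (intro power_mono norm_triangle_ineq) simp
    also have "\<dots> \<le> 2 * (norm (f s))\<^sup>2 + 2 * (norm (g s))\<^sup>2"
      using sum_squares_bound[of "norm (f s)" "norm (g s)"] by (simp add: power2_sum)
    finally show ?thesis .
  qed
  have "set_integrable lborel {a..b} (\<lambda>s. 2 * (norm (f s))\<^sup>2 + 2 * (norm (g s))\<^sup>2)"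
    using assms by (intro set_integral_add) (auto simp: locally_L2_def)
  then show "set_integrable lborel {a..b} (\<lambda>s. (norm (f s + g s))\<^sup>2)"
    by (rule set_integrable_bound) (use sq in \<open>auto simp: set_borel_measurable_def\<close>)
qed

lemma locally_L2_linear:
  assumes "locally_L2 f" "bounded_linear T" shows "locally_L2 (\<lambda>s. T (f s))"
proof -
  obtain C where C: "\<And>x. norm (T x) \<le> norm x * C"
    using bounded_linear.bounded[OF assms(2)] by blast
  have [measurable]: "T \<in> borel_measurable borel"
    by (intro borel_measurable_continuous_onI linear_continuous_on assms)
  have [measurable]: "f \<in> borel_measurable borel" using assms by (simp add: locally_L2_def)
  show ?thesis
    by (rule locally_L2_bound[OF _ assms(1), of _ C]) (use C in \<open>auto simp: mult.commute\<close>)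
qed

lemma locally_L2_diff:
  assumes "locally_L2 f" "locally_L2 g" shows "locally_L2 (\<lambda>s. f s - g s)"
  using locally_L2_add[OF assms(1) locally_L2_linear[OF assms(2), of uminus]]
  by (simp add: bounded_linear_minus bounded_linear_ident)

lemma set_integrable_affine_iff:
  fixes f :: "real \<Rightarrow> 'a::{banach, second_countable_topology}"
  assumes "c \<noteq> 0"
  shows "set_integrable lborel ((\<lambda>x. d + c * x) -` S) (\<lambda>x. f (d + c * x)) \<longleftrightarrow>
    set_integrable lborel S f"
  unfolding set_integrable_def
  using lborel_integrable_real_affine_iff[OF assms, of "\<lambda>x. indicat_real S x *\<^sub>R f x" d]
  by (simp add: indicator_def)

lemma set_integral_affine:
  fixes f :: "real \<Rightarrow> 'a::{banach, second_countable_topology}"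
  assumes "c \<noteq> 0"
  shows "(LINT x:S|lborel. f x) =
    \<bar>c\<bar> *\<^sub>R (LINT x:((\<lambda>x. d + c * x) -` S)|lborel. f (d + c * x))"
  unfolding set_lebesgue_integral_def
  using lborel_integral_real_affine[OF assms, of "\<lambda>x. indicat_real S x *\<^sub>R f x" d]
  by (simp add: indicator_def)

lemma locally_L2_affine:
  assumes "locally_L2 f" "c \<noteq> 0" shows "locally_L2 (\<lambda>s. f (d + c * s))"
  unfolding locally_L2_def
proof (intro conjI allI)
  fix a b :: real
  have [measurable]: "f \<in> borel_measurable borel" using assms by (simp add: locally_L2_def)
  show "(\<lambda>s. f (d + c * s)) \<in> borel_measurable borel" by measurable
  let ?S = "{min (d + c * a) (d + c * b)..max (d + c * a) (d + c * b)}"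
  have "set_integrable lborel ((\<lambda>x. d + c * x) -` ?S) (\<lambda>x. (norm (f (d + c * x)))\<^sup>2)"
    using assms set_integrable_affine_iff[OF assms(2), of d ?S "\<lambda>x. (norm (f x))\<^sup>2"]
    by (simp add: locally_L2_def)
  moreover have "{a..b} \<subseteq> (\<lambda>x. d + c * x) -` ?S"
  proof
    fix x assume x: "x \<in> {a..b}"
    show "x \<in> (\<lambda>x. d + c * x) -` ?S"
    proof (cases "c > 0")
      case True
      then have "c * a \<le> c * x" "c * x \<le> c * b" using x by auto
      then show ?thesis by auto
    next
      case False
      then have "c * x \<le> c * a" "c * b \<le> c * x" using x by (auto intro: mult_left_mono_neg)
      then show ?thesis by auto
    qed
  qed
  ultimately show "set_integrable lborel {a..b} (\<lambda>s. (norm (f (d + c * s)))\<^sup>2)"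
    by (intro set_integrable_subset[of lborel "(\<lambda>x. d + c * x) -` ?S" _ "{a..b}"]) simp_all
qed

lemma locally_L2_integrable:
  assumes "locally_L2 f" "S \<in> sets borel" "S \<subseteq> {a..b}"
  shows "set_integrable lborel S f"
proof -
  have [measurable]: "f \<in> borel_measurable borel" using assms by (simp add: locally_L2_def)
  have "set_integrable lborel {a..b} (\<lambda>s. 1 :: real)"
    by (rule borel_integrable_atLeastAtMost') simp
  then have "set_integrable lborel {a..b} (\<lambda>s. 1 + (norm (f s))\<^sup>2)"
    using assms by (intro set_integral_add) (auto simp: locally_L2_def)
  moreover have "norm (f s) \<le> 1 + (norm (f s))\<^sup>2" for s
    using sum_squares_bound[of 1 "norm (f s)"] by (simp add: algebra_simps)
      (smt (verit) norm_ge_zero)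
  ultimately have "set_integrable lborel {a..b} f"
    by (elim set_integrable_bound) (auto simp: set_borel_measurable_def intro!: AE_I2)
  then show ?thesis using assms set_integrable_subset by (metis sets_lborel)
qed

lemma locally_L2_integrable_on: "locally_L2 f \<Longrightarrow> f integrable_on {a..b}"
  using locally_L2_integrable[of f "{a..b}" a b] set_borel_integral_eq_integral(1) by auto

lemma locally_L2_integral:
  "locally_L2 f \<Longrightarrow> (LINT x:{a<..<b}|lborel. f x) = integral {a..b} f"
  using locally_L2_integrable[of f "{a<..<b}" a b] set_borel_integral_eq_integral(2)
  by (metis greaterThanLessThan_subseteq_atLeastAtMost_iff integral_open_interval_real
      order_refl borel_open open_greaterThanLessThan)

lemma locally_L2_square_integrable_01: "locally_L2 f \<Longrightarrow> square_integrable_01 f"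
  by (auto simp: square_integrable_01_def set_borel_measurable_def locally_L2_measurable
      intro!: locally_L2_integrable_norm[of f _ 0 1] borel_measurable_scaleR)

lemma locally_L2_L2_loc: "locally_L2 f \<Longrightarrow> L2_loc f"
  using locally_L2_integrable_norm[of f "{0<..<T}" 0 T for T, OF _ _
    greaterThanLessThan_subseteq_atLeastAtMost_iff[THEN iffD2]]
  by (simp add: L2_loc_def set_borel_measurable_def locally_L2_measurable borel_measurable_scaleR)

lemma locally_L2_continuous:
  assumes "continuous_on UNIV f" shows "locally_L2 f"
  unfolding locally_L2_def
  using assms
  by (auto intro!: borel_measurable_continuous_onI borel_integrable_atLeastAtMost' continuous_intros
      intro: continuous_on_subset)

lemma norm_indicator_scaleR_square:
  "(norm (indicat_real S s *\<^sub>R x))\<^sup>2 = indicat_real S s *\<^sub>R (norm x)\<^sup>2"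
  by (simp add: indicator_def)

lemma locally_L2_extend:
  assumes "square_integrable_01 f"
  shows "locally_L2 (\<lambda>x. indicat_real {0<..<1} x *\<^sub>R f x)"
  unfolding locally_L2_def
proof (intro conjI allI)
  show "(\<lambda>x. indicat_real {0<..<1} x *\<^sub>R f x) \<in> borel_measurable borel"
    using assms by (simp add: square_integrable_01_def set_borel_measurable_def)
  fix a b :: real
  show "set_integrable lborel {a..b} (\<lambda>s. (norm (indicat_real {0<..<1} s *\<^sub>R f s))\<^sup>2)"
    unfolding norm_indicator_scaleR_square set_integrable_def
    by (rule integrable_mult_indicator)
      (use assms in \<open>simp_all add: square_integrable_01_def set_integrable_def\<close>)
qed

lemma locally_L2_extend_half_line:
  assumes "L2_loc f"
  shows "locally_L2 (\<lambda>x. indicat_real {0<..} x *\<^sub>R f x)"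
  unfolding locally_L2_def
proof (intro conjI allI)
  show "(\<lambda>x. indicat_real {0<..} x *\<^sub>R f x) \<in> borel_measurable borel"
    using assms by (simp add: L2_loc_def set_borel_measurable_def)
  fix a b :: real
  have "integrable lborel (\<lambda>x. indicat_real {a..b} x *\<^sub>R indicat_real {0<..<\<bar>b\<bar>+1} x *\<^sub>R (norm (f x))\<^sup>2)"
    by (rule integrable_mult_indicator)
      (use assms in \<open>simp_all add: L2_loc_def set_integrable_def\<close>)
  also have "(\<lambda>x. indicat_real {a..b} x *\<^sub>R indicat_real {0<..<\<bar>b\<bar>+1} x *\<^sub>R (norm (f x))\<^sup>2) =
     (\<lambda>s. indicat_real {a..b} s *\<^sub>R (norm (indicat_real {0<..} s *\<^sub>R f s))\<^sup>2)"
    by (auto simp: indicator_def fun_eq_iff)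
  finally show "set_integrable lborel {a..b} (\<lambda>s. (norm (indicat_real {0<..} s *\<^sub>R f s))\<^sup>2)"
    unfolding set_integrable_def .
qed

section \<open>Calculating with classes in \<open>L\<^sup>2(0,1;E)\<close>\<close>

lemma L2_class_eq_iff:
  assumes "square_integrable_01 f" "square_integrable_01 g"
  shows "L2_class f = L2_class g \<longleftrightarrow> (AE x in lborel. x \<in> {0<..<1} \<longrightarrow> f x = g x)"
  using assms Quotient3_rel[OF Quotient3_L2, of f g] by (simp add: L2_eq_def)

lemma L2_cases:
  obtains f where "square_integrable_01 f" "X = L2_class f"
  using Quotient3_rel_rep[OF Quotient3_L2, of X X] Quotient3_abs_rep[OF Quotient3_L2, of X]
  by (metis L2_eq_def)

lemma L2_cases_locally:
  obtains f where "locally_L2 f" "X = L2_class f" "\<And>x. x \<notin> {0<..<1} \<Longrightarrow> f x = 0"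
proof -
  obtain f where f: "square_integrable_01 f" "X = L2_class f" by (rule L2_cases)
  show ?thesis
  proof
    show l: "locally_L2 (\<lambda>x. indicat_real {0<..<1} x *\<^sub>R f x)" using f locally_L2_extend by blast
    show "X = L2_class (\<lambda>x. indicat_real {0<..<1} x *\<^sub>R f x)"
      using f locally_L2_square_integrable_01[OF l] by (subst f(2), subst L2_class_eq_iff) auto
  qed simp
qed

lemma L2_class_add:
  "square_integrable_01 f \<Longrightarrow> square_integrable_01 g \<Longrightarrow>
    L2_class f + L2_class g = L2_class (\<lambda>x. f x + g x)"
  by (rule plus_L2.abs_eq) (auto simp: L2_eq_def)

lemma L2_class_scaleR:
  "square_integrable_01 f \<Longrightarrow> c *\<^sub>R L2_class f = L2_class (\<lambda>x. c *\<^sub>R f x)"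
  by (rule scaleR_L2.abs_eq) (auto simp: L2_eq_def)

lemma L2_class_zero: "L2_class (\<lambda>x. 0) = 0"
  by (simp add: zero_L2_def)

lemma square_integrable_01_diff:
  "square_integrable_01 f \<Longrightarrow> square_integrable_01 g \<Longrightarrow> square_integrable_01 (\<lambda>x. f x - g x)"
  using square_integrable_01_add[OF _ square_integrable_01_scaleR[of g "-1"]] by simp

lemma L2_class_diff:
  assumes "square_integrable_01 f" "square_integrable_01 g"
  shows "L2_class f - L2_class g = L2_class (\<lambda>x. f x - g x)"
  using L2_class_add[OF assms(1) square_integrable_01_scaleR[OF assms(2), of "-1"]]
    L2_class_scaleR[OF assms(2), of "-1"] by (simp only: diff_conv_add_uminus scaleR_minus_left
      scaleR_one)

lemma L2_class_inner:
  "square_integrable_01 f \<Longrightarrow> square_integrable_01 g \<Longrightarrow>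
    L2_class f \<bullet> L2_class g = (LINT x:{0<..<1}|lborel. f x \<bullet> g x)"
  by (rule inner_L2.abs_eq) (auto simp: L2_eq_def)

lemma L2_class_norm:
  "square_integrable_01 f \<Longrightarrow>
    (norm (L2_class f))\<^sup>2 = (LINT x:{0<..<1}|lborel. (norm (f x))\<^sup>2)"
  by (simp add: power2_norm_eq_inner L2_class_inner)

lemma L2_class_norm_le:
  assumes "square_integrable_01 f" "\<And>x. 0 < x \<Longrightarrow> x < 1 \<Longrightarrow> norm (f x) \<le> B" "B \<ge> 0"
  shows "norm (L2_class f) \<le> B"
proof -
  have "(norm (L2_class f))\<^sup>2 \<le> (LINT x:{0<..<1::real}|lborel. B\<^sup>2)"
    unfolding L2_class_norm[OF assms(1)]
    using assms by (intro set_integral_mono power_mono)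
      (auto simp: square_integrable_01_def set_integrable_def)
  also have "\<dots> = B\<^sup>2" by (simp add: set_lebesgue_integral_def)
  finally show ?thesis using assms(3) by (rule power2_le_imp_le)
qed

section \<open>Density of the continuous functions\<close>

lemma locally_L2_approx_bounded:
  fixes f :: "real \<Rightarrow> 'a::euclidean_space"
  assumes "locally_L2 f" "e > 0"
  obtains B g where "g \<in> borel_measurable borel" "\<And>s. norm (g s) \<le> B"
    "(LINT s:{a..b}|lborel. (norm (f s - g s))\<^sup>2) < e"
proof -
  have [measurable]: "f \<in> borel_measurable borel" using assms(1) by (rule locally_L2_measurable)
  define g where "g n s = (if norm (f s) \<le> real n then f s else 0)" for n s
  have [measurable]: "g n \<in> borel_measurable borel" for n unfolding g_def by measurable
  have "(\<lambda>n. LINT s|lborel. indicator {a..b} s *\<^sub>R (norm (f s - g n s))\<^sup>2)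
      \<longlonglongrightarrow> integral\<^sup>L lborel (\<lambda>s::real. 0::real)"
  proof (rule Bochner_Integration.integral_dominated_convergence[where w = "\<lambda>s. indicator {a..b} s *\<^sub>R (norm (f s))\<^sup>2"])
    show "integrable lborel (\<lambda>s. indicator {a..b} s *\<^sub>R (norm (f s))\<^sup>2)"
      using assms(1) by (auto simp: locally_L2_def set_integrable_def)
    have "\<forall>\<^sub>F n in sequentially. indicat_real {a..b} s *\<^sub>R (norm (f s - g n s))\<^sup>2 = 0" for s
      using eventually_ge_at_top[of "nat \<lceil>norm (f s)\<rceil>"]
      by eventually_elim (simp add: g_def nat_ceiling_le_eq)
    then show "AE s in lborel. (\<lambda>n. indicat_real {a..b} s *\<^sub>R (norm (f s - g n s))\<^sup>2) \<longlonglongrightarrow> 0"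
      by (intro AE_I2 tendsto_eventually)
    show "AE s in lborel. norm (indicat_real {a..b} s *\<^sub>R (norm (f s - g n s))\<^sup>2)
        \<le> indicat_real {a..b} s *\<^sub>R (norm (f s))\<^sup>2" for n
      by (intro AE_I2) (auto simp: g_def indicator_def)
  qed measurable
  then have "\<forall>\<^sub>F n in sequentially. (LINT s|lborel. indicator {a..b} s *\<^sub>R (norm (f s - g n s))\<^sup>2) < e"
    using assms(2) by (auto dest: order_tendstoD(2))
  from eventually_happens[OF this] obtain n where "(LINT s|lborel. indicator {a..b} s *\<^sub>R (norm (f s - g n s))\<^sup>2) < e"
    by auto
  then show thesis
    by (intro that[of "g n" "real n"]) (auto simp: g_def set_lebesgue_integral_def)
qed

text \<open>A measurable function is the almost everywhere limit of continuous ones. Composing these with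
  the projection onto a ball that contains the values of \<open>f\<close> keeps them continuous and makes them
  uniformly bounded, so dominated convergence turns the limit into one in the mean square.\<close>

lemma bounded_approx_continuous:
  fixes f :: "real \<Rightarrow> 'a::euclidean_space"
  assumes "f \<in> borel_measurable borel" "\<And>s. norm (f s) \<le> B" "e > 0"
  obtains g where "continuous_on UNIV g" "(LINT s:{a..b}|lborel. (norm (f s - g s))\<^sup>2) < e"
proof -
  have [measurable]: "f \<in> borel_measurable borel" by fact
  have B: "B \<ge> 0" using assms(2)[of 0] norm_ge_zero[of "f 0"] by linarith
  have "f measurable_on UNIV"
    by (intro lebesgue_measurable_imp_measurable_on) (auto intro: measurable_completion)
  then obtain N g where N: "negligible N" and g: "\<And>n::nat. continuous_on UNIV (g n)"
    and lim: "\<And>s. s \<notin> N \<Longrightarrow> (\<lambda>n. g n s) \<longlonglongrightarrow> f s"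
    by (auto simp: measurable_on_def)
  \<comment> \<open>A continuous retraction onto the ball; it fixes the values of \<open>f\<close>.\<close>
  define c where "c = closest_point (cball (0::'a) B)"
  define h where "h n s = c (g n s)" for n s
  have c: "continuous_on UNIV c"
    unfolding c_def using B by (intro continuous_on_closest_point) auto
  have cf: "c (f s) = f s" for s
    unfolding c_def using assms(2) by (intro closest_point_self) simp
  have hB: "norm (h n s) \<le> B" for n s
    unfolding h_def c_def using closest_point_in_set[of "cball (0::'a) B"] B by (auto simp: mem_cball_0)
  have h: "continuous_on UNIV (h n)" for n
    unfolding h_def using g c by (metis continuous_on_compose2 subset_UNIV)
  have [measurable]: "h n \<in> borel_measurable borel" for n
    using h by (rule borel_measurable_continuous_onI)
  have hlim: "(\<lambda>n. h n s) \<longlonglongrightarrow> f s" if "s \<notin> N" for s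
    unfolding h_def using c lim[OF that] cf
    by (metis continuous_on_eq_continuous_at isCont_tendsto_compose open_UNIV UNIV_I)
  have "(\<lambda>n. LINT s|lborel. indicator {a..b} s *\<^sub>R (norm (f s - h n s))\<^sup>2)
      \<longlonglongrightarrow> integral\<^sup>L lborel (\<lambda>s::real. 0::real)"
  proof (rule Bochner_Integration.integral_dominated_convergence[where w = "\<lambda>s. indicator {a..b} s *\<^sub>R (2 * B)\<^sup>2"])
    show "integrable lborel (\<lambda>s. indicator {a..b} s *\<^sub>R (2 * B)\<^sup>2)"
      using borel_integrable_atLeastAtMost'[of a b "\<lambda>_. (2 * B)\<^sup>2"] unfolding set_integrable_def by simp
    have "AE s in lebesgue. s \<notin> N"
      using N by (simp add: AE_not_in negligible_iff_null_sets)
    then have "AE s in lborel. s \<notin> N" by (simp add: AE_completion_iff)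
    then show "AE s in lborel. (\<lambda>n. indicat_real {a..b} s *\<^sub>R (norm (f s - h n s))\<^sup>2) \<longlonglongrightarrow> 0"
    proof eventually_elim
      fix s assume "s \<notin> N"
      then have "(\<lambda>n. indicat_real {a..b} s *\<^sub>R (norm (f s - h n s))\<^sup>2)
          \<longlonglongrightarrow> indicat_real {a..b} s *\<^sub>R (norm (f s - f s))\<^sup>2"
        by (intro tendsto_intros hlim)
      then show "(\<lambda>n. indicat_real {a..b} s *\<^sub>R (norm (f s - h n s))\<^sup>2) \<longlonglongrightarrow> 0" by simp
    qed
    show "AE s in lborel. norm (indicat_real {a..b} s *\<^sub>R (norm (f s - h n s))\<^sup>2)
        \<le> indicat_real {a..b} s *\<^sub>R (2 * B)\<^sup>2" for n
    proof (intro AE_I2)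
      fix s
      have "norm (f s - h n s) \<le> 2 * B"
        using norm_triangle_ineq4[of "f s" "h n s"] assms(2)[of s] hB[of n s] by linarith
      then have "(norm (f s - h n s))\<^sup>2 \<le> (2 * B)\<^sup>2" by (intro power_mono) auto
      then show "norm (indicat_real {a..b} s *\<^sub>R (norm (f s - h n s))\<^sup>2)
        \<le> indicat_real {a..b} s *\<^sub>R (2 * B)\<^sup>2" by (auto simp: indicator_def)
    qed
  qed measurable
  then have "\<forall>\<^sub>F n in sequentially. (LINT s|lborel. indicator {a..b} s *\<^sub>R (norm (f s - h n s))\<^sup>2) < e"
    using assms(3) by (auto dest: order_tendstoD(2))
  from eventually_happens[OF this] obtain n where "(LINT s|lborel. indicator {a..b} s *\<^sub>R (norm (f s - h n s))\<^sup>2) < e"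
    by auto
  then show thesis
    by (intro that[of "h n"] h) (simp add: set_lebesgue_integral_def)
qed

lemma locally_L2_approx_continuous:
  fixes f :: "real \<Rightarrow> 'a::euclidean_space"
  assumes "locally_L2 f" "e > 0"
  obtains g where "continuous_on UNIV g" "(LINT s:{a..b}|lborel. (norm (f s - g s))\<^sup>2) < e"
proof -
  obtain h B where h: "h \<in> borel_measurable borel" "\<And>s. norm (h s) \<le> B"
    and fh: "(LINT s:{a..b}|lborel. (norm (f s - h s))\<^sup>2) < e/4"
    by (rule locally_L2_approx_bounded[OF assms(1), of "e/4" a b]) (use assms(2) in auto)
  obtain g where g: "continuous_on UNIV g"
    and hg: "(LINT s:{a..b}|lborel. (norm (h s - g s))\<^sup>2) < e/4"
    by (rule bounded_approx_continuous[OF h, of "e/4" a b]) (use assms(2) in auto)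
  have "B \<ge> 0" using h(2)[of 0] norm_ge_zero[of "h 0"] by linarith
  then obtain v :: 'a where v: "norm v = B" by (rule vector_choose_size)
  have lh: "locally_L2 h"
    by (rule locally_L2_bound[OF h(1) locally_L2_continuous[of "\<lambda>_. v"], of 1])
      (use h(2) v in auto)
  have lg: "locally_L2 g" using g by (rule locally_L2_continuous)
  have sq: "(norm (f s - g s))\<^sup>2 \<le> 2 * (norm (f s - h s))\<^sup>2 + 2 * (norm (h s - g s))\<^sup>2" for s
  proof -
    have "(norm (f s - g s))\<^sup>2 \<le> (norm (f s - h s) + norm (h s - g s))\<^sup>2"
      using norm_triangle_ineq[of "f s - h s" "h s - g s"] by (intro power_mono) auto
    also have "\<dots> \<le> 2 * (norm (f s - h s))\<^sup>2 + 2 * (norm (h s - g s))\<^sup>2"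
      using sum_squares_bound[of "norm (f s - h s)" "norm (h s - g s)"] by (simp add: power2_sum)
    finally show ?thesis .
  qed
  have i: "set_integrable lborel {a..b} (\<lambda>s. (norm (f s - h s))\<^sup>2)"
    "set_integrable lborel {a..b} (\<lambda>s. (norm (h s - g s))\<^sup>2)"
    "set_integrable lborel {a..b} (\<lambda>s. (norm (f s - g s))\<^sup>2)"
    using locally_L2_diff[OF assms(1) lh] locally_L2_diff[OF lh lg] locally_L2_diff[OF assms(1) lg]
    by (auto simp: locally_L2_def)
  have "(LINT s:{a..b}|lborel. (norm (f s - g s))\<^sup>2) \<le>
    (LINT s:{a..b}|lborel. 2 * (norm (f s - h s))\<^sup>2 + 2 * (norm (h s - g s))\<^sup>2)"
    using i sq by (intro set_integral_mono set_integral_add(1)) auto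
  also have "\<dots> = 2 * (LINT s:{a..b}|lborel. (norm (f s - h s))\<^sup>2)
      + 2 * (LINT s:{a..b}|lborel. (norm (h s - g s))\<^sup>2)"
    using i by (subst set_integral_add(2)) auto
  finally show thesis using fh hg assms(2) by (intro that[OF g]) linarith
qed

section \<open>Integrals of continuous curves in inner product spaces\<close>

text \<open>In an inner product space that is not known to be complete, continuity of the integrand does not
  produce an integral. But a candidate \<open>Z\<close>
  that is the integral weakly is also the integral strongly: testing the error of a fine Riemann sum
  with the error itself bounds its norm by the modulus of continuity of the integrand.\<close>

lemma has_integral_weakI:
  fixes f :: "real \<Rightarrow> 'a::real_inner"
  assumes ab: "a \<le> b" and c: "continuous_on {a..b} f"
    and weak: "\<And>h. ((\<lambda>t. f t \<bullet> h) has_integral (Z \<bullet> h)) {a..b}"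
  shows "(f has_integral Z) {a..b}"
  unfolding has_integral_factor_content_real
proof (intro allI impI)
  fix e :: real assume e: "e > 0"
  obtain d where d: "d > 0"
    and df: "\<And>x y. x \<in> {a..b} \<Longrightarrow> y \<in> {a..b} \<Longrightarrow> dist y x < d \<Longrightarrow> dist (f y) (f x) < e"
    using compact_uniformly_continuous[OF c] e unfolding uniformly_continuous_on_def by (metis compact_Icc)
  show "\<exists>d. gauge d \<and> (\<forall>p. p tagged_division_of {a..b} \<and> d fine p \<longrightarrow>
      norm ((\<Sum>(x, k)\<in>p. measure lborel k *\<^sub>R f x) - Z) \<le> e * measure lborel {a..b})"
  proof (intro exI[of _ "\<lambda>x. ball x d"] conjI allI impI)
    show "gauge (\<lambda>x. ball x d)" using d by (rule gauge_ball)
    fix p assume "p tagged_division_of {a..b} \<and> (\<lambda>x. ball x d) fine p"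
    then have p: "p tagged_division_of {a..b}" and fine: "(\<lambda>x. ball x d) fine p" by auto
    let ?h = "(\<Sum>(x, k)\<in>p. measure lborel k *\<^sub>R f x) - Z"
    have int: "(\<lambda>t. f t \<bullet> ?h) integrable_on {a..b}" using weak by blast
    have "Z \<bullet> ?h = integral {a..b} (\<lambda>t. f t \<bullet> ?h)" using weak by (metis integral_unique)
    also have "\<dots> = (\<Sum>(x, k)\<in>p. integral k (\<lambda>t. f t \<bullet> ?h))"
      using int p integral_combine_tagged_division_topdown[of "\<lambda>t. f t \<bullet> ?h" a b p] by simp
    finally have Z: "Z \<bullet> ?h = (\<Sum>(x, k)\<in>p. integral k (\<lambda>t. f t \<bullet> ?h))" .
    have "(norm ?h)\<^sup>2 = (\<Sum>(x, k)\<in>p. measure lborel k *\<^sub>R f x) \<bullet> ?h - Z \<bullet> ?h"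
      by (simp add: power2_norm_eq_inner inner_diff_left)
    also have "\<dots> = (\<Sum>(x, k)\<in>p. measure lborel k *\<^sub>R (f x \<bullet> ?h) - integral k (\<lambda>t. f t \<bullet> ?h))"
      unfolding Z inner_sum_left sum_subtractf[symmetric]
      by (intro sum.cong) (auto split: prod.splits)
    also have "\<dots> \<le> (\<Sum>(x, k)\<in>p. e * norm ?h * measure lborel k)"
    proof (intro sum_mono, clarify)
      fix x k assume xk: "(x, k) \<in> p"
      obtain u v where k: "k = {u..v}" using tagged_division_ofD(4)[OF p xk] by auto
      have kab: "k \<subseteq> {a..b}" and x: "x \<in> k" using tagged_division_ofD(2,3)[OF p xk] by auto
      have kd: "k \<subseteq> ball x d" using fine xk by (auto simp: fine_def)
      have ik: "((\<lambda>t. f t \<bullet> ?h) has_integral integral k (\<lambda>t. f t \<bullet> ?h)) k"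
        using int kab k integrable_on_subinterval by blast
      have "((\<lambda>t. f x \<bullet> ?h) has_integral (measure lborel k *\<^sub>R (f x \<bullet> ?h))) k"
        unfolding k using has_integral_const[of "f x \<bullet> ?h" u v] by simp
      from has_integral_diff[OF this ik]
      have "((\<lambda>t. (f x - f t) \<bullet> ?h) has_integral
         (measure lborel k *\<^sub>R (f x \<bullet> ?h) - integral k (\<lambda>t. f t \<bullet> ?h))) (cbox u v)"
        by (simp add: inner_diff_left k)
      then have "norm (measure lborel k *\<^sub>R (f x \<bullet> ?h) - integral k (\<lambda>t. f t \<bullet> ?h)) \<le> (e * norm ?h) * measure lborel (cbox u v)"
      proof (rule has_integral_bound[rotated])
        show "0 \<le> e * norm ?h" using e by simp
        fix t assume t: "t \<in> cbox u v"
        have "norm ((f x - f t) \<bullet> ?h) \<le> norm (f x - f t) * norm ?h"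
          using Cauchy_Schwarz_ineq2 by (simp add: real_norm_def)
        also have "\<dots> \<le> e * norm ?h"
        proof (intro mult_right_mono norm_ge_zero)
          have "t \<in> k" using t k by simp
          then have "t \<in> {a..b}" "x \<in> {a..b}" "dist t x < d"
            using kab kd x by (auto simp: dist_commute subset_iff)
          then show "norm (f x - f t) \<le> e"
            using df[of x t] by (simp add: dist_norm norm_minus_commute)
        qed
        finally show "norm ((f x - f t) \<bullet> ?h) \<le> e * norm ?h" .
      qed
      then show "measure lborel k *\<^sub>R (f x \<bullet> ?h) - integral k (\<lambda>t. f t \<bullet> ?h) \<le> e * norm ?h * measure lborel k"
        by (simp add: k)
    qed
    also have "\<dots> = e * norm ?h * measure lborel {a..b}"
      using additive_content_tagged_division[of p a b] p
      by (simp add: sum_distrib_left[symmetric] case_prod_unfold)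
    finally have "norm ?h * norm ?h \<le> (e * measure lborel {a..b}) * norm ?h"
      by (simp add: power2_eq_square mult_ac)
    then show "norm ?h \<le> e * measure lborel {a..b}"
      using e by (cases "norm ?h = 0") (auto simp: mult_le_cancel_right)
  qed
qed

text \<open>Same device: the increment of \<open>Z\<close> minus its linear part is tested with itself, which leaves a real
  integral over a short interval.\<close>

lemma has_vector_derivative_weakI:
  fixes f :: "real \<Rightarrow> 'a::real_inner"
  assumes c: "continuous_on {0..} f"
    and int: "\<And>t. t \<ge> 0 \<Longrightarrow> (f has_integral Z t) {0..t}" and t: "t \<ge> 0"
  shows "(Z has_vector_derivative f t) (at t within {0..})"
  unfolding has_vector_derivative_def has_derivative_within_alt
proof (intro conjI allI impI)
  show "bounded_linear (\<lambda>x. x *\<^sub>R f t)" by (rule bounded_linear_scaleR_left)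
  fix e :: real assume e: "e > 0"
  obtain d where d: "d > 0" and df: "\<And>s. s \<ge> 0 \<Longrightarrow> dist s t < d \<Longrightarrow> dist (f s) (f t) < e"
    using c t e unfolding continuous_on_iff by (metis atLeast_iff)
  have weak: "((\<lambda>s. f s \<bullet> h) has_integral (Z s2 \<bullet> h - Z s1 \<bullet> h)) {s1..s2}"
    if "0 \<le> s1" "s1 \<le> s2" for s1 s2 h
  proof -
    have w: "((\<lambda>s. f s \<bullet> h) has_integral (Z s \<bullet> h)) {0..s}" if "s \<ge> 0" for s
      using has_integral_linear[OF int[OF that] bounded_linear_inner_left[of h]] by (simp add: o_def)
    have "integral {0..s1} (\<lambda>s. f s \<bullet> h) + integral {s1..s2} (\<lambda>s. f s \<bullet> h) = integral {0..s2} (\<lambda>s. f s \<bullet> h)"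
      by (rule Henstock_Kurzweil_Integration.integral_combine[OF _ _ has_integral_integrable[OF w[of s2]]])
        (use that in auto)
    moreover have "integral {0..s1} (\<lambda>s. f s \<bullet> h) = Z s1 \<bullet> h" "integral {0..s2} (\<lambda>s. f s \<bullet> h) = Z s2 \<bullet> h"
      using w that by (auto intro!: integral_unique)
    ultimately have "integral {s1..s2} (\<lambda>s. f s \<bullet> h) = Z s2 \<bullet> h - Z s1 \<bullet> h" by linarith
    moreover have "(\<lambda>s. f s \<bullet> h) integrable_on {s1..s2}"
      by (rule integrable_subinterval_real[OF has_integral_integrable[OF w[of s2]]]) (use that in auto)
    ultimately show ?thesis by (metis integrable_integral)
  qed
  have main: "norm (Z s2 - Z s1 - (s2 - s1) *\<^sub>R f t) \<le> e * (s2 - s1)"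
    if s: "0 \<le> s1" "s1 \<le> s2" "dist s1 t < d" "dist s2 t < d" for s1 s2
  proof -
    let ?h = "Z s2 - Z s1 - (s2 - s1) *\<^sub>R f t"
    have "((\<lambda>s. f s \<bullet> ?h - f t \<bullet> ?h) has_integral (Z s2 \<bullet> ?h - Z s1 \<bullet> ?h - (s2 - s1) * (f t \<bullet> ?h))) {s1..s2}"
      using has_integral_diff[OF weak[OF s(1,2)] has_integral_const_real[of "f t \<bullet> ?h" s1 s2]] s by simp
    moreover have "Z s2 \<bullet> ?h - Z s1 \<bullet> ?h - (s2 - s1) * (f t \<bullet> ?h) = norm ?h * norm ?h"
      by (simp only: power2_norm_eq_inner power2_eq_square[symmetric])
        (simp only: inner_diff_left inner_scaleR_left)
    ultimately have "((\<lambda>s. f s \<bullet> ?h - f t \<bullet> ?h) has_integral (norm ?h * norm ?h)) (cbox s1 s2)"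
      by simp
    then have "norm (norm ?h * norm ?h) \<le> (e * norm ?h) * measure lborel (cbox s1 s2)"
    proof (rule has_integral_bound[rotated])
      show "0 \<le> e * norm ?h" using e by simp
      fix x assume "x \<in> cbox s1 s2"
      then have "dist (f x) (f t) < e" using s by (intro df) (auto simp: dist_real_def)
      then have "norm (f x - f t) * norm ?h \<le> e * norm ?h"
        by (intro mult_right_mono) (auto simp: dist_norm)
      then show "norm (f x \<bullet> ?h - f t \<bullet> ?h) \<le> e * norm ?h"
        using Cauchy_Schwarz_ineq2[of "f x - f t" ?h] by (simp add: inner_diff_left)
    qed
    then have "norm ?h * norm ?h \<le> e * (s2 - s1) * norm ?h" using s by (simp add: mult_ac)
    then show ?thesis using e s by (cases "norm ?h = 0") (auto simp: mult_le_cancel_right)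
  qed
  show "\<exists>d>0. \<forall>y\<in>{0..}. norm (y - t) < d \<longrightarrow> norm (Z y - Z t - (y - t) *\<^sub>R f t) \<le> e * norm (y - t)"
  proof (intro exI[of _ d] conjI ballI impI d)
    fix y assume y: "y \<in> {0::real..}" "norm (y - t) < d"
    show "norm (Z y - Z t - (y - t) *\<^sub>R f t) \<le> e * norm (y - t)"
    proof (cases "t \<le> y")
      case True then show ?thesis using main[of t y] t y d by (simp add: dist_norm)
    next
      case False
      have "norm (Z y - Z t - (y - t) *\<^sub>R f t) = norm (Z t - Z y - (t - y) *\<^sub>R f t)"
        by (subst norm_minus_cancel[symmetric]) (simp add: algebra_simps)
      then show ?thesis using main[of y t] False y d t by (simp add: dist_norm)
    qed
  qed
qed

section \<open>Travelling waves solve the transport equation\<close>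

text \<open>The profile \<open>f\<close>, reflected and travelling to the right with speed \<open>lam\<close>.\<close>

definition wave :: "real \<Rightarrow> (real \<Rightarrow> 'a::euclidean_space) \<Rightarrow> real \<Rightarrow> 'a L2" where
  "wave lam f t = L2_class (\<lambda>x. f (lam * t - x))"

text \<open>The time integral of the wave. Unlike the wave itself it has boundary traces.\<close>

definition wave_integral :: "real \<Rightarrow> (real \<Rightarrow> 'a::euclidean_space) \<Rightarrow> real \<Rightarrow> real \<Rightarrow> 'a" where
  "wave_integral lam f t x = (LINT s:{0<..<t}|lborel. f (lam * s - x))"

lemma locally_L2_reflect: "locally_L2 f \<Longrightarrow> locally_L2 (\<lambda>x. f (d - x))"
  using locally_L2_affine[of f "-1" d] by simp

lemma wave_diff:
  assumes "locally_L2 f" "locally_L2 g"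
  shows "wave lam f t - wave lam g t = wave lam (\<lambda>s. f s - g s) t"
  unfolding wave_def
  by (rule L2_class_diff) (auto intro!: locally_L2_square_integrable_01 locally_L2_reflect assms)

lemma wave_norm:
  assumes "locally_L2 f"
  shows "(norm (wave lam f t))\<^sup>2 = (LINT s:{lam * t - 1<..<lam * t}|lborel. (norm (f s))\<^sup>2)"
proof -
  have "(\<lambda>x. lam * t + -1 * x) -` {lam * t - 1<..<lam * t} = {0<..<1}" by auto
  then show ?thesis
    unfolding wave_def
    using set_integral_affine[of "-1" "{lam * t - 1<..<lam * t}" "\<lambda>s. (norm (f s))\<^sup>2" "lam * t"]
    by (simp add: L2_class_norm locally_L2_square_integrable_01 locally_L2_reflect assms)
qed

lemma wave_norm_le:
  assumes "locally_L2 f" "lam > 0" "0 \<le> t" "t \<le> T"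
  shows "(norm (wave lam f t))\<^sup>2 \<le> (LINT s:{-1..lam * T}|lborel. (norm (f s))\<^sup>2)"
proof -
  have 1: "0 \<le> lam * t" "lam * t \<le> lam * T" using assms by auto
  have "{lam * t - 1<..<lam * t} \<subseteq> {-1..lam * T}"
  proof
    fix x assume "x \<in> {lam * t - 1<..<lam * t}"
    then have "lam * t - 1 < x" "x < lam * t" by auto
    then have "- 1 \<le> x" "x \<le> lam * T" using 1 by linarith+
    then show "x \<in> {-1..lam * T}" by simp
  qed
  then have "(LINT s:{lam * t - 1<..<lam * t}|lborel. (norm (f s))\<^sup>2) \<le>
    (LINT s:{-1..lam * T}|lborel. (norm (f s))\<^sup>2)"
    unfolding set_lebesgue_integral_def
    using locally_L2_integrable_norm[OF assms(1), of "{lam * t - 1<..<lam * t}" "-1" "lam * T"]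
      locally_L2_integrable_norm[OF assms(1), of "{-1..lam * T}" "-1" "lam * T"]
    unfolding set_integrable_def
    by (intro integral_mono) (auto simp: indicator_def)
  then show ?thesis using wave_norm[OF assms(1)] by simp
qed

lemma continuous_on_wave_of_continuous:
  fixes g :: "real \<Rightarrow> 'a::euclidean_space"
  assumes g: "continuous_on UNIV g" and lam: "lam > 0"
  shows "continuous_on {0..T} (wave lam g)"
  unfolding continuous_on_iff
proof (intro ballI allI impI)
  fix t e :: real assume t: "t \<in> {0..T}" and e: "e > 0"
  \<comment> \<open>\<open>[-1, lam T]\<close> contains every argument \<open>lam t - x\<close> with \<open>t\<close> in \<open>[0,T]\<close> and \<open>x\<close> in \<open>(0,1)\<close>.\<close>
  have "uniformly_continuous_on {-1..lam * T} g"
    by (intro compact_uniformly_continuous continuous_on_subset[OF g]) auto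
  then obtain d where d: "d > 0"
    and dg: "\<And>x y. x \<in> {-1..lam * T} \<Longrightarrow> y \<in> {-1..lam * T} \<Longrightarrow> dist y x < d \<Longrightarrow> dist (g y) (g x) < e/2"
    using e unfolding uniformly_continuous_on_def by (metis half_gt_zero)
  show "\<exists>d>0. \<forall>s\<in>{0..T}. dist s t < d \<longrightarrow> dist (wave lam g s) (wave lam g t) < e"
  proof (intro exI[of _ "d / lam"] conjI ballI impI)
    fix s assume s: "s \<in> {0..T}" and st: "dist s t < d / lam"
    have l: "square_integrable_01 (\<lambda>x. g (lam * s - x))" for s
      using g by (intro locally_L2_square_integrable_01 locally_L2_reflect locally_L2_continuous)
    have bd: "0 \<le> lam * s" "lam * s \<le> lam * T" "0 \<le> lam * t" "lam * t \<le> lam * T"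
      using s t lam by auto
    have "norm (L2_class (\<lambda>x. g (lam * s - x) - g (lam * t - x))) \<le> e/2"
    proof (rule L2_class_norm_le)
      show "square_integrable_01 (\<lambda>x. g (lam * s - x) - g (lam * t - x))"
        using l by (intro square_integrable_01_diff)
      fix x :: real assume x: "0 < x" "x < 1"
      have "dist (lam * s - x) (lam * t - x) = lam * dist s t"
        using lam abs_mult[of lam "s - t"] by (simp add: dist_real_def right_diff_distrib)
      also have "\<dots> < d" using st lam by (simp add: pos_less_divide_eq mult.commute)
      finally have "dist (g (lam * s - x)) (g (lam * t - x)) < e/2"
        using x bd by (intro dg) auto
      then show "norm (g (lam * s - x) - g (lam * t - x)) \<le> e/2" by (simp add: dist_norm)
    qed (use e in simp)
    then show "dist (wave lam g s) (wave lam g t) < e"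
      using e by (simp add: dist_norm wave_def L2_class_diff[OF l l])
  qed (use d lam in simp)
qed

text \<open>On a bounded time interval only a bounded part of the profile is visible, so approximating it
  there by a continuous function approximates the whole curve uniformly in time.\<close>

lemma continuous_on_wave_Icc:
  assumes f: "locally_L2 f" and lam: "lam > 0" and T: "T \<ge> 0"
  shows "continuous_on {0..T} (wave lam f)"
  unfolding continuous_on_iff
proof (intro ballI allI impI)
  fix t e :: real assume t: "t \<in> {0..T}" and e: "e > 0"
  obtain g where g: "continuous_on UNIV g"
    and fg: "(LINT s:{-1..lam * T}|lborel. (norm (f s - g s))\<^sup>2) < (e/3)\<^sup>2"
    by (rule locally_L2_approx_continuous[OF f, of "(e/3)\<^sup>2" "-1" "lam * T"]) (use e in auto)
  have lg: "locally_L2 g" using g by (rule locally_L2_continuous)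
  have near: "dist (wave lam f s) (wave lam g s) < e/3" if "s \<in> {0..T}" for s
  proof -
    have "(norm (wave lam f s - wave lam g s))\<^sup>2 < (e/3)\<^sup>2"
      unfolding wave_diff[OF f lg]
      using wave_norm_le[OF locally_L2_diff[OF f lg] lam, of s T] fg that by simp
    then show ?thesis unfolding dist_norm by (rule power2_less_imp_less) (use e in simp)
  qed
  obtain d where d: "d > 0" and dg: "\<And>s. s \<in> {0..T} \<Longrightarrow> dist s t < d \<Longrightarrow> dist (wave lam g s) (wave lam g t) < e/3"
    using continuous_on_wave_of_continuous[OF g lam, of T, unfolded continuous_on_iff,
        rule_format, OF t, of "e/3"] e by auto
  show "\<exists>d>0. \<forall>s\<in>{0..T}. dist s t < d \<longrightarrow> dist (wave lam f s) (wave lam f t) < e"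
  proof (intro exI[of _ d] conjI ballI impI d)
    fix s assume s: "s \<in> {0..T}" "dist s t < d"
    have "dist (wave lam f s) (wave lam f t) \<le> dist (wave lam f s) (wave lam g s)
        + (dist (wave lam g s) (wave lam g t) + dist (wave lam g t) (wave lam f t))"
      by (meson add_left_mono dist_triangle order_trans)
    then show "dist (wave lam f s) (wave lam f t) < e"
      using near[OF s(1)] near[OF t] dg[OF s] by (simp add: dist_commute)
  qed
qed

lemma continuous_on_wave:
  assumes "locally_L2 f" and "lam > 0"
  shows "continuous_on {0..} (wave lam f)"
proof -
  have "continuous (at t within {0..}) (wave lam f)" if "t \<ge> 0" for t
  proof -
    have "continuous (at t within {0..t+1}) (wave lam f)"
      using continuous_on_wave_Icc[OF assms, of "t+1"] that by (simp add: continuous_on_eq_continuous_within)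
    moreover have "at t within {0..t+1} = at t within {0..}"
      using that by (intro at_within_nhd[of t "{..<t+1}"]) auto
    ultimately show ?thesis by simp
  qed
  then show ?thesis by (simp add: continuous_on_eq_continuous_within)
qed

lemma square_integrable_01_continuous:
  assumes "continuous_on {0..1} F" shows "square_integrable_01 F"
proof -
  have "set_integrable lborel {0..1} (\<lambda>x. (norm (F x))\<^sup>2)"
    by (intro borel_integrable_atLeastAtMost' continuous_intros assms)
  then have "set_integrable lborel {0<..<1} (\<lambda>x. (norm (F x))\<^sup>2)"
    by (rule set_integrable_subset) auto
  moreover have "set_borel_measurable lborel {0<..<1} F"
    using assms by (auto simp: set_borel_measurable_def
       intro!: borel_measurable_continuous_on_indicator intro: continuous_on_subset)
  ultimately show ?thesis by (simp add: square_integrable_01_def)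
qed

lemma wave_integral_eq:
  assumes f: "locally_L2 f" and lam: "lam > 0"
  shows "wave_integral lam f t x = (1 / lam) *\<^sub>R integral {- x..lam * t - x} f"
proof -
  have "(\<lambda>s. - x + lam * s) -` {-x<..<lam * t - x} = {0<..<t}"
    using lam by (auto simp: zero_less_mult_iff)
  then show ?thesis
    using set_integral_affine[of lam "{-x<..<lam * t - x}" f "-x"] lam
    by (simp add: wave_integral_def locally_L2_integral[OF f])
qed

lemma reflect_integral:
  assumes f: "locally_L2 f"
  shows "integral {d - x..d} f = (LINT s:{0<..<x}|lborel. f (d - s))"
proof -
  have "(\<lambda>s. d + -1 * s) -` {d - x<..<d} = {0<..<x}" by auto
  then show ?thesis
    using set_integral_affine[of "-1" "{d - x<..<d}" f d]
    by (simp add: locally_L2_integral[OF f])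
qed

lemma H1_rep_continuous:
  assumes g: "square_integrable_01 g"
    and F: "\<forall>x\<in>{0..1}. F x = F 0 + (LINT s:{0<..<x}|lborel. g s)"
  shows "continuous_on {0..1} F"
proof -
  define g' where "g' x = indicat_real {0<..<1} x *\<^sub>R g x" for x
  have g': "locally_L2 g'" unfolding g'_def by (rule locally_L2_extend[OF g])
  have "(LINT s:{0<..<x}|lborel. g s) = integral {0..x} g'" if "x \<in> {0..1}" for x
    unfolding locally_L2_integral[OF g', symmetric]
    using that by (intro set_lebesgue_integral_cong) (auto simp: g'_def)
  then have eq: "F 0 + integral {0..x} g' = F x" if "x \<in> {0..1}" for x
    using bspec[OF F that] that by simp
  have "continuous_on {0..1} (\<lambda>x. F 0 + integral {0..x} g')"
    by (intro continuous_intros indefinite_integral_continuous_1 locally_L2_integrable_on g')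
  then show ?thesis by (rule continuous_on_eq) (rule eq)
qed

text \<open>Moving the point \<open>x\<close> to the right shifts the window of integration \<open>[-x, lam t - x]\<close> to the left;
  the mass gained and lost at its two ends is the integral of the stated derivative.\<close>

lemma H1_rep_wave_integral:
  assumes f: "locally_L2 f" and lam: "lam > 0" and t: "t \<ge> 0"
  shows "H1_rep (L2_class (wave_integral lam f t)) (wave_integral lam f t)
    ((1 / lam) *\<^sub>R (wave lam f 0 - wave lam f t))"
proof -
  define g where "g s = (1 / lam) *\<^sub>R (f (lam * 0 - s) - f (lam * t - s))" for s
  have s: "square_integrable_01 (\<lambda>s. f (lam * t - s))" for t
    by (intro locally_L2_square_integrable_01 locally_L2_reflect f)
  have g: "square_integrable_01 g"
    unfolding g_def by (intro square_integrable_01_scaleR square_integrable_01_diff s)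
  have G: "(1 / lam) *\<^sub>R (wave lam f 0 - wave lam f t) = L2_class g"
    unfolding wave_def g_def using s by (simp only: L2_class_diff L2_class_scaleR square_integrable_01_diff)
  have F: "\<forall>x\<in>{0..1}. wave_integral lam f t x = wave_integral lam f t 0 + (LINT s:{0<..<x}|lborel. g s)"
  proof
    fix x :: real assume x: "x \<in> {0..1}"
    have lt: "0 \<le> lam * t" using lam t by simp
    have "integral {-x..lam * t - x} f + integral {lam * t - x..lam * t} f = integral {-x..lam * t} f"
      using x lt by (intro Henstock_Kurzweil_Integration.integral_combine locally_L2_integrable_on f) auto
    moreover have "integral {-x..0} f + integral {0..lam * t} f = integral {-x..lam * t} f"
      using x lt by (intro Henstock_Kurzweil_Integration.integral_combine locally_L2_integrable_on f) auto
    moreover have "integral {-x..0} f = (LINT s:{0<..<x}|lborel. f (- s))"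
      using reflect_integral[OF f, of 0 x] by simp
    moreover have "integral {lam * t - x..lam * t} f = (LINT s:{0<..<x}|lborel. f (lam * t - s))"
      by (rule reflect_integral[OF f])
    moreover have "set_integrable lborel {0<..<x} (\<lambda>s. f (d - s))" for d
      by (rule locally_L2_integrable[OF locally_L2_reflect[OF f], of _ 0 x]) auto
    from set_integral_diff(2)[OF this[of 0] this[of "lam * t"]]
    have "(LINT s:{0<..<x}|lborel. g s) = (1 / lam) *\<^sub>R
       ((LINT s:{0<..<x}|lborel. f (- s)) - (LINT s:{0<..<x}|lborel. f (lam * t - s)))"
      unfolding g_def by simp
    moreover from calculation have "integral {-x..lam * t - x} f = integral {0..lam * t} f +
       ((LINT s:{0<..<x}|lborel. f (- s)) - (LINT s:{0<..<x}|lborel. f (lam * t - s)))"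
      by (simp add: algebra_simps)
    ultimately show "wave_integral lam f t x = wave_integral lam f t 0 + (LINT s:{0<..<x}|lborel. g s)"
      unfolding wave_integral_eq[OF f lam] by (simp add: scaleR_add_right)
  qed
  show ?thesis
    unfolding H1_rep_def
    using H1_rep_continuous[OF g F] square_integrable_01_continuous F G g by blast
qed

text \<open>Fubini's theorem for \<open>f(lam s - x) \<bullet> k(x)\<close> on \<open>(0,t) \<times> (0,1)\<close>; integrability follows from the
  Cauchy-Schwarz inequality, as the visible part of \<open>f\<close> has finite energy.\<close>

lemma wave_inner_integral:
  assumes f: "locally_L2 f" and lam: "lam > 0" and t: "t \<ge> 0"
  shows "((\<lambda>s. wave lam f s \<bullet> h) has_integral (L2_class (wave_integral lam f t) \<bullet> h)) {0..t}"
proof -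
  obtain k where k: "locally_L2 k" and h: "h = L2_class k" by (rule L2_cases_locally)
  have [measurable]: "f \<in> borel_measurable borel" "k \<in> borel_measurable borel"
    using f k by (auto intro: locally_L2_measurable)
  define p where "p = (\<lambda>(s, x). indicat_real {0<..<t} s *\<^sub>R indicat_real {0<..<1} x *\<^sub>R (f (lam * s - x) \<bullet> k x))"
  have fs: "square_integrable_01 (\<lambda>x. f (lam * s - x))" for s
    by (intro locally_L2_square_integrable_01 locally_L2_reflect f)
  have ks: "square_integrable_01 k" using k by (rule locally_L2_square_integrable_01)
  have [measurable]: "p \<in> borel_measurable (lborel \<Otimes>\<^sub>M lborel)"
    unfolding p_def by measurable
  have slice: "integrable lborel (\<lambda>x. p (s, x))" for s
    using square_integrable_01_inner[OF fs ks] by (simp add: p_def set_integrable_def)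
  define C where "C = (LINT s:{-1..lam * t}|lborel. (norm (f s))\<^sup>2) + (norm h)\<^sup>2"
  have bound: "(\<integral>x. norm (p (s, x)) \<partial>lborel) \<le> indicat_real {0<..<t} s * C" for s
  proof (cases "s \<in> {0<..<t}")
    case True
    have i: "set_integrable lborel {0<..<1} (\<lambda>x. (norm (f (lam * s - x)))\<^sup>2)"
        "set_integrable lborel {0<..<1} (\<lambda>x. (norm (k x))\<^sup>2)"
      using fs ks by (auto simp: square_integrable_01_def)
    have "(\<integral>x. norm (p (s, x)) \<partial>lborel) \<le> (\<integral>x. indicat_real {0<..<1} x *\<^sub>R ((norm (f (lam * s - x)))\<^sup>2 + (norm (k x))\<^sup>2) \<partial>lborel)"
    proof (intro integral_mono integrable_norm slice)
      show "integrable lborel (\<lambda>x. indicat_real {0<..<1} x *\<^sub>R ((norm (f (lam * s - x)))\<^sup>2 + (norm (k x))\<^sup>2))"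
        using set_integral_add(1)[OF i] by (simp add: set_integrable_def)
      fix x
      have "\<bar>f (lam * s - x) \<bullet> k x\<bar> \<le> norm (f (lam * s - x)) * norm (k x)"
        by (rule Cauchy_Schwarz_ineq2)
      also have "\<dots> \<le> (norm (f (lam * s - x)))\<^sup>2 + (norm (k x))\<^sup>2"
        using sum_squares_bound[of "norm (f (lam * s - x))" "norm (k x)"]
          mult_nonneg_nonneg[OF norm_ge_zero[of "f (lam * s - x)"] norm_ge_zero[of "k x"]] by linarith
      finally show "norm (p (s, x)) \<le> indicat_real {0<..<1} x *\<^sub>R ((norm (f (lam * s - x)))\<^sup>2 + (norm (k x))\<^sup>2)"
        by (auto simp: p_def indicator_def)
    qed
    also have "\<dots> = (norm (wave lam f s))\<^sup>2 + (norm h)\<^sup>2"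
      using set_integral_add(2)[OF i] by (simp add: h wave_def L2_class_norm[OF fs] L2_class_norm[OF ks] set_lebesgue_integral_def)
    also have "\<dots> \<le> C" using wave_norm_le[OF f lam, of s t] True by (simp add: C_def)
    finally show ?thesis using True by simp
  qed (simp add: p_def)
  have ip: "integrable (lborel \<Otimes>\<^sub>M lborel) p"
  proof (rule lborel_pair.Fubini_integrable)
    have "set_integrable lborel {0<..<t} (\<lambda>_. C)"
      by (rule set_integrable_subset[OF borel_integrable_atLeastAtMost'[of 0 t]]) auto
    then have "integrable lborel (\<lambda>s. indicat_real {0<..<t} s * C)" by (simp add: set_integrable_def)
    then show "integrable lborel (\<lambda>s. \<integral>x. norm (p (s, x)) \<partial>lborel)"
      by (rule Bochner_Integration.integrable_bound)
        (auto intro!: AE_I2 order_trans[OF bound[unfolded real_norm_def] abs_ge_self])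
    show "AE s in lborel. integrable lborel (\<lambda>x. p (s, x))" using slice by simp
  qed measurable
  have left: "(\<integral>x. p (s, x) \<partial>lborel) = indicat_real {0<..<t} s *\<^sub>R (wave lam f s \<bullet> h)" for s
    by (simp add: p_def h wave_def L2_class_inner[OF fs ks] set_lebesgue_integral_def)
  have right: "(\<integral>s. p (s, x) \<partial>lborel) = indicat_real {0<..<1} x *\<^sub>R (wave_integral lam f t x \<bullet> k x)" for x
  proof -
    have "set_integrable lborel {0<..<t} (\<lambda>s. f (- x + lam * s))"
      by (rule locally_L2_integrable[OF locally_L2_affine[OF f, of lam "-x"], of "{0<..<t}" 0 t])
        (use lam in auto)
    then have "integrable lborel (\<lambda>s. indicat_real {0<..<t} s *\<^sub>R f (lam * s - x))"
      by (simp add: set_integrable_def)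
    from integral_inner_left[OF this, of "k x"] show ?thesis
      by (simp add: p_def wave_integral_def set_lebesgue_integral_def mult_ac)
  qed
  have Fs: "square_integrable_01 (wave_integral lam f t)"
    using H1_rep_wave_integral[OF f lam t] by (simp add: H1_rep_def)
  have int: "set_integrable lborel {0<..<t} (\<lambda>s. wave lam f s \<bullet> h)"
    using lborel_pair.integrable_fst'[OF ip] by (simp add: left set_integrable_def)
  have "integral {0<..<t} (\<lambda>s. wave lam f s \<bullet> h) = (\<integral>s. (\<integral>x. p (s, x) \<partial>lborel) \<partial>lborel)"
    using set_borel_integral_eq_integral(2)[OF int] by (simp add: left set_lebesgue_integral_def)
  also have "\<dots> = (\<integral>x. (\<integral>s. p (s, x) \<partial>lborel) \<partial>lborel)"
    using lborel_pair.Fubini_integral[of "\<lambda>s x. p (s, x)"] ip by simp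
  also have "\<dots> = L2_class (wave_integral lam f t) \<bullet> h"
    by (simp add: right h L2_class_inner[OF Fs ks] set_lebesgue_integral_def)
  finally have "((\<lambda>s. wave lam f s \<bullet> h) has_integral (L2_class (wave_integral lam f t) \<bullet> h)) {0<..<t}"
    using set_borel_integral_eq_integral(1)[OF int] by (metis integrable_integral)
  then show ?thesis by (simp add: has_integral_Icc_iff_Ioo)
qed

theorem transport_solution_wave:
  assumes f: "locally_L2 f" and lam: "lam > 0"
  shows "transport_solution lam (wave lam f 0) (wave lam f) (wave_integral lam f)"
  unfolding transport_solution_def
proof (intro conjI allI impI)
  show "continuous_on {0..} (wave lam f)" by (rule continuous_on_wave[OF f lam])
  fix t :: real assume t: "t \<ge> 0"
  have "(wave lam f has_integral L2_class (wave_integral lam f t)) {0..t}"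
    by (rule has_integral_weakI[OF t continuous_on_wave_Icc[OF f lam t] wave_inner_integral[OF f lam t]])
  moreover have "wave lam f t - wave lam f 0 = - lam *\<^sub>R ((1 / lam) *\<^sub>R (wave lam f 0 - wave lam f t))"
    using lam by simp
  ultimately show "\<exists>Z G. (wave lam f has_integral Z) {0..t} \<and> H1_rep Z (wave_integral lam f t) G \<and>
      wave lam f t - wave lam f 0 = - lam *\<^sub>R G"
    using H1_rep_wave_integral[OF f lam t] by blast
qed

text \<open>The traces at \<open>0\<close> and \<open>1\<close> are read off pointwise from the profile. This turns boundary conditions in
  integrated form into relations between \<open>f(s)\<close> and \<open>f(s - 1)\<close>.\<close>

lemma wave_boundary:
  fixes M N :: "complex^'n^'m"
  assumes f: "locally_L2 f" and lam: "lam > 0"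
  shows "M *v wave_integral lam f t 0 + N *v wave_integral lam f t 1 =
    (LINT s:{0<..<t}|lborel. M *v f (lam * s) + N *v f (lam * s - 1))"
proof -
  have i: "set_integrable lborel {0<..<t} (\<lambda>s. f (lam * s - x))" for x
    using locally_L2_integrable[OF locally_L2_affine[OF f, of lam "-x"], of "{0<..<t}" 0 t] lam
    by (simp add: greaterThanLessThan_subseteq_atLeastAtMost_iff)
  have T: "(LINT s:{0<..<t}|lborel. T *v f (lam * s - x)) = T *v wave_integral lam f t x"
    "set_integrable lborel {0<..<t} (\<lambda>s. T *v f (lam * s - x))" for x and T :: "complex^'n^'m"
  proof -
    have e: "indicat_real {0<..<t} s *\<^sub>R (T *v f (lam * s - x)) = T *v (indicat_real {0<..<t} s *\<^sub>R f (lam * s - x))" for s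
      by (simp add: indicator_def)
    show "(LINT s:{0<..<t}|lborel. T *v f (lam * s - x)) = T *v wave_integral lam f t x"
      using integral_bounded_linear[OF matrix_vector_mul_bounded_linear i[of x, unfolded set_integrable_def], of T]
      by (simp add: wave_integral_def set_lebesgue_integral_def e)
    show "set_integrable lborel {0<..<t} (\<lambda>s. T *v f (lam * s - x))"
      using integrable_bounded_linear[OF matrix_vector_mul_bounded_linear i[of x, unfolded set_integrable_def], of T]
      by (simp add: set_integrable_def e)
  qed
  show ?thesis using set_integral_add(2)[OF T(2)[of M 0] T(2)[of N 1]] by (simp add: T(1)[of _ 1] T(1)[of _ 0, simplified])
qed

section \<open>A weighted inner product\<close>

lemma square_integrable_01_cong:
  assumes "\<And>x. 0 < x \<Longrightarrow> x < 1 \<Longrightarrow> f x = g x"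
  shows "square_integrable_01 f \<longleftrightarrow> square_integrable_01 g"
proof -
  have "(\<lambda>x. indicat_real {0<..<1} x *\<^sub>R f x) = (\<lambda>x. indicat_real {0<..<1} x *\<^sub>R g x)"
    using assms by (auto simp: indicator_def fun_eq_iff)
  moreover have "set_integrable lborel {0<..<1} (\<lambda>x. (norm (f x))\<^sup>2) \<longleftrightarrow>
     set_integrable lborel {0<..<1} (\<lambda>x. (norm (g x))\<^sup>2)"
    using assms by (intro set_integrable_cong) auto
  ultimately show ?thesis by (simp add: square_integrable_01_def set_borel_measurable_def)
qed

lemma square_integrable_01_weight:
  assumes "square_integrable_01 f"
  shows "square_integrable_01 (\<lambda>x. (1 + c * x) *\<^sub>R f x)"
proof -
  define h where "h x = indicat_real {0<..<1} x *\<^sub>R f x" for x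
  have h: "locally_L2 h" unfolding h_def by (rule locally_L2_extend[OF assms])
  have [measurable]: "h \<in> borel_measurable borel" using h by (rule locally_L2_measurable)
  have "locally_L2 (\<lambda>x. (1 + c * x) *\<^sub>R h x)"
  proof (rule locally_L2_bound[OF _ h])
    fix x
    show "norm ((1 + c * x) *\<^sub>R h x) \<le> (1 + \<bar>c\<bar>) * norm (h x)"
    proof (cases "x \<in> {0<..<1}")
      case True
      then have "\<bar>c * x\<bar> \<le> \<bar>c\<bar>" using mult_left_le[of x "\<bar>c\<bar>"] by (simp add: abs_mult)
      then have "\<bar>1 + c * x\<bar> \<le> 1 + \<bar>c\<bar>" by linarith
      then show ?thesis by (simp add: mult_right_mono)
    qed (simp add: h_def)
  qed measurable
  then have "square_integrable_01 (\<lambda>x. (1 + c * x) *\<^sub>R h x)" by (rule locally_L2_square_integrable_01)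
  then show ?thesis by (subst square_integrable_01_cong[of _ "\<lambda>x. (1 + c * x) *\<^sub>R h x"]) (auto simp: h_def)
qed

text \<open>Multiplication by \<open>1 + c x\<close>. Without a weight the energy of a solution grows at a rate that depends
  on the outflow \<open>F t 1\<close>, which the energy does not control. A weight that is larger at \<open>1\<close> than at \<open>0\<close>
  makes the outflow term win over the inflow term.\<close>

lift_definition weight :: "real \<Rightarrow> 'a::euclidean_space L2 \<Rightarrow> 'a L2" is "\<lambda>c f x. (1 + c * x) *\<^sub>R f x"
  unfolding L2_eq_def by (auto intro: square_integrable_01_weight)

lemma weight_class:
  "square_integrable_01 f \<Longrightarrow> weight c (L2_class f) = L2_class (\<lambda>x. (1 + c * x) *\<^sub>R f x)"
  by (rule weight.abs_eq) (simp add: L2_eq_def)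

lemma weight_inner:
  assumes "square_integrable_01 f" "square_integrable_01 g"
  shows "weight c (L2_class f) \<bullet> L2_class g = (LINT x:{0<..<1}|lborel. (1 + c * x) * (f x \<bullet> g x))"
  by (simp add: weight_class assms L2_class_inner square_integrable_01_weight)

lemma weight_sym: "weight c X \<bullet> Y = X \<bullet> weight c Y"
proof -
  obtain f where f: "square_integrable_01 f" "X = L2_class f" by (rule L2_cases)
  obtain g where g: "square_integrable_01 g" "Y = L2_class g" by (rule L2_cases)
  have "weight c X \<bullet> Y = (LINT x:{0<..<1}|lborel. (1 + c * x) * (f x \<bullet> g x))"
    unfolding f(2) g(2) by (rule weight_inner[OF f(1) g(1)])
  also have "\<dots> = (LINT x:{0<..<1}|lborel. (1 + c * x) * (g x \<bullet> f x))"
    by (subst inner_commute) (rule refl)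
  also have "\<dots> = weight c Y \<bullet> X"
    unfolding f(2) g(2) by (rule weight_inner[OF g(1) f(1), symmetric])
  also have "\<dots> = X \<bullet> weight c Y" by (rule inner_commute)
  finally show ?thesis .
qed

lemma weight_norm: "norm (weight c X) \<le> (1 + \<bar>c\<bar>) * norm X"
proof (rule power2_le_imp_le)
  obtain f where f: "square_integrable_01 f" "X = L2_class f" by (rule L2_cases)
  have "(norm (weight c X))\<^sup>2 = (LINT x:{0<..<1}|lborel. (norm ((1 + c * x) *\<^sub>R f x))\<^sup>2)"
    using f by (simp add: weight_class L2_class_norm square_integrable_01_weight del: norm_scaleR)
  also have "\<dots> \<le> (LINT x:{0<..<1}|lborel. (1 + \<bar>c\<bar>)\<^sup>2 * (norm (f x))\<^sup>2)"
  proof (rule set_integral_mono)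
    show "set_integrable lborel {0<..<1} (\<lambda>x. (norm ((1 + c * x) *\<^sub>R f x))\<^sup>2)"
      using square_integrable_01_weight[OF f(1)] by (simp add: square_integrable_01_def)
    show "set_integrable lborel {0<..<1} (\<lambda>x. (1 + \<bar>c\<bar>)\<^sup>2 * (norm (f x))\<^sup>2)"
      using f(1) unfolding square_integrable_01_def by (intro set_integrable_mult_right) auto
    fix x :: real assume x: "x \<in> {0<..<1}"
    then have "\<bar>c * x\<bar> \<le> \<bar>c\<bar>" using mult_left_le[of x "\<bar>c\<bar>"] by (simp add: abs_mult)
    then have "\<bar>1 + c * x\<bar> \<le> 1 + \<bar>c\<bar>" by linarith
    then have "norm ((1 + c * x) *\<^sub>R f x) \<le> (1 + \<bar>c\<bar>) * norm (f x)" by (simp add: mult_right_mono)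
    from power_mono[OF this, of 2]
    show "(norm ((1 + c * x) *\<^sub>R f x))\<^sup>2 \<le> (1 + \<bar>c\<bar>)\<^sup>2 * (norm (f x))\<^sup>2"
      by (simp only: norm_ge_zero power_mult_distrib)
  qed
  also have "\<dots> = ((1 + \<bar>c\<bar>) * norm X)\<^sup>2"
    using f by (simp add: L2_class_norm power_mult_distrib)
  finally show "(norm (weight c X))\<^sup>2 \<le> ((1 + \<bar>c\<bar>) * norm X)\<^sup>2" .
qed simp

lemma bounded_linear_weight: "bounded_linear (weight c :: 'a::euclidean_space L2 \<Rightarrow> _)"
proof (rule bounded_linear_intro)
  fix X Y :: "'a L2" and r :: real
  obtain f where f: "square_integrable_01 f" "X = L2_class f" by (rule L2_cases)
  obtain g where g: "square_integrable_01 g" "Y = L2_class g" by (rule L2_cases)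
  show "weight c (X + Y) = weight c X + weight c Y"
    using f g by (simp add: L2_class_add weight_class square_integrable_01_weight
      square_integrable_01_add scaleR_add_right)
  show "weight c (r *\<^sub>R X) = r *\<^sub>R weight c X"
    unfolding f(2) L2_class_scaleR[OF f(1)] weight_class[OF f(1)]
      weight_class[OF square_integrable_01_scaleR[OF f(1)]]
      L2_class_scaleR[OF square_integrable_01_weight[OF f(1)]]
    by (simp add: mult.commute)
  show "norm (weight c X) \<le> norm X * (1 + \<bar>c\<bar>)" using weight_norm[of c X] by (simp add: mult.commute)
qed

lemma weight_inner_ge:
  assumes "c \<ge> 0" shows "(norm X)\<^sup>2 \<le> weight c X \<bullet> X"
proof -
  obtain f where f: "square_integrable_01 f" "X = L2_class f" by (rule L2_cases)
  have "(LINT x:{0<..<1}|lborel. (norm (f x))\<^sup>2) \<le> (LINT x:{0<..<1}|lborel. (1 + c * x) * (norm (f x))\<^sup>2)"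
  proof (rule set_integral_mono)
    show "set_integrable lborel {0<..<1} (\<lambda>x. (1 + c * x) * (norm (f x))\<^sup>2)"
      using square_integrable_01_inner[OF square_integrable_01_weight[OF f(1)] f(1)]
      by (simp add: power2_norm_eq_inner)
    fix x :: real assume "x \<in> {0<..<1}"
    then have "1 \<le> 1 + c * x" using assms by simp
    then show "(norm (f x))\<^sup>2 \<le> (1 + c * x) * (norm (f x))\<^sup>2"
      using mult_right_mono[of 1 "1 + c * x" "(norm (f x))\<^sup>2"] by simp
  qed (use f in \<open>simp add: square_integrable_01_def\<close>)
  then show ?thesis
    unfolding f(2) L2_class_norm[OF f(1)] weight_inner[OF f(1) f(1)] power2_norm_eq_inner[of "f _"] .
qed

lemma integral_norm_le_L2_norm:
  assumes f: "square_integrable_01 f"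
  shows "(LINT x:{0<..<1}|lborel. norm (f x)) \<le> norm (L2_class f)"
proof -
  have "(\<lambda>x. norm (indicat_real {0<..<1} x *\<^sub>R f x)) \<in> borel_measurable lborel"
    by (rule measurable_compose[OF _ borel_measurable_norm])
      (use f in \<open>simp add: square_integrable_01_def set_borel_measurable_def\<close>)
  then have n: "square_integrable_01 (\<lambda>x. norm (f x))"
    using f by (simp add: square_integrable_01_def set_borel_measurable_def)
  have 1: "square_integrable_01 (\<lambda>x. 1 :: real)"
    by (intro square_integrable_01_continuous continuous_intros)
  have "(LINT x:{0<..<1}|lborel. norm (f x)) = L2_class (\<lambda>x. norm (f x)) \<bullet> L2_class (\<lambda>x. 1 :: real)"
    using n 1 by (simp add: L2_class_inner)
  also have "\<dots> \<le> norm (L2_class (\<lambda>x. norm (f x))) * norm (L2_class (\<lambda>x. 1 :: real))"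
    by (rule norm_cauchy_schwarz)
  also have "norm (L2_class (\<lambda>x. norm (f x))) = norm (L2_class f)"
    by (rule power2_eq_imp_eq) (simp_all add: L2_class_norm n f)
  also have "norm (L2_class (\<lambda>x. 1 :: real)) \<le> 1"
    using 1 by (intro L2_class_norm_le) auto
  finally show ?thesis by (simp add: mult_left_mono)
qed

lemma square_integrable_01_integrable:
  assumes f: "square_integrable_01 f" and S: "S \<in> sets borel" "S \<subseteq> {0<..<1}"
  shows "set_integrable lborel S f"
proof -
  have "set_integrable lborel S (\<lambda>x. indicat_real {0<..<1} x *\<^sub>R f x)"
    by (rule locally_L2_integrable[OF locally_L2_extend[OF f], of _ 0 1]) (use S in auto)
  moreover have "set_integrable lborel S (\<lambda>x. indicat_real {0<..<1} x *\<^sub>R f x) = set_integrable lborel S f"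
    using S by (intro set_integrable_cong) auto
  ultimately show ?thesis by simp
qed

lemma primitive_norm_le_L2_norm:
  assumes g: "square_integrable_01 g" and x: "x \<in> {0..1}"
  shows "norm (LINT s:{0<..<x}|lborel. g s) \<le> norm (L2_class g)"
proof -
  have 1: "set_integrable lborel {0<..<1} (\<lambda>s. norm (g s))"
    using square_integrable_01_integrable[OF g, of "{0<..<1}"] by (intro set_integrable_norm) auto
  have "norm (LINT s:{0<..<x}|lborel. g s) \<le> (LINT s:{0<..<x}|lborel. norm (g s))"
    by (rule set_integral_norm_bound, rule square_integrable_01_integrable[OF g]) (use x in auto)
  also have "\<dots> \<le> (LINT s:{0<..<1}|lborel. norm (g s))"
    unfolding set_lebesgue_integral_def
  proof (rule integral_mono)
    have "set_integrable lborel {0<..<x} (\<lambda>s. norm (g s))"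
      by (rule set_integrable_subset[OF 1]) (use x in auto)
    then show "integrable lborel (\<lambda>s. indicat_real {0<..<x} s *\<^sub>R norm (g s))"
      by (simp add: set_integrable_def)
    show "integrable lborel (\<lambda>s. indicat_real {0<..<1} s *\<^sub>R norm (g s))"
      using 1 by (simp add: set_integrable_def)
  qed (use x in \<open>auto simp: indicator_def\<close>)
  also have "\<dots> \<le> norm (L2_class g)" by (rule integral_norm_le_L2_norm[OF g])
  finally show ?thesis .
qed

section \<open>Integration by parts in \<open>H\<^sup>1(0,1;E)\<close>\<close>

text \<open>For continuous \<open>g\<close> this is the fundamental theorem of calculus for \<open>(1 + c x) |F(x)|\<^sup>2\<close>.\<close>

lemma weighted_parts_continuous:
  fixes g :: "real \<Rightarrow> 'a::euclidean_space"
  assumes g: "continuous_on UNIV g"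
    and F: "\<And>x. x \<in> {0..1} \<Longrightarrow> F x = F 0 + (LINT s:{0<..<x}|lborel. g s)"
  shows "2 * (weight c (L2_class F) \<bullet> L2_class g) + c * (norm (L2_class F))\<^sup>2 =
    (1 + c) * (norm (F 1))\<^sup>2 - (norm (F 0))\<^sup>2"
proof -
  have gl: "locally_L2 g" using g by (rule locally_L2_continuous)
  have gs: "square_integrable_01 g" using gl by (rule locally_L2_square_integrable_01)
  have Fc: "continuous_on {0..1} F" by (rule H1_rep_continuous[OF gs]) (use F in blast)
  have Fs: "square_integrable_01 F" using Fc by (rule square_integrable_01_continuous)
  have F': "F 0 + integral {0..x} g = F x" if "x \<in> {0..1}" for x
    using F[OF that] by (simp add: locally_L2_integral[OF gl])
  have dF: "(F has_vector_derivative g x) (at x within {0..1})" if x: "x \<in> {0..1}" for x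
  proof -
    have "((\<lambda>x. F 0 + integral {0..x} g) has_vector_derivative 0 + g x) (at x within {0..1})"
      by (intro has_vector_derivative_add has_vector_derivative_const integral_has_vector_derivative x
          continuous_on_subset[OF g]) simp
    then have "((\<lambda>x. F 0 + integral {0..x} g) has_vector_derivative g x) (at x within {0..1})" by simp
    then show ?thesis by (rule has_vector_derivative_transform[OF x, rotated]) (use F' in auto)
  qed
  define q where "q x = c * (F x \<bullet> F x) + (1 + c * x) * (2 * (F x \<bullet> g x))" for x
  have "(q has_integral ((1 + c * 1) * (F 1 \<bullet> F 1) - (1 + c * 0) * (F 0 \<bullet> F 0))) {0..1}"
  proof (rule fundamental_theorem_of_calculus)
    fix x :: real assume x: "x \<in> {0..1}"
    have d: "((\<lambda>x. F x \<bullet> F x) has_vector_derivative (F x \<bullet> g x + g x \<bullet> F x)) (at x within {0..1})"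
      by (rule bounded_bilinear.has_vector_derivative[OF bounded_bilinear_inner dF[OF x] dF[OF x]])
    have w: "((\<lambda>x. 1 + c * x) has_vector_derivative c) (at x within {0..1})"
      by (auto intro!: derivative_eq_intros simp: has_real_derivative_iff_has_vector_derivative[symmetric])
    show "((\<lambda>x. (1 + c * x) * (F x \<bullet> F x)) has_vector_derivative q x) (at x within {0..1})"
      using bounded_bilinear.has_vector_derivative[OF bounded_bilinear_mult w d]
      by (simp add: q_def inner_commute algebra_simps)
  qed simp
  then have iq: "integral {0..1} q = (1 + c) * (norm (F 1))\<^sup>2 - (norm (F 0))\<^sup>2"
    by (simp add: integral_unique power2_norm_eq_inner)
  have i1: "set_integrable lborel {0<..<1} (\<lambda>x. c * (F x \<bullet> F x))"
    using square_integrable_01_inner[OF Fs Fs] by (rule set_integrable_mult_right)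
  have i2: "set_integrable lborel {0<..<1} (\<lambda>x. 2 * ((1 + c * x) * (F x \<bullet> g x)))"
    using square_integrable_01_inner[OF square_integrable_01_weight[OF Fs] gs, of c]
    by (intro set_integrable_mult_right) simp
  have q: "q = (\<lambda>x. c * (F x \<bullet> F x) + 2 * ((1 + c * x) * (F x \<bullet> g x)))"
    by (auto simp: q_def)
  have "integral {0..1} q = (LINT x:{0<..<1}|lborel. q x)"
    using set_borel_integral_eq_integral(2)[OF set_integral_add(1)[OF i1 i2]] unfolding q
    by (simp add: integral_open_interval_real)
  also have "\<dots> = 2 * (weight c (L2_class F) \<bullet> L2_class g) + c * (norm (L2_class F))\<^sup>2"
    unfolding q set_integral_add(2)[OF i1 i2]
    by (simp add: weight_inner Fs gs L2_class_norm) (simp add: power2_norm_eq_inner)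
  finally show ?thesis using iq by simp
qed

text \<open>Both sides depend continuously on the derivative in \<open>L\<^sup>2\<close> when the value at \<open>0\<close> is kept, so the
  identity passes from continuous derivatives to arbitrary ones by density.\<close>

lemma weighted_parts:
  fixes Z :: "'a::euclidean_space L2"
  assumes "H1_rep Z F G"
  shows "2 * (weight c Z \<bullet> G) + c * (norm Z)\<^sup>2 = (1 + c) * (norm (F 1))\<^sup>2 - (norm (F 0))\<^sup>2"
proof -
  obtain g where Fs: "square_integrable_01 F" and Z: "Z = L2_class F" and gs: "square_integrable_01 g"
    and G: "G = L2_class g" and F: "\<And>x. x \<in> {0..1} \<Longrightarrow> F x = F 0 + (LINT s:{0<..<x}|lborel. g s)"
    using assms unfolding H1_rep_def by blast
  define g' where "g' x = indicat_real {0<..<1} x *\<^sub>R g x" for x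
  have g': "locally_L2 g'" unfolding g'_def by (rule locally_L2_extend[OF gs])
  have "\<exists>h. continuous_on UNIV h \<and> (LINT s:{0..1}|lborel. (norm (g' s - h s))\<^sup>2) < (1 / Suc n)\<^sup>2" for n
    by (rule locally_L2_approx_continuous[OF g', of "(1 / Suc n)\<^sup>2" 0 1]) (auto simp del: of_nat_Suc)
  then obtain h where hc: "\<And>n. continuous_on UNIV (h n)"
    and happ: "\<And>n. (LINT s:{0..1}|lborel. (norm (g' s - h n s))\<^sup>2) < (1 / Suc n)\<^sup>2"
    by metis
  have hl: "locally_L2 (h n)" for n using hc by (rule locally_L2_continuous)
  have hs: "square_integrable_01 (h n)" for n using hl by (rule locally_L2_square_integrable_01)
  define H where "H n x = F 0 + (LINT s:{0<..<x}|lborel. h n s)" for n x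
  have H0: "H n 0 = F 0" for n by (simp add: H_def set_lebesgue_integral_def)
  have Hs: "square_integrable_01 (H n)" for n
    by (intro square_integrable_01_continuous H1_rep_continuous[OF hs[of n]]) (simp add: H0, simp add: H_def)
  have near: "norm (G - L2_class (h n)) \<le> 1 / Suc n" for n
  proof (rule power2_le_imp_le)
    have i: "set_integrable lborel {0..1} (\<lambda>s. (norm (g' s - h n s))\<^sup>2)"
      using locally_L2_diff[OF g' hl[of n]] by (simp add: locally_L2_def)
    have "(norm (G - L2_class (h n)))\<^sup>2 = (LINT s:{0<..<1}|lborel. (norm (g s - h n s))\<^sup>2)"
      unfolding G L2_class_diff[OF gs hs] by (rule L2_class_norm[OF square_integrable_01_diff[OF gs hs]])
    also have "\<dots> = (LINT s:{0<..<1}|lborel. (norm (g' s - h n s))\<^sup>2)"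
      by (intro set_lebesgue_integral_cong) (auto simp: g'_def)
    also have "\<dots> \<le> (LINT s:{0..1}|lborel. (norm (g' s - h n s))\<^sup>2)"
      unfolding set_lebesgue_integral_def
    proof (rule integral_mono)
      have "set_integrable lborel {0<..<1} (\<lambda>s. (norm (g' s - h n s))\<^sup>2)"
        by (rule set_integrable_subset[OF i]) auto
      then show "integrable lborel (\<lambda>s. indicat_real {0<..<1} s *\<^sub>R (norm (g' s - h n s))\<^sup>2)"
        by (simp add: set_integrable_def)
      show "integrable lborel (\<lambda>s. indicat_real {0..1} s *\<^sub>R (norm (g' s - h n s))\<^sup>2)"
        using i by (simp add: set_integrable_def)
    qed (auto simp: indicator_def)
    finally show "(norm (G - L2_class (h n)))\<^sup>2 \<le> (1 / Suc n)\<^sup>2" using happ[of n] by linarith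
  qed simp
  have nearF: "norm (F x - H n x) \<le> 1 / Suc n" if x: "x \<in> {0..1}" for n x
  proof -
    have "F x - H n x = (LINT s:{0<..<x}|lborel. g s - h n s)"
      using F[OF x] x unfolding H_def
      by (subst set_integral_diff(2)) (auto intro!: square_integrable_01_integrable gs hs)
    also have "norm \<dots> \<le> norm (L2_class (\<lambda>s. g s - h n s))"
      by (intro primitive_norm_le_L2_norm square_integrable_01_diff gs hs x)
    also have "\<dots> \<le> 1 / Suc n" using near[of n] by (simp add: G L2_class_diff[OF gs hs])
    finally show ?thesis .
  qed
  have null: "(\<lambda>n. 1 / real (Suc n)) \<longlonglongrightarrow> 0" by (rule LIMSEQ_Suc[OF lim_1_over_n])
  have limG: "(\<lambda>n. L2_class (h n)) \<longlonglongrightarrow> G"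
    by (rule metric_tendsto_imp_tendsto[OF null]) (use near in \<open>simp add: dist_norm norm_minus_commute\<close>)
  have lim1: "(\<lambda>n. H n 1) \<longlonglongrightarrow> F 1"
    by (rule metric_tendsto_imp_tendsto[OF null]) (use nearF[of 1] in \<open>simp add: dist_norm norm_minus_commute\<close>)
  have "norm (Z - L2_class (H n)) \<le> 1 / Suc n" for n
    unfolding Z L2_class_diff[OF Fs Hs]
    by (rule L2_class_norm_le[OF square_integrable_01_diff[OF Fs Hs]]) (use nearF in auto)
  then have limZ: "(\<lambda>n. L2_class (H n)) \<longlonglongrightarrow> Z"
    by (intro metric_tendsto_imp_tendsto[OF null]) (simp add: dist_norm norm_minus_commute)
  have "(\<lambda>n. 2 * (weight c (L2_class (H n)) \<bullet> L2_class (h n)) + c * (norm (L2_class (H n)))\<^sup>2)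
      \<longlonglongrightarrow> 2 * (weight c Z \<bullet> G) + c * (norm Z)\<^sup>2"
    by (intro tendsto_intros bounded_linear.tendsto[OF bounded_linear_weight] limG limZ)
  moreover have "(\<lambda>n. (1 + c) * (norm (H n 1))\<^sup>2 - (norm (F 0))\<^sup>2)
      \<longlonglongrightarrow> (1 + c) * (norm (F 1))\<^sup>2 - (norm (F 0))\<^sup>2"
    by (intro tendsto_intros lim1)
  moreover have "2 * (weight c (L2_class (H n)) \<bullet> L2_class (h n)) + c * (norm (L2_class (H n)))\<^sup>2
      = (1 + c) * (norm (H n 1))\<^sup>2 - (norm (F 0))\<^sup>2" for n
    using weighted_parts_continuous[OF hc[of n], of "H n"] by (simp add: H0) (simp add: H_def)
  ultimately show ?thesis by (simp add: LIMSEQ_unique)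
qed

section \<open>Uniqueness of solutions\<close>

lemma H1_rep_diff:
  assumes "H1_rep Z F G" "H1_rep Z' F' G'"
  shows "H1_rep (Z - Z') (\<lambda>x. F x - F' x) (G - G')"
proof -
  obtain g where Fs: "square_integrable_01 F" and Z: "Z = L2_class F" and gs: "square_integrable_01 g"
    and G: "G = L2_class g" and F: "\<And>x. x \<in> {0..1} \<Longrightarrow> F x = F 0 + (LINT s:{0<..<x}|lborel. g s)"
    using assms(1) unfolding H1_rep_def by blast
  obtain g' where Fs': "square_integrable_01 F'" and Z': "Z' = L2_class F'" and gs': "square_integrable_01 g'"
    and G': "G' = L2_class g'" and F': "\<And>x. x \<in> {0..1} \<Longrightarrow> F' x = F' 0 + (LINT s:{0<..<x}|lborel. g' s)"
    using assms(2) unfolding H1_rep_def by blast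
  have "F x - F' x = F 0 - F' 0 + (LINT s:{0<..<x}|lborel. g s - g' s)" if x: "x \<in> {0..1}" for x
  proof -
    have "(LINT s:{0<..<x}|lborel. g s - g' s) =
      (LINT s:{0<..<x}|lborel. g s) - (LINT s:{0<..<x}|lborel. g' s)"
      by (rule set_integral_diff(2); rule square_integrable_01_integrable) (use x gs gs' in auto)
    then show ?thesis using F[OF x] F'[OF x] by simp
  qed
  then show ?thesis
    unfolding H1_rep_def Z Z' G G' L2_class_diff[OF Fs Fs'] L2_class_diff[OF gs gs']
    using square_integrable_01_diff[OF Fs Fs'] square_integrable_01_diff[OF gs gs'] by blast
qed

lemma transport_solution_diff:
  assumes "transport_solution lam z0 z F" "transport_solution lam z0' z' F'"
  shows "transport_solution lam (z0 - z0') (\<lambda>t. z t - z' t) (\<lambda>t x. F t x - F' t x)"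
  unfolding transport_solution_def
proof (intro conjI allI impI)
  show "continuous_on {0..} (\<lambda>t. z t - z' t)"
    using assms by (intro continuous_intros) (auto simp: transport_solution_def)
  fix t :: real assume t: "t \<ge> 0"
  obtain Z G where 1: "(z has_integral Z) {0..t}" "H1_rep Z (F t) G" "z t - z0 = - lam *\<^sub>R G"
    using assms(1) t unfolding transport_solution_def by blast
  obtain Z' G' where 2: "(z' has_integral Z') {0..t}" "H1_rep Z' (F' t) G'" "z' t - z0' = - lam *\<^sub>R G'"
    using assms(2) t unfolding transport_solution_def by blast
  have "z t - z' t - (z0 - z0') = (z t - z0) - (z' t - z0')" by simp
  also have "\<dots> = - lam *\<^sub>R (G - G')" by (simp only: 1(3) 2(3) scaleR_diff_right)
  finally have "z t - z' t - (z0 - z0') = - lam *\<^sub>R (G - G')" .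
  then show "\<exists>Z G. ((\<lambda>t. z t - z' t) has_integral Z) {0..t} \<and> H1_rep Z (\<lambda>x. F t x - F' t x) G \<and>
      z t - z' t - (z0 - z0') = - lam *\<^sub>R G"
    using has_integral_diff[OF 1(1) 2(1)] H1_rep_diff[OF 1(2) 2(2)] by blast
qed

text \<open>The exceptional points form an open set of measure zero, hence none exist; the end points follow
  by passing to the closure.\<close>

lemma continuous_AE_closed:
  fixes F :: "real \<Rightarrow> 'a::euclidean_space"
  assumes F: "continuous_on {0..1} F" and C: "closed C"
    and ae: "AE x in lborel. x \<in> {0<..<1} \<longrightarrow> F x \<in> C" and x: "x \<in> {0..1}"
  shows "F x \<in> C"
proof -
  define S where "S = {0<..<1} \<inter> F -` (- C)"
  have "open S"
    unfolding S_def
    by (rule continuous_open_preimage[OF continuous_on_subset[OF F]]) (use C in auto)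
  moreover have "negligible S"
  proof -
    have "AE x in lborel. x \<notin> S" using ae by eventually_elim (auto simp: S_def)
    moreover have "S \<in> sets lborel" using \<open>open S\<close> by simp
    ultimately have "S \<in> null_sets lborel" by (simp add: AE_iff_null_sets)
    then show ?thesis by (simp add: negligible_iff_null_sets null_sets_completionI)
  qed
  ultimately have "S = {}" using open_not_negligible by blast
  then have sub: "{0<..<1} \<subseteq> {0..1} \<inter> F -` C" by (auto simp: S_def)
  have "closed ({0..1} \<inter> F -` C)" using F C by (intro continuous_closed_preimage) auto
  then have "closure {0<..<1::real} \<subseteq> {0..1} \<inter> F -` C" using sub by (rule closure_minimal[rotated])
  then show ?thesis using x by auto
qed

lemma H1_rep_zero:
  assumes "H1_rep 0 F G" "x \<in> {0..1}" shows "F x = 0"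
proof -
  have Fs: "square_integrable_01 F" "L2_class F = L2_class (\<lambda>x. 0)" and c: "continuous_on {0..1} F"
    using assms(1) H1_rep_continuous unfolding H1_rep_def L2_class_zero by auto
  have "AE x in lborel. x \<in> {0<..<1} \<longrightarrow> F x \<in> {0}"
    using Fs by (simp add: L2_class_eq_iff square_integrable_01_zero)
  then show ?thesis using continuous_AE_closed[OF c closed_singleton _ assms(2)] by blast
qed

text \<open>Energy estimate. By \<open>weighted_parts\<close> the derivative of the weighted energy \<open>E\<close> of \<open>Z(t)\<close> is
  \<open>lam\<close> times \<open>c \<parallel>Z\<parallel>\<^sup>2 + |F t 0|\<^sup>2 - (1 + c) |F t 1|\<^sup>2\<close>. With \<open>c = N\<^sup>2\<close> the boundary terms are
  nonpositive together, so \<open>E' \<le> lam c E\<close>, and \<open>E\<close> starts at \<open>0\<close>.\<close>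

theorem transport_solution_unique_zero:
  fixes z :: "real \<Rightarrow> 'a::euclidean_space L2"
  assumes sol: "transport_solution lam 0 z F" and lam: "lam > 0"
    and bd: "\<And>t. t \<ge> 0 \<Longrightarrow> norm (F t 0) \<le> N * norm (F t 1)" and t: "t \<ge> 0"
  shows "z t = 0" and "x \<in> {0..1} \<Longrightarrow> F t x = 0"
proof -
  have c: "continuous_on {0..} z" using sol by (simp add: transport_solution_def)
  have "\<forall>t\<ge>0. \<exists>Z G. (z has_integral Z) {0..t} \<and> H1_rep Z (F t) G \<and> z t = - lam *\<^sub>R G"
    using sol by (simp add: transport_solution_def)
  then obtain Z G where int: "\<And>t. t \<ge> 0 \<Longrightarrow> (z has_integral Z t) {0..t}"
    and H1: "\<And>t. t \<ge> 0 \<Longrightarrow> H1_rep (Z t) (F t) (G t)" and zG: "\<And>t. t \<ge> 0 \<Longrightarrow> z t = - lam *\<^sub>R G t"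
    by metis
  have dZ: "(Z has_vector_derivative z t) (at t within {0..})" if "t \<ge> 0" for t
    using has_vector_derivative_weakI[OF c int that] .
  \<comment> \<open>Chosen so that \<open>|F t 0|\<^sup>2 \<le> c |F t 1|\<^sup>2\<close>.\<close>
  define c where "c = N\<^sup>2"
  define E where "E t = weight c (Z t) \<bullet> Z t" for t
  define u where "u t = exp (- (lam * c) * t) * E t" for t
  have c0: "c \<ge> 0" by (simp add: c_def)
  have dE: "(E has_real_derivative (2 * (weight c (Z t) \<bullet> z t))) (at t within {0..})" if t: "t \<ge> 0" for t
  proof -
    have "((\<lambda>t. weight c (Z t) \<bullet> Z t) has_vector_derivative
        (weight c (Z t) \<bullet> z t + weight c (z t) \<bullet> Z t)) (at t within {0..})"
      by (rule bounded_bilinear.has_vector_derivative[OF bounded_bilinear_inner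
          bounded_linear.has_vector_derivative[OF bounded_linear_weight dZ[OF t]] dZ[OF t]])
    moreover have "weight c (z t) \<bullet> Z t = weight c (Z t) \<bullet> z t"
      by (metis weight_sym inner_commute)
    ultimately show ?thesis
      unfolding E_def by (simp add: has_real_derivative_iff_has_vector_derivative)
  qed
  have decay: "2 * (weight c (Z t) \<bullet> z t) \<le> lam * c * E t" if t: "t \<ge> 0" for t
  proof -
    have "(norm (F t 0))\<^sup>2 \<le> (N * norm (F t 1))\<^sup>2" by (rule power_mono[OF bd[OF t]]) simp
    also have "\<dots> \<le> (1 + c) * (norm (F t 1))\<^sup>2" by (simp add: c_def power_mult_distrib algebra_simps)
    finally have "0 \<le> (1 + c) * (norm (F t 1))\<^sup>2 - (norm (F t 0))\<^sup>2" by simp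
    also have "\<dots> = 2 * (weight c (Z t) \<bullet> G t) + c * (norm (Z t))\<^sup>2"
      by (rule weighted_parts[OF H1[OF t], symmetric])
    finally have "- (2 * (weight c (Z t) \<bullet> G t)) \<le> c * (norm (Z t))\<^sup>2" by simp
    also have "\<dots> \<le> c * E t" unfolding E_def using weight_inner_ge[OF c0] c0 by (rule mult_left_mono)
    finally have "lam * (- (2 * (weight c (Z t) \<bullet> G t))) \<le> lam * (c * E t)"
      using lam by (intro mult_left_mono) auto
    then show ?thesis by (simp add: zG[OF t] mult_ac)
  qed
  have du: "(u has_real_derivative (exp (- (lam * c) * t) * (2 * (weight c (Z t) \<bullet> z t) - lam * c * E t))) (at t within {0..})"
    if t: "t \<ge> 0" for t
    unfolding u_def by (rule derivative_eq_intros dE[OF t] refl | simp add: algebra_simps)+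
  have Z0: "Z 0 = 0" using int[of 0] has_integral_null_eq[of 0 "0::real" z "Z 0"] by simp
  have zero: "Z t = 0" if t: "t \<ge> 0" for t
  proof -
    have "u t \<le> u 0"
    proof (rule DERIV_nonpos_imp_decreasing_open[OF t])
      fix x assume x: "0 < x" "x < t"
      then have "at x within {0..} = at x" by (intro at_within_interior) (simp add: interior_Ici)
      then have "DERIV u x :> exp (- (lam * c) * x) * (2 * (weight c (Z x) \<bullet> z x) - lam * c * E x)"
        using du[of x] x by simp
      moreover have "exp (- (lam * c) * x) * (2 * (weight c (Z x) \<bullet> z x) - lam * c * E x) \<le> 0"
        using decay[of x] x by (intro mult_nonneg_nonpos) auto
      ultimately show "\<exists>y. DERIV u x :> y \<and> y \<le> 0" by blast
    next
      have "continuous_on {0..} u" using du by (intro DERIV_continuous_on) auto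
      then show "continuous_on {0..t} u" by (rule continuous_on_subset) auto
    qed
    then have "E t \<le> 0" by (simp add: u_def E_def Z0 mult_le_0_iff)
    then have "(norm (Z t))\<^sup>2 \<le> 0" using weight_inner_ge[OF c0, of "Z t"] unfolding E_def by linarith
    then show ?thesis by simp
  qed
  show "F t x = 0" if "x \<in> {0..1}" using H1[OF t] zero[OF t] that H1_rep_zero by metis
  have "((\<lambda>t. 0) has_vector_derivative z t) (at t within {0..})"
    by (rule has_vector_derivative_transform[OF _ _ dZ[OF t]]) (use t zero in auto)
  then have "((\<lambda>t. 0) has_vector_derivative z t) (at t within cbox 0 (t + 1))"
    by (rule has_vector_derivative_within_subset) auto
  then show "z t = 0"
    using t by (intro vector_derivative_unique_within_closed_interval[of 0 "t + 1" t "\<lambda>t. 0"]) auto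
qed

text \<open>Open intervals are stable under intersection and generate the Borel sets, so all integrals of \<open>v\<close>
  over Borel subsets of \<open>(0,n)\<close> vanish as well.\<close>

lemma AE_zero_of_integral_zero:
  fixes v :: "real \<Rightarrow> 'a::euclidean_space"
  assumes v: "locally_L2 v" and zero: "\<And>t. t > 0 \<Longrightarrow> (LINT s:{0<..<t}|lborel. v s) = 0"
  shows "AE t in lborel. t > 0 \<longrightarrow> v t = 0"
proof -
  have I: "integral {a..b} v = 0" if "0 \<le> a" "a \<le> b" for a b
  proof -
    have z: "integral {0..t} v = 0" if "t \<ge> 0" for t
      using zero[of t] that locally_L2_integral[OF v, of 0 t] by (cases "t = 0") auto
    then show ?thesis
      using Henstock_Kurzweil_Integration.integral_combine[OF that locally_L2_integrable_on[OF v]] that by simp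
  qed
  have "AE s in lborel. indicat_real {0<..<n} s *\<^sub>R v s = 0" for n :: real
  proof -
    let ?w = "\<lambda>s. indicat_real {0<..<n} s *\<^sub>R v s"
    have w: "integrable lborel ?w"
      using locally_L2_integrable[OF v, of "{0<..<n}" 0 n] by (simp add: set_integrable_def greaterThanLessThan_subseteq_atLeastAtMost_iff)
    have wI: "(LINT s:{a<..<b}|lborel. ?w s) = 0" for a b
    proof (cases "max a 0 \<le> min b n")
      case True
      have "{a<..<b} \<inter> {0<..<n} = {max a 0<..<min b n}" by auto
      then have "(LINT s:{a<..<b}|lborel. ?w s) = (LINT s:{max a 0<..<min b n}|lborel. v s)"
        unfolding set_lebesgue_integral_def
        by (intro Bochner_Integration.integral_cong) (auto simp: indicator_def)
      also have "\<dots> = 0" unfolding locally_L2_integral[OF v] using True by (intro I) auto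
      finally show ?thesis .
    next
      case False
      then have "indicat_real {a<..<b} s *\<^sub>R ?w s = 0" for s by (auto simp: indicator_def)
      then show ?thesis unfolding set_lebesgue_integral_def by (simp only: integral_zero)
    qed
    show ?thesis
    proof (rule sigma_finite_measure.density_zero[OF sigma_finite_lborel w])
      fix A :: "real set" assume "A \<in> sets lborel"
      then have A: "A \<in> sets borel" by simp
      let ?G = "range (\<lambda>(a, b). {a<..<b}) :: real set set"
      have "sets (borel :: real measure) = sets (sigma UNIV ?G)"
        by (subst borel_eq_box, intro arg_cong[where f = "\<lambda>G. sets (sigma UNIV G)"] image_cong)
          (auto simp del: box_real simp: box_real)
      also have "\<dots> = sigma_sets UNIV ?G" by (rule sets_measure_of) simp
      finally have G: "sets lborel = sigma_sets UNIV ?G" by simp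
      have "Int_stable ?G" by (auto simp: Int_stable_def)
      moreover have "?G \<subseteq> Pow UNIV" by simp
      moreover have "A \<in> sigma_sets UNIV ?G" using A G by simp
      ultimately show "(LINT s:A|lborel. ?w s) = 0"
      proof (induction rule: sigma_sets_induct_disjoint)
        case (basic B) then show ?case using wI by auto
      next
        case empty then show ?case by (simp add: set_lebesgue_integral_def)
      next
        case (compl B)
        have B: "B \<in> sets lborel" using compl(1) G by simp
        have "(LINT s:UNIV|lborel. ?w s) = (LINT s:{-1<..<n}|lborel. ?w s)"
          unfolding set_lebesgue_integral_def
          by (intro Bochner_Integration.integral_cong) (auto simp: indicator_def)
        also have "\<dots> = 0" by (rule wI)
        finally have total: "(LINT s:UNIV|lborel. ?w s) = 0" .
        have "(LINT s:B \<union> (UNIV - B)|lborel. ?w s) = (LINT s:B|lborel. ?w s) + (LINT s:UNIV - B|lborel. ?w s)"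
        proof (rule set_integral_Un)
          have "UNIV - B \<in> sets lborel" using B by auto
          then show "set_integrable lborel (UNIV - B) ?w"
            unfolding set_integrable_def by (rule integrable_mult_indicator[OF _ w])
          show "set_integrable lborel B ?w"
            unfolding set_integrable_def by (rule integrable_mult_indicator[OF B w])
        qed simp
        moreover have "B \<union> (UNIV - B) = UNIV" by blast
        ultimately show ?case using compl(2) total by (metis add_0)
      next
        case (union B)
        have B: "B i \<in> sets lborel" for i using union(2) G by auto
        have "(LINT s:(\<Union>i. B i)|lborel. ?w s) = (\<Sum>i. (LINT s:B i|lborel. ?w s))"
        proof (rule lebesgue_integral_countable_add)
          show "set_integrable lborel (\<Union>i. B i) ?w"
            unfolding set_integrable_def by (rule integrable_mult_indicator[OF _ w]) (use B in blast)
        qed (use union(1) B in \<open>auto simp: disjoint_family_on_def\<close>)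
        then show ?case using union by simp
      qed
    qed
  qed
  then have "AE s in lborel. \<forall>n::nat. indicat_real {0<..<real n} s *\<^sub>R v s = 0"
    unfolding AE_all_countable by blast
  then show ?thesis
  proof eventually_elim
    fix s assume a: "\<forall>n::nat. indicat_real {0<..<real n} s *\<^sub>R v s = 0"
    obtain n :: nat where "s < real n" using reals_Archimedean2 by blast
    then show "s > 0 \<longrightarrow> v s = 0" using a[rule_format, of n] by auto
  qed
qed

section \<open>The delay equation\<close>

lemma locally_L2_restrict:
  assumes "locally_L2 f" "S \<in> sets borel"
  shows "locally_L2 (\<lambda>s. indicat_real S s *\<^sub>R f s)"
proof (rule locally_L2_bound[OF _ assms(1), of _ 1])
  have [measurable]: "f \<in> borel_measurable borel" "S \<in> sets borel"
    using assms by (auto simp: locally_L2_measurable)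
  show "(\<lambda>s. indicat_real S s *\<^sub>R f s) \<in> borel_measurable borel" by measurable
qed (auto simp: indicator_def)

text \<open>The solution of \<open>x(s) = A x(s - 1) + f(s)\<close>, \<open>s \<ge> 0\<close>, with history \<open>b\<close>. The recursion stops since
  each call lowers \<open>s\<close> by one.\<close>

function delay :: "('a::real_normed_vector \<Rightarrow> 'a) \<Rightarrow> (real \<Rightarrow> 'a) \<Rightarrow> (real \<Rightarrow> 'a) \<Rightarrow> real \<Rightarrow> 'a" where
  "delay A b f s = (if s < 0 then b s else A (delay A b f (s - 1)) + f s)"
  by pat_completeness auto
termination
proof (relation "Wellfounded.measure (\<lambda>(A, b, f, s). nat (\<lfloor>s\<rfloor> + 1))")
  fix A :: "'a \<Rightarrow> 'a" and b f :: "real \<Rightarrow> 'a" and s :: real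
  assume "\<not> s < 0"
  then have "\<lfloor>s\<rfloor> \<ge> 0" by simp
  then show "((A, b, f, s - 1), A, b, f, s) \<in> Wellfounded.measure (\<lambda>(A, b, f, s). nat (\<lfloor>s\<rfloor> + 1))"
    by simp
qed simp

declare delay.simps [simp del]

lemma delay_neg: "s < 0 \<Longrightarrow> delay A b f s = b s"
  by (subst delay.simps) simp

lemma delay_nonneg: "s \<ge> 0 \<Longrightarrow> delay A b f s = A (delay A b f (s - 1)) + f s"
  by (subst delay.simps) simp

text \<open>The truncations to \<open>s < k\<close> are locally square integrable by induction on \<open>k\<close>, and on each bounded
  interval all but finitely many of them agree with the solution.\<close>

lemma locally_L2_delay:
  fixes A :: "'a::euclidean_space \<Rightarrow> 'a"
  assumes A: "bounded_linear A" and b: "locally_L2 b" and f: "locally_L2 f"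
  shows "locally_L2 (delay A b f)"
proof -
  let ?D = "\<lambda>k s. indicat_real {..<real k} s *\<^sub>R delay A b f s"
  have D: "locally_L2 (?D k)" for k
  proof (induction k)
    case 0
    have "?D 0 = (\<lambda>s. indicat_real {..<0} s *\<^sub>R b s)"
      by (auto simp: indicator_def fun_eq_iff delay_neg)
    then show ?case using locally_L2_restrict[OF b, of "{..<0}"] by simp
  next
    case (Suc k)
    have "locally_L2 (\<lambda>s. A (?D k (-1 + 1 * s)) + f s)"
      by (intro locally_L2_add f locally_L2_linear[OF _ A] locally_L2_affine[OF Suc]) simp
    from locally_L2_add[OF locally_L2_restrict[OF b, of "{..<0}"] locally_L2_restrict[OF this, of "{0..<real (Suc k)}"]]
    have "locally_L2 (\<lambda>s. indicat_real {..<0} s *\<^sub>R b s +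
      indicat_real {0..<real (Suc k)} s *\<^sub>R (A (?D k (-1 + 1 * s)) + f s))" by simp
    moreover have "?D (Suc k) s = indicat_real {..<0} s *\<^sub>R b s +
      indicat_real {0..<real (Suc k)} s *\<^sub>R (A (?D k (-1 + 1 * s)) + f s)" for s
      by (cases "s < 0") (auto simp: indicator_def delay_neg delay_nonneg)
    ultimately show ?case by presburger
  qed
  have ev: "\<forall>\<^sub>F k in sequentially. ?D k s = delay A b f s" for s
  proof -
    obtain k where "s < real k" using reals_Archimedean2 by blast
    then have "?D n s = delay A b f s" if "n \<ge> k" for n using that by (auto simp: indicator_def)
    then show ?thesis unfolding eventually_sequentially by blast
  qed
  have "delay A b f \<in> borel_measurable borel"
    by (rule borel_measurable_LIMSEQ_metric[OF locally_L2_measurable[OF D]]) (rule tendsto_eventually[OF ev])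
  moreover have "set_integrable lborel {x..y} (\<lambda>s. (norm (delay A b f s))\<^sup>2)" for x y
  proof -
    obtain k where k: "y < real k" using reals_Archimedean2 by blast
    have "set_integrable lborel {x..y} (\<lambda>s. (norm (?D k s))\<^sup>2)"
      using D by (simp only: locally_L2_def)
    moreover have "set_integrable lborel {x..y} (\<lambda>s. (norm (?D k s))\<^sup>2) =
      set_integrable lborel {x..y} (\<lambda>s. (norm (delay A b f s))\<^sup>2)"
      using k by (intro set_integrable_cong) (auto simp: indicator_def)
    ultimately show ?thesis by blast
  qed
  ultimately show ?thesis by (simp add: locally_L2_def)
qed

lemma AE_affine:
  assumes "AE x in lborel. P x" "c \<noteq> (0::real)"
  shows "AE x in lborel. P (t + c * x)"
proof -
  obtain N where N: "{x. \<not> P x} \<subseteq> N" "N \<in> sets lborel" "emeasure lborel N = 0"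
    using assms(1) by (auto elim!: AE_E)
  have "AE x in lborel. x \<notin> N" using N by (intro AE_not_in) (auto simp: null_sets_def)
  then have "AE x in lborel. t + c * x \<notin> N"
    using N(2) assms(2) by (intro AE_borel_affine) auto
  then show ?thesis by eventually_elim (use N in auto)
qed

section \<open>Functions with values in a subspace\<close>

lemma wave_in_L2_on:
  assumes f: "locally_L2 f" and W: "AE s in lborel. s > -1 \<longrightarrow> f s \<in> W"
    and lam: "lam > 0" and t: "t \<ge> 0"
  shows "wave lam f t \<in> L2_on W"
proof -
  have "AE x in lborel. lam * t + -1 * x > -1 \<longrightarrow> f (lam * t + -1 * x) \<in> W"
    using W by (rule AE_affine) simp
  then have "AE x in lborel. x \<in> {0<..<1} \<longrightarrow> f (lam * t - x) \<in> W"
  proof eventually_elim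
    case (elim x)
    have "0 \<le> lam * t" using lam t by simp
    then show ?case using elim by auto
  qed
  then show ?thesis
    unfolding wave_def L2_on_def
    using locally_L2_square_integrable_01[OF locally_L2_reflect[OF f]] by blast
qed

lemma L2_on_representative:
  assumes X: "X \<in> L2_on W" and W: "closed W" "0 \<in> W"
  obtains k where "locally_L2 k" "X = L2_class k" "\<And>x. k x \<in> W"
proof -
  obtain f where f: "square_integrable_01 f" "X = L2_class f"
    and ae: "AE x in lborel. x \<in> {0<..<1} \<longrightarrow> f x \<in> W"
    using X unfolding L2_on_def by blast
  define g where "g x = indicat_real {0<..<1} x *\<^sub>R f x" for x
  have g: "locally_L2 g" unfolding g_def by (rule locally_L2_extend[OF f(1)])
  have [measurable]: "g \<in> borel_measurable borel" "W \<in> sets borel"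
    using g W by (auto simp: locally_L2_measurable)
  define k where "k x = (if g x \<in> W then g x else 0)" for x
  have k: "locally_L2 k"
  proof (rule locally_L2_bound[OF _ g, of _ 1])
    show "k \<in> borel_measurable borel" unfolding k_def by measurable
  qed (simp add: k_def)
  show thesis
  proof (rule that[OF k])
    show "k x \<in> W" for x using W by (simp add: k_def)
    have "AE x in lborel. x \<in> {0<..<1} \<longrightarrow> f x = k x"
      using ae by eventually_elim (auto simp: k_def g_def)
    then show "X = L2_class k"
      unfolding f(2) using L2_class_eq_iff[OF f(1) locally_L2_square_integrable_01[OF k]] by simp
  qed
qed

text \<open>For \<open>b\<close> orthogonal to \<open>W\<close> every \<open>z s\<close> is orthogonal to the class of \<open>(F \<bullet> b) b\<close>, hence so is the
  integral \<open>Z\<close>, the class of \<open>F\<close>; this says that \<open>F \<bullet> b\<close> vanishes in \<open>L\<^sup>2\<close>, and by continuity everywhere.\<close>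

lemma L2_on_integral_trace:
  fixes z :: "real \<Rightarrow> 'a::euclidean_space L2"
  assumes W: "subspace W" and z: "\<And>s. s \<in> {0..t} \<Longrightarrow> z s \<in> L2_on W"
    and int: "(z has_integral Z) {0..t}" and H1: "H1_rep Z F G" and x: "x \<in> {0..1}"
  shows "F x \<in> W"
proof -
  have Fs: "square_integrable_01 F" and Z: "Z = L2_class F" and c: "continuous_on {0..1} F"
    using H1 H1_rep_continuous unfolding H1_rep_def by auto
  have "F x \<bullet> b = 0" if b: "\<And>w. w \<in> W \<Longrightarrow> w \<bullet> b = 0" for b
  proof -
    let ?h = "\<lambda>x. (F x \<bullet> b) *\<^sub>R b"
    have h: "square_integrable_01 ?h"
      by (intro square_integrable_01_continuous continuous_intros c)
    have zero: "z s \<bullet> L2_class ?h = 0" if s: "s \<in> {0..t}" for s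
    proof -
      obtain f where f: "square_integrable_01 f" "z s = L2_class f"
        and ae: "AE x in lborel. x \<in> {0<..<1} \<longrightarrow> f x \<in> W"
        using z[OF s] unfolding L2_on_def by blast
      have "z s \<bullet> L2_class ?h = (LINT x:{0<..<1}|lborel. f x \<bullet> ?h x)"
        unfolding f(2) by (rule L2_class_inner[OF f(1) h])
      also have "\<dots> = 0"
        unfolding set_lebesgue_integral_def
      proof (rule integral_eq_zero_AE)
        show "AE x in lborel. indicat_real {0<..<1} x *\<^sub>R (f x \<bullet> (F x \<bullet> b) *\<^sub>R b) = 0"
          using ae by eventually_elim (use b in \<open>auto simp: indicator_def\<close>)
      qed
      finally show ?thesis .
    qed
    have "((\<lambda>s. z s \<bullet> L2_class ?h) has_integral (Z \<bullet> L2_class ?h)) {0..t}"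
      using has_integral_linear[OF int bounded_linear_inner_left[of "L2_class ?h"]] by (simp add: o_def)
    then have "Z \<bullet> L2_class ?h = 0"
      by (rule has_integral_unique[OF _ has_integral_is_0[OF zero]])
    then have "(LINT x:{0<..<1}|lborel. (F x \<bullet> b) * (F x \<bullet> b)) = 0"
      unfolding Z L2_class_inner[OF Fs h] by simp
    moreover have "set_integrable lborel {0<..<1} (\<lambda>x. (F x \<bullet> b) * (F x \<bullet> b))"
      using square_integrable_01_inner[OF Fs h] by simp
    ultimately have "AE x in lborel. indicat_real {0<..<1} x *\<^sub>R ((F x \<bullet> b) * (F x \<bullet> b)) = 0"
      unfolding set_lebesgue_integral_def set_integrable_def
      by (subst (asm) integral_nonneg_eq_0_iff_AE) auto
    then have "AE x in lborel. x \<in> {0<..<1} \<longrightarrow> F x \<in> {y. b \<bullet> y = 0}"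
      by eventually_elim (auto simp: inner_commute)
    then have "F x \<in> {y. b \<bullet> y = 0}"
      by (intro continuous_AE_closed[OF c closed_hyperplane _ x])
    then show ?thesis by (simp add: inner_commute)
  qed
  then have "F x \<in> (W\<^sup>\<bottom>)\<^sup>\<bottom>"
    by (auto simp: orthogonal_comp_def orthogonal_def inner_commute)
  then show ?thesis using orthogonal_comp_self[OF W] by simp
qed

section \<open>The discrete-time system\<close>

text \<open>One step of the discrete-time system: the boundary relation for a pair \<open>(z(1,t), z(0,t))\<close> when the
  output is zero and the input, which can be solved for from the rows in \<open>U\<close>, is left free.\<close>

definition transition ::
    "complex^'n^'n \<Rightarrow> complex^'n^'n \<Rightarrow> 'n set \<Rightarrow> complex^'n^'m \<Rightarrow> complex^'n^'m \<Rightarrow>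
     ((complex^'n) \<times> (complex^'n)) set" where
  "transition K L U Ky Ly =
     {(x, x'). (\<forall>i. i \<notin> U \<longrightarrow> (K *v x' + L *v x) $ i = 0) \<and> Ky *v x' + Ly *v x = 0}"

text \<open>The viability kernel of the relation: the largest set whose points all have a successor in the set.\<close>

definition viable :: "('a \<times> 'a) set \<Rightarrow> 'a set" where
  "viable R = {x0. \<exists>x. x 0 = x0 \<and> (\<forall>k. (x k, x (Suc k)) \<in> R)}"

lemma trajectory_viable:
  assumes "\<And>k. (x k, x (Suc k)) \<in> R" shows "x k \<in> viable R"
  unfolding viable_def using assms by (auto intro!: exI[of _ "\<lambda>j. x (k + j)"])

lemma viable_step:
  assumes "x \<in> viable R" obtains x' where "x' \<in> viable R" "(x, x') \<in> R"
proof -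
  obtain y where y: "y 0 = x" "\<And>k. (y k, y (Suc k)) \<in> R"
    using assms unfolding viable_def by blast
  show thesis by (rule that[OF trajectory_viable[of y R "Suc 0"]]) (use y(2)[of 0] y in simp_all)
qed

lemma transition_add:
  assumes "(x, x') \<in> transition K L U Ky Ly" "(y, y') \<in> transition K L U Ky Ly"
  shows "(x + y, x' + y') \<in> transition K L U Ky Ly"
proof -
  have eq: "K *v (x' + y') + L *v (x + y) = (K *v x' + L *v x) + (K *v y' + L *v y)"
    "Ky *v (x' + y') + Ly *v (x + y) = (Ky *v x' + Ly *v x) + (Ky *v y' + Ly *v y)"
    by (simp_all add: matrix_vector_right_distrib)
  show ?thesis
    using assms unfolding transition_def mem_Collect_eq case_prod_conv eq
    by (metis (no_types, lifting) add_0 vector_add_component)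
qed

lemma transition_scale:
  assumes "(x, x') \<in> transition K L U Ky Ly"
  shows "(c *s x, c *s x') \<in> transition K L U Ky Ly"
proof -
  have eq: "K *v (c *s x') + L *v (c *s x) = c *s (K *v x' + L *v x)"
    "Ky *v (c *s x') + Ly *v (c *s x) = c *s (Ky *v x' + Ly *v x)"
    by (simp_all add: vector_scalar_commute vec.scale_right_distrib)
  show ?thesis
    using assms unfolding transition_def mem_Collect_eq case_prod_conv eq
    by (metis (no_types, lifting) mult_zero_right vec.scale_zero_right vector_smult_component)
qed

lemma transition_zero: "(0, 0) \<in> transition K L U Ky Ly"
  by (simp add: transition_def)

lemma subspace_viable_transition: "vec.subspace (viable (transition K L U Ky Ly))"
proof (rule vec.subspaceI)
  show "0 \<in> viable (transition K L U Ky Ly)"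
    unfolding viable_def using transition_zero by (auto intro!: exI[of _ "\<lambda>_. 0"])
next
  fix a b assume "a \<in> viable (transition K L U Ky Ly)" "b \<in> viable (transition K L U Ky Ly)"
  then obtain x y where "x 0 = a" "y 0 = b" "\<And>k. (x k, x (Suc k)) \<in> transition K L U Ky Ly"
    "\<And>k. (y k, y (Suc k)) \<in> transition K L U Ky Ly"
    unfolding viable_def by blast
  then show "a + b \<in> viable (transition K L U Ky Ly)"
    unfolding viable_def by (auto intro!: exI[of _ "\<lambda>k. x k + y k"] transition_add)
next
  fix c a assume "a \<in> viable (transition K L U Ky Ly)"
  then obtain x where "x 0 = a" "\<And>k. (x k, x (Suc k)) \<in> transition K L U Ky Ly"
    unfolding viable_def by blast
  then show "c *s a \<in> viable (transition K L U Ky Ly)"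
    unfolding viable_def by (auto intro!: exI[of _ "\<lambda>k. c *s x k"] transition_scale)
qed

lemma scaleR_conv_scale: "r *\<^sub>R x = complex_of_real r *s (x :: complex^'n)"
  by (simp add: vec_eq_iff scaleR_conv_of_real[where 'a = complex])

lemma vec_subspace_imp_subspace:
  "vec.subspace W \<Longrightarrow> subspace (W :: (complex^'n) set)"
  by (auto simp: subspace_def vec.subspace_def scaleR_conv_scale)

text \<open>Choose successors on a basis of \<open>W\<close> and extend linearly: as the relation is linear, the points at
  which the extension picks an admissible successor form a subspace.\<close>

lemma linear_feedback_exists:
  fixes W :: "(complex^'n) set"
  assumes W: "vec.subspace W" and step: "\<And>x. x \<in> W \<Longrightarrow> \<exists>x'\<in>W. (x, x') \<in> transition K L U Ky Ly"
  shows "\<exists>P :: complex^'n^'n. \<forall>x\<in>W. P *v x \<in> W \<and> (x, P *v x) \<in> transition K L U Ky Ly"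
proof -
  obtain f where f: "\<And>x. x \<in> W \<Longrightarrow> f x \<in> W \<and> (x, f x) \<in> transition K L U Ky Ly"
    using step by metis
  obtain B where B: "B \<subseteq> W" "vec.independent B" "W \<subseteq> vec.span B"
    by (rule vec.basis_exists[of W])
  obtain g where g: "Vector_Spaces.linear (*s) (*s) g" "\<And>x. x \<in> B \<Longrightarrow> g x = f x"
    using vec.linear_independent_extend[OF B(2), of f] by blast
  have lin: "matrix g *v (x + y) = matrix g *v x + matrix g *v y"
    "matrix g *v (c *s x) = c *s (matrix g *v x)" for x y c
    by (simp_all add: matrix_vector_right_distrib vector_scalar_commute)
  define S where "S = {x. matrix g *v x \<in> W \<and> (x, matrix g *v x) \<in> transition K L U Ky Ly}"
  have "vec.subspace S"
    using W unfolding S_def vec.subspace_def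
    by (auto simp: lin transition_zero intro: transition_add transition_scale)
  moreover have "B \<subseteq> S" unfolding S_def using f g B(1) by (auto simp: matrix_works)
  ultimately have "W \<subseteq> S" using B(3) vec.span_minimal by blast
  then show ?thesis by (intro exI[of _ "matrix g"]) (auto simp: S_def)
qed

section \<open>From trajectories to solutions of the zero dynamics\<close>

text \<open>The rows of the boundary condition, solved for the input.\<close>

definition input_of :: "real \<Rightarrow> complex^'n^'n \<Rightarrow> complex^'n^'n \<Rightarrow> (real \<Rightarrow> complex^'n) \<Rightarrow> real \<Rightarrow> complex^'n" where
  "input_of lam K L f t = - lam *\<^sub>R (K *v f (lam * t) + L *v f (lam * t - 1))"

lemma locally_L2_pair:
  fixes M N :: "complex^'n^'m"
  assumes f: "locally_L2 f" and "lam \<noteq> 0"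
  shows "locally_L2 (\<lambda>s. M *v f (lam * s) + N *v f (lam * s - 1))"
proof -
  have "locally_L2 (\<lambda>s. f (d + lam * s))" for d using assms by (rule locally_L2_affine)
  from locally_L2_add[OF locally_L2_linear[OF this[of 0], of "(*v) M"] locally_L2_linear[OF this[of "-1"], of "(*v) N"]]
  show ?thesis by simp
qed

context
  fixes lam :: real and K L :: "complex^'n^'n" and U :: "'n set" and Ky Ly :: "complex^'n^'m"
    and f :: "real \<Rightarrow> complex^'n"
  assumes lam: "lam > 0" and f: "locally_L2 f"
    and traj: "\<And>s. s > 0 \<Longrightarrow> (f (s - 1), f s) \<in> transition K L U Ky Ly"
begin

lemma input_signal_input_of: "input_signal U (input_of lam K L f)"
  unfolding input_signal_def
proof (intro conjI allI impI)
  have "locally_L2 (\<lambda>s. (- lam) *\<^sub>R (K *v f (lam * s) + L *v f (lam * s - 1)))"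
    by (rule locally_L2_linear[OF locally_L2_pair[OF f] bounded_linear_scaleR_right]) (use lam in simp)
  then show "L2_loc (input_of lam K L f)" unfolding input_of_def by (rule locally_L2_L2_loc)
  fix t :: real and i assume "t > 0" "i \<notin> U"
  then have "(K *v f (lam * t) + L *v f (lam * t - 1)) $ i = 0"
    using traj[of "lam * t"] lam by (simp add: transition_def)
  then show "input_of lam K L f t $ i = 0" by (simp add: input_of_def)
qed

lemma input_of_boundary:
  "(LINT s:{0<..<t}|lborel. input_of lam K L f s) =
     - lam *\<^sub>R (K *v wave_integral lam f t 0) - lam *\<^sub>R (L *v wave_integral lam f t 1)"
proof -
  have "(LINT s:{0<..<t}|lborel. input_of lam K L f s) =
     - lam *\<^sub>R (K *v wave_integral lam f t 0 + L *v wave_integral lam f t 1)"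
    unfolding input_of_def wave_boundary[OF f lam] by (rule set_integral_scaleR_right)
  then show ?thesis by (simp add: scaleR_add_right)
qed

lemma output_zero_boundary: "Ky *v wave_integral lam f t 0 + Ly *v wave_integral lam f t 1 = 0"
proof -
  have "(LINT s:{0<..<t}|lborel. Ky *v f (lam * s) + Ly *v f (lam * s - 1)) =
    (LINT s:{0<..<t}|lborel. (0 :: complex^'m))"
  proof (rule set_lebesgue_integral_cong)
    show "\<forall>s. s \<in> {0<..<t} \<longrightarrow> Ky *v f (lam * s) + Ly *v f (lam * s - 1) = 0"
      using traj[of "lam * s" for s] lam by (simp add: transition_def)
  qed simp
  then show ?thesis unfolding wave_boundary[OF f lam] by (simp add: set_lebesgue_integral_def)
qed

lemma unforced_rows_boundary:
  assumes "i \<notin> U"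
  shows "(K *v wave_integral lam f t 0 + L *v wave_integral lam f t 1) $ i = 0"
proof -
  have int: "set_integrable lborel {0<..<t} (\<lambda>s. K *v f (lam * s) + L *v f (lam * s - 1))"
    by (rule locally_L2_integrable[OF locally_L2_pair[OF f], of _ _ 0 t]) (use lam in auto)
  have "(K *v wave_integral lam f t 0 + L *v wave_integral lam f t 1) $ i =
    (LINT s|lborel. (indicat_real {0<..<t} s *\<^sub>R (K *v f (lam * s) + L *v f (lam * s - 1))) $ i)"
    unfolding wave_boundary[OF f lam] set_lebesgue_integral_def
    using integral_bounded_linear[OF bounded_linear_vec_nth int[unfolded set_integrable_def], of i] by simp
  also have "\<dots> = 0"
  proof (intro integral_eq_zero_AE AE_I2)
    fix s
    have "(K *v f (lam * s) + L *v f (lam * s - 1)) $ i = 0" if "s > 0"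
      using traj[of "lam * s"] lam assms that by (simp add: transition_def)
    then show "(indicat_real {0<..<t} s *\<^sub>R (K *v f (lam * s) + L *v f (lam * s - 1))) $ i = 0"
      by (simp add: indicator_def)
  qed
  finally show ?thesis by simp
qed

lemma zero_dynamics_of_trajectory:
  "(wave lam f 0, input_of lam K L f) \<in> zero_dynamics lam K L U Ky Ly"
proof -
  have "- lam *\<^sub>R (Ky *v wave_integral lam f t 0) - lam *\<^sub>R (Ly *v wave_integral lam f t 1) = 0" for t
  proof -
    have "- lam *\<^sub>R (Ky *v wave_integral lam f t 0) - lam *\<^sub>R (Ly *v wave_integral lam f t 1) =
      - lam *\<^sub>R (Ky *v wave_integral lam f t 0 + Ly *v wave_integral lam f t 1)"
      by (simp add: scaleR_add_right)
    then show ?thesis using output_zero_boundary[of t] by simp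
  qed
  moreover have "L2_loc (\<lambda>t. 0 :: complex^'m)" by (intro locally_L2_L2_loc locally_L2_continuous) simp
  moreover have "(LINT s:{0<..<t}|lborel. (0 :: complex^'m)) = 0" for t by (simp add: set_lebesgue_integral_def)
  ultimately have "mild_solution lam K L Ky Ly (wave lam f 0) (input_of lam K L f) (wave lam f) (\<lambda>t. 0)"
    unfolding mild_solution_def
    using transport_solution_wave[OF f lam] input_of_boundary by (intro conjI exI[of _ "wave_integral lam f"]) auto
  then show ?thesis unfolding zero_dynamics_def using input_signal_input_of by blast
qed

lemma zero_dynamics_solution_of_trajectory:
  assumes "\<And>t. t \<ge> 0 \<Longrightarrow> wave lam f t \<in> output_nulling_subspace lam K L U Ky Ly"
  shows "zero_dynamics_solution lam K L U Ky Ly (wave lam f 0) (wave lam f) (input_of lam K L f)"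
  unfolding zero_dynamics_solution_def
  using input_signal_input_of assms transport_solution_wave[OF f lam] unforced_rows_boundary
    output_zero_boundary input_of_boundary
  by (intro conjI exI[of _ "wave_integral lam f"] allI impI ballI) (simp_all del: scaleR_minus_left)

end

section \<open>Output nulling states\<close>

lemma matrix_vector_mult_minus_left: "(- A) *v x = - (A *v (x :: 'a::comm_ring_1^'n))"
  by (simp add: vec_eq_iff matrix_vector_mult_def sum_negf)

lemma delay_in:
  assumes "\<And>s. s < 0 \<Longrightarrow> b s \<in> W" "\<And>s x. s \<ge> 0 \<Longrightarrow> x \<in> W \<Longrightarrow> A x + f s \<in> W"
  shows "delay A b f s \<in> W"
  using assms
proof (induction A b f s rule: delay.induct)
  case (1 A b f s)
  then show ?case by (cases "s < 0") (simp_all add: delay_neg delay_nonneg)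
qed

lemma wave_delay_initial:
  assumes k: "locally_L2 k" and z0: "z0 = L2_class k" and b: "\<And>s. b s = k (- s)"
    and d: "locally_L2 (delay A b f)"
  shows "wave lam (delay A b f) 0 = z0"
proof -
  have "AE x in lborel. x \<in> {0<..<1} \<longrightarrow> delay A b f (0 - x) = k x"
    by (intro AE_I2) (simp add: delay_neg b)
  then show ?thesis
    unfolding wave_def z0
    using L2_class_eq_iff[OF locally_L2_square_integrable_01[OF locally_L2_reflect[OF d, of 0]]
        locally_L2_square_integrable_01[OF k]] by simp
qed

text \<open>Only the difference of the boundary values has to satisfy a linear feedback law, so two solutions
  driven by the same input are covered.\<close>

lemma transport_solution_unique:
  fixes A :: "complex^'n^'n"
  assumes 1: "transport_solution lam z0 z F" and 2: "transport_solution lam z0 z' F'" and lam: "lam > 0"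
    and A: "\<And>t. t \<ge> 0 \<Longrightarrow> F t 0 - F' t 0 = A *v (F t 1 - F' t 1)" and t: "t \<ge> 0"
  shows "z t = z' t" and "x \<in> {0..1} \<Longrightarrow> F t x = F' t x"
proof -
  obtain N where N: "\<And>x. norm (A *v x) \<le> norm x * N"
    using bounded_linear.bounded[OF matrix_vector_mul_bounded_linear[of A]] by blast
  have sol: "transport_solution lam 0 (\<lambda>t. z t - z' t) (\<lambda>t x. F t x - F' t x)"
    using transport_solution_diff[OF 1 2] by simp
  have bd: "norm (F t 0 - F' t 0) \<le> N * norm (F t 1 - F' t 1)" if "t \<ge> 0" for t
    using N[of "F t 1 - F' t 1"] A[OF that] by (simp add: mult.commute)
  show "z t = z' t" using transport_solution_unique_zero(1)[OF sol lam bd t] by simp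
  show "x \<in> {0..1} \<Longrightarrow> F t x = F' t x"
    using transport_solution_unique_zero(2)[OF sol lam bd t, of x] by simp
qed

lemma transport_solution_cong:
  assumes "\<And>t. t \<ge> 0 \<Longrightarrow> z t = z' t" "transport_solution lam z0 z F"
  shows "transport_solution lam z0 z' F"
proof -
  have "continuous_on {0..} z'"
    using assms by (subst continuous_on_cong[OF refl, of _ _ z]) (auto simp: transport_solution_def)
  moreover have "(z' has_integral Z) {0..t}" if "(z has_integral Z) {0..t}" for Z t
    using that assms(1) by (subst has_integral_cong[of _ _ z]) auto
  ultimately show ?thesis
    using assms unfolding transport_solution_def by metis
qed

lemma zero_dynamics_solution_cong:
  assumes "\<And>t. t \<ge> 0 \<Longrightarrow> z t = z' t" "zero_dynamics_solution lam K L U Ky Ly z0 z u"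
  shows "zero_dynamics_solution lam K L U Ky Ly z0 z' u"
  using assms transport_solution_cong[of z z' lam z0] unfolding zero_dynamics_solution_def by metis

lemma invertible_boundary:
  assumes "invertible (K :: complex^'n^'n)"
  obtains J :: "complex^'n^'n" where "\<And>x. J *v (K *v x) = x" "\<And>x. K *v (J *v x) = x"
  using assms unfolding invertible_def by (metis matrix_vector_mul_assoc matrix_vector_mul_lid)

text \<open>Solving the boundary condition for \<open>z(0,t)\<close>, which is possible as \<open>K\<close> is invertible, gives a delay
  equation driven by \<open>u\<close>. Its solution \<open>f\<close> yields a wave with the same initial state and the same
  input, so \<open>z\<close> is this wave by uniqueness. Vanishing of the integrated output for all times means
  that \<open>(f(s - 1), f(s))\<close> is an admissible step for almost every \<open>s > 0\<close>. Discarding countably many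
  translates of a null set leaves complete trajectories over almost every \<open>s > -1\<close>.\<close>

lemma mild_solution_output_nulling:
  fixes K L :: "complex^'n^'n" and Ky Ly :: "complex^'n^'m"
  assumes lam: "lam > 0" and K: "invertible K" and u: "input_signal U u"
    and sol: "mild_solution lam K L Ky Ly z0 u z (\<lambda>t. 0)"
  defines "W \<equiv> viable (transition K L U Ky Ly)"
  shows "z0 \<in> L2_on W" and "t \<ge> 0 \<Longrightarrow> z t \<in> L2_on W"
proof -
  obtain J :: "complex^'n^'n" where J: "\<And>x. J *v (K *v x) = x" "\<And>x. K *v (J *v x) = x"
    by (rule invertible_boundary[OF K]) blast
  obtain F where F: "transport_solution lam z0 z F"
    and Fu: "\<And>t. t \<ge> 0 \<Longrightarrow> (LINT s:{0<..<t}|lborel. u s) = - lam *\<^sub>R (K *v F t 0) - lam *\<^sub>R (L *v F t 1)"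
    and Fy: "\<And>t. t \<ge> 0 \<Longrightarrow> (LINT s:{0<..<t}|lborel. (0 :: complex^'m)) = - lam *\<^sub>R (Ky *v F t 0) - lam *\<^sub>R (Ly *v F t 1)"
    using sol unfolding mild_solution_def by blast
  obtain k where k: "locally_L2 k" "z0 = L2_class k" by (rule L2_cases_locally)
  define u' where "u' s = indicat_real {0<..} s *\<^sub>R u s" for s
  have u': "locally_L2 u'"
    unfolding u'_def using u by (intro locally_L2_extend_half_line) (simp add: input_signal_def)
  define A where "A x = - (J *v (L *v x))" for x
  define b where "b s = k (- s)" for s
  define r where "r s = - (1 / lam) *\<^sub>R (J *v u' (0 + (1 / lam) * s))" for s
  define f where "f = delay A b r"
  have "bounded_linear A"
    unfolding A_def
    by (rule bounded_linear_minus[OF bounded_linear_compose[OF matrix_vector_mul_bounded_linear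
        matrix_vector_mul_bounded_linear]])
  moreover have "locally_L2 b" unfolding b_def using locally_L2_reflect[OF k(1), of 0] by simp
  moreover have "locally_L2 r"
    unfolding r_def using lam
    by (intro locally_L2_linear[OF locally_L2_linear[OF locally_L2_affine[OF u'] matrix_vector_mul_bounded_linear]
        bounded_linear_scaleR_right]) simp
  ultimately have f: "locally_L2 f" unfolding f_def by (rule locally_L2_delay)
  have init: "wave lam f 0 = z0"
    unfolding f_def by (rule wave_delay_initial[OF k]) (use f in \<open>simp_all add: b_def f_def\<close>)
  have rec: "K *v f s + L *v f (s - 1) = - (1 / lam) *\<^sub>R u' (s / lam)" if "s \<ge> 0" for s
    unfolding f_def delay_nonneg[OF that] A_def r_def
    by (simp add: matrix_vector_right_distrib linear_simps[OF matrix_vector_mul_bounded_linear[of K]] J)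
  let ?F = "wave_integral lam f"
  have Ku: "K *v ?F t 0 + L *v ?F t 1 = - (1 / lam) *\<^sub>R (LINT s:{0<..<t}|lborel. u s)" for t
  proof -
    have "K *v ?F t 0 + L *v ?F t 1 = (LINT s:{0<..<t}|lborel. - (1 / lam) *\<^sub>R u s)"
      unfolding wave_boundary[OF f lam] using lam rec[of "lam * s" for s]
      by (intro set_lebesgue_integral_cong) (auto simp: u'_def)
    then show ?thesis by (simp only: set_integral_scaleR_right)
  qed
  have same: "K *v F t 0 + L *v F t 1 = K *v ?F t 0 + L *v ?F t 1" if "t \<ge> 0" for t
    unfolding Ku Fu[OF that] using lam by (simp add: scaleR_diff_right)
  have A: "F t 0 - ?F t 0 = (- (J ** L)) *v (F t 1 - ?F t 1)" if "t \<ge> 0" for t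
  proof -
    have "K *v (F t 0 - ?F t 0) = - (L *v (F t 1 - ?F t 1))"
      using same[OF that] by (simp add: matrix_vector_mult_diff_distrib algebra_simps)
    then have "J *v (K *v (F t 0 - ?F t 0)) = J *v (- (L *v (F t 1 - ?F t 1)))" by simp
    then have "F t 0 - ?F t 0 = J *v (- (L *v (F t 1 - ?F t 1)))" unfolding J .
    then show ?thesis
      by (simp add: linear_simps[OF matrix_vector_mul_bounded_linear[of J]] matrix_vector_mul_assoc
          matrix_vector_mult_minus_left)
  qed
  have F': "transport_solution lam z0 (wave lam f) ?F"
    using transport_solution_wave[OF f lam] init by simp
  have zw: "z t = wave lam f t" if "t \<ge> 0" for t
    by (rule transport_solution_unique(1)[OF F F' lam A that])
  have FF: "F t x = ?F t x" if "t \<ge> 0" "x \<in> {0..1}" for t x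
    by (rule transport_solution_unique(2)[OF F F' lam A that])
  have y0: "(LINT s:{0<..<t}|lborel. Ky *v f (lam * s) + Ly *v f (lam * s - 1)) = 0" if "t > 0" for t
  proof -
    have "- lam *\<^sub>R (Ky *v F t 0 + Ly *v F t 1) = 0"
      using Fy[of t] that by (simp add: set_lebesgue_integral_def scaleR_add_right)
    then show ?thesis
      unfolding wave_boundary[OF f lam, symmetric] using lam FF[of t 0] FF[of t 1] that by simp
  qed
  have "AE s in lborel. s > 0 \<longrightarrow> Ky *v f (lam * s) + Ly *v f (lam * s - 1) = 0"
    by (rule AE_zero_of_integral_zero[OF locally_L2_pair[OF f] y0]) (use lam in auto)
  then have "AE s in lborel. 0 + (1/lam) * s > 0 \<longrightarrow>
      Ky *v f (lam * (0 + (1/lam) * s)) + Ly *v f (lam * (0 + (1/lam) * s) - 1) = 0"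
    by (rule AE_affine) (use lam in simp)
  then have "AE s in lborel. s > 0 \<longrightarrow> (f (s - 1), f s) \<in> transition K L U Ky Ly"
  proof eventually_elim
    case (elim s)
    show ?case
    proof
      assume s: "s > 0"
      have "Ky *v f s + Ly *v f (s - 1) = 0" using elim lam s by simp
      moreover have "(K *v f s + L *v f (s - 1)) $ i = 0" if "i \<notin> U" for i
        unfolding rec[OF less_imp_le[OF s]] using u that s lam by (simp add: u'_def input_signal_def)
      ultimately show "(f (s - 1), f s) \<in> transition K L U Ky Ly" by (simp add: transition_def)
    qed
  qed
  then have "AE s in lborel. real (Suc k) + 1 * s > 0 \<longrightarrow>
      (f (real (Suc k) + 1 * s - 1), f (real (Suc k) + 1 * s)) \<in> transition K L U Ky Ly" for k
    by (rule AE_affine) simp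
  then have "AE s in lborel. \<forall>k. real (Suc k) + 1 * s > 0 \<longrightarrow>
      (f (real (Suc k) + 1 * s - 1), f (real (Suc k) + 1 * s)) \<in> transition K L U Ky Ly"
    unfolding AE_all_countable by blast
  then have fW: "AE s in lborel. s > - 1 \<longrightarrow> f s \<in> W"
  proof eventually_elim
    case (elim s)
    show ?case
    proof
      assume s: "s > - 1"
      have "(f (real k + s), f (real (Suc k) + s)) \<in> transition K L U Ky Ly" for k
        using elim[rule_format, of k] s by (simp add: algebra_simps)
      from trajectory_viable[of "\<lambda>k. f (real k + s)", OF this, of 0]
      show "f s \<in> W" by (simp add: W_def)
    qed
  qed
  have wW: "wave lam f t \<in> L2_on W" if "t \<ge> 0" for t by (rule wave_in_L2_on[OF f fW lam that])
  show "z0 \<in> L2_on W" using wW[of 0] init by simp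
  show "t \<ge> 0 \<Longrightarrow> z t \<in> L2_on W" using wW zw by simp
qed

section \<open>The port-Hamiltonian system on the viable subspace\<close>

context
  fixes lam :: real and K L P :: "complex^'n^'n" and U :: "'n set" and Ky Ly :: "complex^'n^'m"
    and W :: "(complex^'n) set"
  assumes lam: "lam > 0" and W_def: "W = viable (transition K L U Ky Ly)"
    and feedback: "\<forall>x\<in>W. P *v x \<in> W \<and> (x, P *v x) \<in> transition K L U Ky Ly"
begin

lemma feedback_in: "x \<in> W \<Longrightarrow> P *v x \<in> W"
  using feedback by blast

lemma feedback_transition: "x \<in> W \<Longrightarrow> (x, P *v x) \<in> transition K L U Ky Ly"
  using feedback by blast

lemma vec_subspace_W: "vec.subspace W" unfolding W_def by (rule subspace_viable_transition)

lemma subspace_W: "subspace W" using vec_subspace_W by (rule vec_subspace_imp_subspace)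

lemma feedback_wave:
  assumes "z0 \<in> L2_on W"
  obtains f where "locally_L2 f" "wave lam f 0 = z0" "\<And>s. f s \<in> W"
    "\<And>s. s > 0 \<Longrightarrow> f s = P *v f (s - 1)"
proof -
  obtain k where k: "locally_L2 k" "z0 = L2_class k" "\<And>x. k x \<in> W"
    by (rule L2_on_representative[OF assms closed_subspace[OF subspace_W] subspace_0[OF subspace_W]]) blast
  define b where "b s = k (- s)" for s
  define f where "f = delay ((*v) P) b (\<lambda>s. 0)"
  have "locally_L2 b" unfolding b_def using locally_L2_reflect[OF k(1), of 0] by simp
  then have f: "locally_L2 f"
    unfolding f_def by (rule locally_L2_delay[OF matrix_vector_mul_bounded_linear])
      (simp_all add: locally_L2_continuous)
  have fW: "f s \<in> W" for s
    unfolding f_def using k(3) feedback_in by (intro delay_in) (auto simp: b_def)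
  show thesis
  proof (rule that[OF f _ fW])
    show "wave lam f 0 = z0"
      unfolding f_def by (rule wave_delay_initial[OF k(1,2)]) (use f in \<open>simp_all add: b_def f_def\<close>)
    show "f s = P *v f (s - 1)" if "s > 0" for s unfolding f_def using that by (simp add: delay_nonneg)
  qed
qed

lemma feedback_wave_boundary:
  assumes f: "locally_L2 f" and rec: "\<And>s. s > 0 \<Longrightarrow> f s = P *v f (s - 1)"
  shows "wave_integral lam f t 0 = P *v wave_integral lam f t 1"
proof -
  have "mat 1 *v wave_integral lam f t 0 + (- P) *v wave_integral lam f t 1 =
    (LINT s:{0<..<t}|lborel. 0)"
    unfolding wave_boundary[OF f lam] using rec[of "lam * s" for s] lam
    by (intro set_lebesgue_integral_cong) (auto simp: matrix_vector_mult_minus_left)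
  then show ?thesis by (simp add: set_lebesgue_integral_def matrix_vector_mult_minus_left)
qed

lemma L2_on_W_subset:
  assumes "z0 \<in> L2_on W" shows "z0 \<in> output_nulling_subspace lam K L U Ky Ly"
proof -
  obtain f where f: "locally_L2 f" "wave lam f 0 = z0" "\<And>s. f s \<in> W"
    "\<And>s. s > 0 \<Longrightarrow> f s = P *v f (s - 1)" using feedback_wave[OF assms] by blast
  have "(f (s - 1), f s) \<in> transition K L U Ky Ly" if "s > 0" for s
    using feedback_transition[OF f(3)] f(4)[OF that] by simp
  from zero_dynamics_of_trajectory[OF lam f(1) this] show ?thesis
    unfolding output_nulling_subspace_def f(2) by blast
qed

lemma output_nulling_subspace_eq:
  assumes "invertible K"
  shows "output_nulling_subspace lam K L U Ky Ly = L2_on W"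
  using L2_on_W_subset mild_solution_output_nulling(1)[OF lam assms]
  unfolding output_nulling_subspace_def zero_dynamics_def W_def by blast

lemma phs_solution_iff:
  "phs_solution lam W (mat 1) (- P) z0 z \<longleftrightarrow> (\<forall>t\<ge>0. z t \<in> L2_on W) \<and>
     (\<exists>F. transport_solution lam z0 z F \<and> (\<forall>t\<ge>0. F t 0 = P *v F t 1))"
proof -
  have "- lam *\<^sub>R (mat 1 *v x) - lam *\<^sub>R (- P *v y) = 0 \<longleftrightarrow> x = P *v y" for x y :: "complex^'n"
  proof -
    have "- lam *\<^sub>R (mat 1 *v x) - lam *\<^sub>R (- P *v y) = - lam *\<^sub>R (x - P *v y)"
      by (simp add: matrix_vector_mult_minus_left scaleR_diff_right)
    then show ?thesis using lam by simp
  qed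
  then show ?thesis unfolding phs_solution_def by simp
qed

lemma phs_solution_unique:
  assumes "phs_solution lam W (mat 1) (- P) z0 z" "phs_solution lam W (mat 1) (- P) z0 z'" "t \<ge> 0"
  shows "z t = z' t"
proof -
  obtain F where F: "transport_solution lam z0 z F" "\<And>t. t \<ge> 0 \<Longrightarrow> F t 0 = P *v F t 1"
    using assms(1) unfolding phs_solution_iff by blast
  obtain F' where F': "transport_solution lam z0 z' F'" "\<And>t. t \<ge> 0 \<Longrightarrow> F' t 0 = P *v F' t 1"
    using assms(2) unfolding phs_solution_iff by blast
  show ?thesis
    by (rule transport_solution_unique(1)[OF F(1) F'(1) lam _ assms(3), of P])
      (simp add: F(2) F'(2) matrix_vector_mult_diff_distrib)
qed

lemma solution_exists:
  assumes K: "invertible K" and z0: "z0 \<in> L2_on W"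
  obtains z u where "phs_solution lam W (mat 1) (- P) z0 z" "zero_dynamics_solution lam K L U Ky Ly z0 z u"
proof -
  obtain f where f: "locally_L2 f" "wave lam f 0 = z0" "\<And>s. f s \<in> W"
    "\<And>s. s > 0 \<Longrightarrow> f s = P *v f (s - 1)" using feedback_wave[OF z0] by blast
  have tr: "(f (s - 1), f s) \<in> transition K L U Ky Ly" if "s > 0" for s
    using feedback_transition[OF f(3)] f(4)[OF that] by simp
  have W: "wave lam f t \<in> L2_on W" if "t \<ge> 0" for t
    by (rule wave_in_L2_on[OF f(1) _ lam that]) (use f(3) in simp)
  have "phs_solution lam W (mat 1) (- P) z0 (wave lam f)"
    unfolding phs_solution_iff
    using W transport_solution_wave[OF f(1) lam] f(2) feedback_wave_boundary[OF f(1,4)] by auto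
  moreover have "zero_dynamics_solution lam K L U Ky Ly z0 (wave lam f) (input_of lam K L f)"
    using zero_dynamics_solution_of_trajectory[OF lam f(1) tr] W
    unfolding f(2) output_nulling_subspace_eq[OF K] by blast
  ultimately show thesis by (rule that)
qed

text \<open>The closed-loop delay equation can be solved for every history, so \<open>z\<close> coincides with a wave that
  starts at \<open>z0\<close>. This identifies \<open>z0\<close> with \<open>z 0\<close>, which has values in \<open>W\<close>.\<close>

lemma phs_initial_in_W:
  assumes "phs_solution lam W (mat 1) (- P) z0 z" shows "z0 \<in> L2_on W"
proof -
  obtain F where F: "transport_solution lam z0 z F" "\<And>t. t \<ge> 0 \<Longrightarrow> F t 0 = P *v F t 1"
    and zW: "z 0 \<in> L2_on W"
    using assms unfolding phs_solution_iff by auto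
  obtain k where k: "locally_L2 k" "z0 = L2_class k" by (rule L2_cases_locally)
  define b where "b s = k (- s)" for s
  define f where "f = delay ((*v) P) b (\<lambda>s. 0)"
  have "locally_L2 b" unfolding b_def using locally_L2_reflect[OF k(1), of 0] by simp
  then have f: "locally_L2 f"
    unfolding f_def by (rule locally_L2_delay[OF matrix_vector_mul_bounded_linear])
      (simp_all add: locally_L2_continuous)
  have init: "wave lam f 0 = z0"
    unfolding f_def by (rule wave_delay_initial[OF k(1,2)]) (use f in \<open>simp_all add: b_def f_def\<close>)
  have rec: "f s = P *v f (s - 1)" if "s > 0" for s unfolding f_def using that by (simp add: delay_nonneg)
  have "z 0 = wave lam f 0"
    by (rule transport_solution_unique(1)[OF F(1) _ lam, of _ "wave_integral lam f" P])
      (use transport_solution_wave[OF f lam] init in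
        \<open>simp_all add: F(2) feedback_wave_boundary[OF f rec] matrix_vector_mult_diff_distrib\<close>)
  then show ?thesis using zW init by simp
qed

lemma zero_dynamics_of_phs_solution:
  assumes K: "invertible K" and z: "phs_solution lam W (mat 1) (- P) z0 z"
  shows "\<exists>u. zero_dynamics_solution lam K L U Ky Ly z0 z u"
proof -
  obtain z' u where z': "phs_solution lam W (mat 1) (- P) z0 z'"
    "zero_dynamics_solution lam K L U Ky Ly z0 z' u"
    using solution_exists[OF K phs_initial_in_W[OF z]] by blast
  then show ?thesis using phs_solution_unique[OF z'(1) z] zero_dynamics_solution_cong by blast
qed

text \<open>An admissible step from \<open>0\<close> to \<open>x\<close> in \<open>W\<close> would allow the following motion from the zero state: send in
  \<open>x\<close> during the first transit time and follow the feedback afterwards. The output stays zero, while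
  the input equals \<open>- lam K x\<close> on the first time interval.\<close>

lemma successor_of_zero:
  assumes K: "invertible K" and x: "x \<in> W" "(0, x) \<in> transition K L U Ky Ly"
    and det: "\<And>u. (0, u) \<in> zero_dynamics lam K L U Ky Ly \<Longrightarrow> (AE t in lborel. t > 0 \<longrightarrow> u t = 0)"
  shows "x = 0"
proof -
  obtain J :: "complex^'n^'n" where J: "\<And>x. J *v (K *v x) = x"
    by (rule invertible_boundary[OF K]) blast
  define r where "r s = indicat_real {0..<1} s *\<^sub>R x" for s :: real
  define f where "f = delay ((*v) P) (\<lambda>s. 0) r"
  have "locally_L2 r" unfolding r_def by (intro locally_L2_restrict locally_L2_continuous) auto
  then have f: "locally_L2 f"
    unfolding f_def by (intro locally_L2_delay[OF matrix_vector_mul_bounded_linear])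
      (simp_all add: locally_L2_continuous)
  have f_neg: "f s = 0" if "s < 0" for s using that by (simp add: f_def delay_neg)
  have f1: "f s = x" if "0 \<le> s" "s < 1" for s
    using that by (simp add: f_def delay_nonneg delay_neg r_def)
  have f2: "f s = P *v f (s - 1)" if "s \<ge> 1" for s
    using that by (simp add: f_def delay_nonneg r_def)
  have fW: "f s \<in> W" for s
    unfolding f_def using feedback_in x(1) subspace_0[OF subspace_W] subspace_add[OF subspace_W]
    by (intro delay_in) (auto simp: r_def indicator_def)
  have tr: "(f (s - 1), f s) \<in> transition K L U Ky Ly" if "s > 0" for s
    using that x(2) feedback_transition[OF fW] by (cases "s < 1") (auto simp: f1 f2 f_neg)
  have "wave lam f 0 = L2_class (\<lambda>x. 0)"
    unfolding wave_def
    by (subst L2_class_eq_iff)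
      (auto intro!: AE_I2 f_neg locally_L2_square_integrable_01 locally_L2_reflect[OF f, of 0, simplified] square_integrable_01_zero)
  then have "wave lam f 0 = 0" by (simp add: L2_class_zero)
  then have ae: "AE t in lborel. t > 0 \<longrightarrow> input_of lam K L f t = 0"
    using det zero_dynamics_of_trajectory[OF lam f tr] by simp
  have "K *v x = 0"
  proof (rule ccontr)
    assume Kx: "K *v x \<noteq> 0"
    have ne: "input_of lam K L f t \<noteq> 0" if "t \<in> {0<..<1/lam}" for t
    proof -
      have "0 < lam * t" "lam * t < 1" using that lam by (auto simp: pos_less_divide_eq mult.commute)
      then show ?thesis using Kx lam by (simp add: input_of_def f1 f_neg)
    qed
    have "AE t in lborel. t \<notin> {0<..<1/lam}"
      using ae by eventually_elim (use ne in auto)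
    then have "{0<..<1/lam} \<in> null_sets lborel" by (subst (asm) AE_iff_null_sets[symmetric]) auto
    then show False using lam by (simp add: null_sets_def)
  qed
  then show ?thesis using J[of x] by simp
qed

text \<open>The boundary values of any solution and the values prescribed by the feedback are two successors
  of the same point of \<open>W\<close>; their difference is a successor of \<open>0\<close>.\<close>

lemma phs_solution_of_zero_dynamics:
  assumes K: "invertible K" and z: "zero_dynamics_solution lam K L U Ky Ly z0 z u"
    and det: "\<And>u. (0, u) \<in> zero_dynamics lam K L U Ky Ly \<Longrightarrow> (AE t in lborel. t > 0 \<longrightarrow> u t = 0)"
  shows "phs_solution lam W (mat 1) (- P) z0 z"
proof -
  obtain F where F: "transport_solution lam z0 z F"
    and tr: "\<And>t. t \<ge> 0 \<Longrightarrow> (F t 1, F t 0) \<in> transition K L U Ky Ly"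
    and zW: "\<And>t. t \<ge> 0 \<Longrightarrow> z t \<in> L2_on W"
    using z unfolding zero_dynamics_solution_def output_nulling_subspace_eq[OF K] transition_def by blast
  have "F t 0 = P *v F t 1" if t: "t \<ge> 0" for t
  proof -
    obtain Z G where Z: "(z has_integral Z) {0..t}" "H1_rep Z (F t) G"
      using F t unfolding transport_solution_def by blast
    have FW: "F t x \<in> W" if "x \<in> {0..1}" for x
      by (rule L2_on_integral_trace[OF subspace_W _ Z that]) (use zW in auto)
    have "F t 0 - P *v F t 1 \<in> W"
      using FW[of 0] feedback_in[OF FW[of 1]] by (intro subspace_diff[OF subspace_W]) auto
    moreover have "(0, F t 0 - P *v F t 1) \<in> transition K L U Ky Ly"
      using transition_add[OF tr[OF t] transition_scale[OF feedback_transition[OF FW[of 1]], of "-1"]] by simp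
    ultimately have "F t 0 - P *v F t 1 = 0" by (rule successor_of_zero[OF K]) (rule det)
    then show ?thesis by simp
  qed
  then show ?thesis unfolding phs_solution_iff using F zW by blast
qed

end

section \<open>Well-posedness of the zero dynamics\<close>

lemma integral_unforced_component:
  assumes "input_signal U u" "i \<notin> U"
  shows "(LINT s:{0<..<t}|lborel. u s) $ i = 0"
proof -
  define v where "v s = indicat_real {0<..} s *\<^sub>R u s" for s
  have "locally_L2 v" unfolding v_def using assms(1) by (intro locally_L2_extend_half_line) (simp add: input_signal_def)
  then have "set_integrable lborel {0<..<t} v" by (rule locally_L2_integrable[of _ _ 0 t]) auto
  from integral_bounded_linear[OF bounded_linear_vec_nth this[unfolded set_integrable_def], of i]
  have "(LINT s:{0<..<t}|lborel. v s) $ i = (LINT s|lborel. (indicat_real {0<..<t} s *\<^sub>R v s) $ i)"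
    by (simp add: set_lebesgue_integral_def)
  also have "\<dots> = 0"
    using assms by (intro integral_eq_zero_AE AE_I2) (auto simp: v_def indicator_def input_signal_def)
  also have "(LINT s:{0<..<t}|lborel. v s) = (LINT s:{0<..<t}|lborel. u s)"
    by (intro set_lebesgue_integral_cong) (auto simp: v_def)
  finally show ?thesis .
qed

lemma zero_dynamics_solution_of_mild_solution:
  assumes lam: "lam > 0" and K: "invertible K" and u: "input_signal U u"
    and sol: "mild_solution lam K L Ky Ly z0 u z (\<lambda>t. 0)"
    and V: "output_nulling_subspace lam K L U Ky Ly = L2_on (viable (transition K L U Ky Ly))"
  shows "zero_dynamics_solution lam K L U Ky Ly z0 z u"
proof -
  obtain F where F: "transport_solution lam z0 z F"
    and Fu: "\<And>t. t \<ge> 0 \<Longrightarrow> (LINT s:{0<..<t}|lborel. u s) = - lam *\<^sub>R (K *v F t 0) - lam *\<^sub>R (L *v F t 1)"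
    and Fy: "\<And>t. t \<ge> 0 \<Longrightarrow> (LINT s:{0<..<t}|lborel. 0) = - lam *\<^sub>R (Ky *v F t 0) - lam *\<^sub>R (Ly *v F t 1)"
    using sol unfolding mild_solution_def by blast
  have comb: "- lam *\<^sub>R x - lam *\<^sub>R y = - lam *\<^sub>R (x + y)" for x y :: "complex^'c"
    by (simp add: scaleR_add_right)
  have "Ky *v F t 0 + Ly *v F t 1 = 0" if "t \<ge> 0" for t
    using Fy[OF that] lam unfolding comb by (simp add: set_lebesgue_integral_def)
  moreover have "(K *v F t 0 + L *v F t 1) $ i = 0" if "t \<ge> 0" "i \<notin> U" for t i
    using integral_unforced_component[OF u that(2), of t] lam unfolding Fu[OF that(1)] comb
    by (simp del: vector_add_component)
  ultimately show ?thesis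
    unfolding zero_dynamics_solution_def V
    using u F Fu mild_solution_output_nulling(2)[OF lam K u sol] by (intro conjI exI[of _ F] allI impI ballI) simp_all
qed

text \<open>The state determines its time integral, and the absolutely continuous representative of the
  latter is unique, so \<open>z\<close> determines the traces.\<close>

lemma transport_trace_unique:
  assumes 1: "transport_solution lam z0 z F" and 2: "transport_solution lam z0 z' F'"
    and eq: "\<And>t. t \<ge> 0 \<Longrightarrow> z t = z' t" and t: "t \<ge> 0" and x: "x \<in> {0..1}"
  shows "F t x = F' t x"
proof -
  obtain Z G where Z: "(z has_integral Z) {0..t}" "H1_rep Z (F t) G"
    using 1 t unfolding transport_solution_def by blast
  obtain Z' G' where Z': "(z' has_integral Z') {0..t}" "H1_rep Z' (F' t) G'"
    using 2 t unfolding transport_solution_def by blast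
  have "(z' has_integral Z) {0..t}" using Z(1) eq by (subst has_integral_cong[of _ _ z]) auto
  then have "Z = Z'" using Z'(1) by (rule has_integral_unique)
  then have "H1_rep 0 (\<lambda>x. F t x - F' t x) (G - G')" using H1_rep_diff[OF Z(2) Z'(2)] by simp
  from H1_rep_zero[OF this x] show ?thesis by simp
qed

lemma zero_dynamics_input_unique:
  assumes 1: "zero_dynamics_solution lam K L U Ky Ly z0 z u"
    and 2: "zero_dynamics_solution lam K L U Ky Ly z0 z' u'"
    and eq: "\<And>t. t \<ge> 0 \<Longrightarrow> z t = z' t"
  shows "AE t in lborel. t > 0 \<longrightarrow> u t = u' t"
proof -
  obtain F where F: "transport_solution lam z0 z F" and u: "input_signal U u"
    and Fu: "\<And>t i. t \<ge> 0 \<Longrightarrow> i \<in> U \<Longrightarrow> (LINT s:{0<..<t}|lborel. u s) $ i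
        = (- lam *\<^sub>R (K *v F t 0) - lam *\<^sub>R (L *v F t 1)) $ i"
    using 1 unfolding zero_dynamics_solution_def by blast
  obtain F' where F': "transport_solution lam z0 z' F'" and u': "input_signal U u'"
    and Fu': "\<And>t i. t \<ge> 0 \<Longrightarrow> i \<in> U \<Longrightarrow> (LINT s:{0<..<t}|lborel. u' s) $ i
        = (- lam *\<^sub>R (K *v F' t 0) - lam *\<^sub>R (L *v F' t 1)) $ i"
    using 2 unfolding zero_dynamics_solution_def by blast
  have FF: "F t x = F' t x" if "t \<ge> 0" "x \<in> {0..1}" for t x
    using transport_trace_unique[OF F F' eq that] .
  have int: "(LINT s:{0<..<t}|lborel. u s) = (LINT s:{0<..<t}|lborel. u' s)" if "t > 0" for t
    unfolding vec_eq_iff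
  proof
    fix i
    show "(LINT s:{0<..<t}|lborel. u s) $ i = (LINT s:{0<..<t}|lborel. u' s) $ i"
      by (cases "i \<in> U")
        (use that FF[of t 0] FF[of t 1] in \<open>simp_all add: Fu Fu' integral_unforced_component[OF u]
          integral_unforced_component[OF u']\<close>)
  qed
  let ?e = "\<lambda>(v :: real \<Rightarrow> complex^'a) s. indicat_real {0<..} s *\<^sub>R v s"
  have e: "locally_L2 (?e u)" "locally_L2 (?e u')"
    using u u' by (auto intro!: locally_L2_extend_half_line simp: input_signal_def)
  have zero: "(LINT s:{0<..<t}|lborel. ?e u s - ?e u' s) = 0" if t: "t > 0" for t
  proof -
    have "(LINT s:{0<..<t}|lborel. ?e u s - ?e u' s) =
      (LINT s:{0<..<t}|lborel. ?e u s) - (LINT s:{0<..<t}|lborel. ?e u' s)"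
      by (rule set_integral_diff(2); rule locally_L2_integrable[of _ _ 0 t]) (use e in auto)
    also have "(LINT s:{0<..<t}|lborel. ?e u s) = (LINT s:{0<..<t}|lborel. u s)"
      by (rule set_lebesgue_integral_cong) auto
    also have "(LINT s:{0<..<t}|lborel. ?e u' s) = (LINT s:{0<..<t}|lborel. u' s)"
      by (rule set_lebesgue_integral_cong) auto
    finally show ?thesis using int[OF t] by simp
  qed
  have "AE t in lborel. t > 0 \<longrightarrow> ?e u t - ?e u' t = 0"
    by (rule AE_zero_of_integral_zero[OF locally_L2_diff[OF e] zero])
  then show ?thesis by eventually_elim auto
qed

theorem theorem3p5:
  fixes lam :: real
    and K L :: "complex^'n^'n" and U :: "'n set"
    and Ky Ly :: "complex^'n^'m"
  defines "V \<equiv> output_nulling_subspace lam K L U Ky Ly"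
  defines "input_determined \<equiv>
    (\<forall>u. (0, u) \<in> zero_dynamics lam K L U Ky Ly \<longrightarrow> (AE t in lborel. t > 0 \<longrightarrow> u t = 0))"
  assumes "lam > 0" and "invertible K"
  shows "(\<forall>z0\<in>V. \<exists>z u. zero_dynamics_solution lam K L U Ky Ly z0 z u)
    \<and> (zero_dynamics_wellposed lam K L U Ky Ly \<longleftrightarrow> input_determined)
    \<and> (\<exists>W Y KW LW.
        port_hamiltonian_without_input W Y KW LW \<and> bij_betw ((*v) KW) W Y \<and>
        phs_wellposed lam W KW LW \<and> V = L2_on W \<and>
        (\<forall>z0 z. phs_solution lam W KW LW z0 z \<longrightarrow>
           (\<exists>u. zero_dynamics_solution lam K L U Ky Ly z0 z u)) \<and>
        (input_determined \<longrightarrow>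
           (\<forall>z0 z u. zero_dynamics_solution lam K L U Ky Ly z0 z u \<longrightarrow>
              phs_solution lam W KW LW z0 z)))"
proof -
  note lam = \<open>lam > 0\<close> and K = \<open>invertible K\<close>
  define W where "W = viable (transition K L U Ky Ly)"
  have sub: "vec.subspace W" unfolding W_def by (rule subspace_viable_transition)
  have step: "\<exists>x'\<in>W. (x, x') \<in> transition K L U Ky Ly" if "x \<in> W" for x
    using that unfolding W_def by (rule viable_step) (rule bexI)
  obtain P :: "complex^'n^'n"
    where feedback: "\<forall>x\<in>W. P *v x \<in> W \<and> (x, P *v x) \<in> transition K L U Ky Ly"
    using linear_feedback_exists[OF sub step] by blast
  note setting = lam W_def feedback
  have V: "V = L2_on W" unfolding V_def by (rule output_nulling_subspace_eq[OF setting K])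
  have exist: "\<exists>z u. zero_dynamics_solution lam K L U Ky Ly z0 z u" if "z0 \<in> V" for z0
    by (rule solution_exists[OF setting K that[unfolded V]]) blast
  have det_phs: "phs_solution lam W (mat 1) (- P) z0 z"
    if "input_determined" "zero_dynamics_solution lam K L U Ky Ly z0 z u" for z0 z u
    by (rule phs_solution_of_zero_dynamics[OF setting K that(2)])
      (use that(1) in \<open>simp add: input_determined_def\<close>)
  have wp1: "zero_dynamics_wellposed lam K L U Ky Ly" if det: input_determined
    unfolding zero_dynamics_wellposed_def
  proof (intro ballI conjI allI impI; (elim conjE)?)
    fix z0 assume "z0 \<in> output_nulling_subspace lam K L U Ky Ly"
    then show "\<exists>z u. zero_dynamics_solution lam K L U Ky Ly z0 z u" using exist by (simp add: V_def)
  next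
    fix z0 z u z' u'
    assume 1: "zero_dynamics_solution lam K L U Ky Ly z0 z u"
      and 2: "zero_dynamics_solution lam K L U Ky Ly z0 z' u'"
    have eq: "z t = z' t" if "t \<ge> 0" for t
      by (rule phs_solution_unique[OF setting det_phs[OF det 1] det_phs[OF det 2] that])
    then show "0 \<le> t \<Longrightarrow> z t = z' t" for t .
    show "AE t in lborel. t > 0 \<longrightarrow> u t = u' t"
      by (rule zero_dynamics_input_unique[OF 1 2 eq])
  qed
  have wp2: input_determined if wp: "zero_dynamics_wellposed lam K L U Ky Ly"
    unfolding input_determined_def
  proof (intro allI impI)
    fix u assume u: "(0, u) \<in> zero_dynamics lam K L U Ky Ly"
    then obtain z where "input_signal U u" "mild_solution lam K L Ky Ly 0 u z (\<lambda>t. 0)"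
      unfolding zero_dynamics_def by blast
    from zero_dynamics_solution_of_mild_solution[OF lam K this V[unfolded V_def W_def]]
    have 1: "zero_dynamics_solution lam K L U Ky Ly 0 z u" .
    have zero: "locally_L2 (\<lambda>s. 0 :: complex^'n)" by (simp add: locally_L2_continuous)
    have w0: "wave lam (\<lambda>s. 0 :: complex^'n) t = 0" for t by (simp add: wave_def L2_class_zero)
    have "0 \<in> V" using u unfolding V_def output_nulling_subspace_def by blast
    then have "zero_dynamics_solution lam K L U Ky Ly 0 (wave lam (\<lambda>s. 0)) (input_of lam K L (\<lambda>s. 0))"
      using zero_dynamics_solution_of_trajectory[OF lam zero, of K L U Ky Ly]
      by (simp add: w0 V_def transition_zero)
    with 1 wp \<open>0 \<in> V\<close> have "AE t in lborel. t > 0 \<longrightarrow> u t = input_of lam K L (\<lambda>s. 0) t"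
      unfolding zero_dynamics_wellposed_def V_def by blast
    then show "AE t in lborel. t > 0 \<longrightarrow> u t = 0" by (simp add: input_of_def)
  qed
  have port: "port_hamiltonian_without_input W W (mat 1) (- P)"
    unfolding port_hamiltonian_without_input_def
    using sub feedback by (auto simp: matrix_vector_mult_minus_left vec.subspace_neg)
  have bij: "bij_betw ((*v) (mat 1 :: complex^'n^'n)) W W"
    by (rule bij_betwI[where g = "\<lambda>x. x"]) auto
  have wp: "phs_wellposed lam W (mat 1) (- P)"
    unfolding phs_wellposed_def
  proof (intro ballI conjI allI impI; (elim conjE)?)
    fix z0 assume z0: "z0 \<in> L2_on W"
    show "\<exists>z. phs_solution lam W (mat 1) (- P) z0 z"
      by (rule solution_exists[OF setting K z0]) blast
  qed (rule phs_solution_unique[OF setting])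
  have zd: "\<forall>z0 z. phs_solution lam W (mat 1) (- P) z0 z \<longrightarrow>
      (\<exists>u. zero_dynamics_solution lam K L U Ky Ly z0 z u)"
    using zero_dynamics_of_phs_solution[OF setting K] by blast
  show ?thesis
  proof (intro conjI)
    show "\<forall>z0\<in>V. \<exists>z u. zero_dynamics_solution lam K L U Ky Ly z0 z u" using exist by blast
    show "zero_dynamics_wellposed lam K L U Ky Ly \<longleftrightarrow> input_determined" using wp1 wp2 by blast
    show "\<exists>W Y KW LW.
        port_hamiltonian_without_input W Y KW LW \<and> bij_betw ((*v) KW) W Y \<and>
        phs_wellposed lam W KW LW \<and> V = L2_on W \<and>
        (\<forall>z0 z. phs_solution lam W KW LW z0 z \<longrightarrow>
           (\<exists>u. zero_dynamics_solution lam K L U Ky Ly z0 z u)) \<and>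
        (input_determined \<longrightarrow>
           (\<forall>z0 z u. zero_dynamics_solution lam K L U Ky Ly z0 z u \<longrightarrow>
              phs_solution lam W KW LW z0 z))"
      by (rule exI[of _ W], rule exI[of _ W], rule exI[of _ "mat 1"], rule exI[of _ "- P"])
        (intro conjI port bij wp V zd impI allI det_phs)
  qed
qed

end
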